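(* Let $\alpha=\{\alpha_n\}_{n\in\mathbb{N}}$ and $\beta=\{\beta_n\}_{n\in\mathbb{N}}$ be null sequences (of non-negative reals) and let $f:\mathbb{N}\to\mathbb{N}$ satisfy $f(n)>n$. Define $$S_{f,\alpha,\beta}=\left\{(T,x,z)\in\Omega^{\mathrm{N}}_{f,\alpha,\beta}\times\mathbb{C}: z\in\mathbb{C}\setminus\sigma(T)\right\}$$ and for $(T,x)\in\Omega^{\mathrm{N}}_{f,\alpha,\beta}$ let $C_1=C_1(T,x)$, $C_2=C_2(T,x)\in\mathbb{R}_{\ge0}$ be such that 1. $\|(I-P_{f(n)})TP_n\|\le C_1\alpha_n$, 2. $\|P_nx-x\|\le C_2\beta_n$. Then there exists a sequence of arithmetic algorithms $\Gamma_n:S_{f,\alpha,\beta}\to l^2(\mathbb{N})$, each of which uses the evaluation functions in $\Lambda_1$, such that each vector $\Gamma_n(T,x,z)$ has finite support with respect to the canonical basis, and $$\lim_{n\to\infty}\Gamma_n(T,x,z)=R(z,T)x\quad\text{in } l^2(\mathbb{N}).$$ Moreover, the following error bound holds: $$\|\Gamma_n(T,x,z)-R(z,T)x\|\le\frac{C_2\beta_{f(n)}+C_1\alpha_n\|\Gamma_n(T,x,z)\|+\|P_{f(n)}(T-zI)\Gamma_n(T,x,z)-P_{f(n)}x\|}{\mathrm{dist}(z,\sigma(T))}.$$ If bounds on $C_1$ and $C_2$ are known, this error bound can be computed to arbitrary accuracy using finitely many arithmetic operations and comparisons.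
   Context: $l^2(\mathbb{N})$ has canonical basis $\{e_n\}_{n\in\mathbb{N}}$ and $P_n$ is the orthogonal projection onto $\mathrm{span}\{e_1,\dots,e_n\}$. $\mathcal{C}(l^2(\mathbb{N}))$ is the set of closed densely defined linear operators $T$ on $l^2(\mathbb{N})$ such that $\mathrm{span}\{e_n:n\in\mathbb{N}\}$ is a core of $T$ and of $T^*$. $\Omega_{\mathrm{N}}\subset\mathcal{C}(l^2(\mathbb{N}))$ is the subclass of (possibly unbounded) normal operators, i.e. $\mathcal{D}(T)=\mathcal{D}(T^* )$ and $\|Tx\|=\|T^*x\|$ on this domain. $\sigma(T)$ is the spectrum and $R(z,T)=(T-zI)^{-1}$ for $z\notin\sigma(T)$. Set $$\Omega^{\mathrm{N}}_{f,\alpha,\beta}=\{T\in\Omega_{\mathrm{N}}:\|(P_{f(n)}-I)TP_n\|=O(\alpha_n)\}\times\{x\in l^2(\mathbb{N}):\|P_nx-x\|=O(\beta_n)\},$$ where the $O$-constants may depend on $T$ or $x$; when $\alpha_n\equiv0$ one requires $\|(P_{f(n)}-I)TP_n\|=0$. A null sequence is a sequence converging to zero. The evaluation set is $\Lambda_1=\{\langle Te_j,e_i\rangle:i,j\in\mathbb{N}\}$, extended by the evaluations of the coefficients of $x$ (and the input $z$). The function $f$ and the sequence $\alpha$ can also be considered as inputs to the algorithm. General and arithmetic algorithms: given a set $\Omega$ of inputs, a metric space $\mathcal{M}$ and a set $\Lambda$ of complex-valued evaluation functions on $\Omega$, a general algorithm is a map $\Gamma:\Omega\to\mathcal{M}$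 such that for every $A\in\Omega$ there is a finite non-empty $\Lambda_\Gamma(A)\subset\Lambda$ for which $\Gamma(A)$ depends only on $\{g(A)\}_{g\in\Lambda_\Gamma(A)}$, and $\Lambda_\Gamma(B)=\Lambda_\Gamma(A)$ whenever $g(B)=g(A)$ for all $g\in\Lambda_\Gamma(A)$. A sequence of general algorithms $\Gamma_n$ is a sequence of arithmetic algorithms if, for each $A$, $n\mapsto\Gamma_n(A)$ is recursive (executable by a Turing machine with oracle access to the values $g(A)$ if these are rational, and by a Blum--Shub--Smale machine with such an oracle if they are real or complex), only finitely many arithmetic operations and comparisons on $\{g(A)\}_{g\in\Lambda_{\Gamma_n}(A)}$ are used, and the output is a finite string of complex numbers identified with an element of $\mathcal{M}$.
   Formalization: The last sentence fails as stated, since dist(z,σ(T)) cannot be computed with error control; instead the bound is computed to accuracy ε when dist(z,σ(T)) is also given, and, without it, by finite computations that converge to the bound with no known rate. *)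

theory Defs
  imports "HOL-Analysis.Analysis"
begin

section \<open>The Hilbert space of square-summable sequences\<close>

text \<open>Coordinates are counted from 0: \<open>coeff x k\<close> is the coefficient of \<open>x\<close> along the
  canonical basis vector usually called \<open>e\<^sub>k\<^sub>+\<^sub>1\<close>.\<close>

typedef ell2 = "{x :: nat \<Rightarrow> complex. summable (\<lambda>k. (cmod (x k))\<^sup>2)}"
  morphisms coeff Abs_ell2
  by (rule exI[of _ "\<lambda>_. 0"]) simp

setup_lifting type_definition_ell2

lemma summable_coeff: "summable (\<lambda>k. (cmod (coeff x k))\<^sup>2)"
  using coeff[of x] by simp

lemma cmod_add_sq_le: "(cmod (a + b))\<^sup>2 \<le> 2 * (cmod a)\<^sup>2 + 2 * (cmod b)\<^sup>2"
proof -
  have "(cmod (a + b))\<^sup>2 \<le> (cmod a + cmod b)\<^sup>2"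
    by (intro power_mono norm_triangle_ineq norm_ge_zero)
  also have "\<dots> \<le> 2 * (cmod a)\<^sup>2 + 2 * (cmod b)\<^sup>2"
    using sum_squares_bound[of "cmod a" "cmod b"] by (simp add: power2_sum)
  finally show ?thesis .
qed

lemma summable_ell2_add:
  assumes "summable (\<lambda>k. (cmod (x k))\<^sup>2)" "summable (\<lambda>k. (cmod (y k))\<^sup>2)"
  shows "summable (\<lambda>k. (cmod (x k + y k))\<^sup>2)"
proof (rule summable_comparison_test')
  show "summable (\<lambda>k. 2 * (cmod (x k))\<^sup>2 + 2 * (cmod (y k))\<^sup>2)"
    using assms by (intro summable_add summable_mult)
  show "norm ((cmod (x k + y k))\<^sup>2) \<le> 2 * (cmod (x k))\<^sup>2 + 2 * (cmod (y k))\<^sup>2" for k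
    using cmod_add_sq_le by simp
qed

lemma summable_ell2_mult:
  assumes "summable (\<lambda>k. (cmod (x k))\<^sup>2)"
  shows "summable (\<lambda>k. (cmod (c * x k))\<^sup>2)"
  using summable_mult[OF assms, of "(cmod c)\<^sup>2"] by (simp add: norm_mult power_mult_distrib)

lemma summable_ell2_cinner:
  assumes "summable (\<lambda>k. (cmod (x k))\<^sup>2)" "summable (\<lambda>k. (cmod (y k))\<^sup>2)"
  shows "summable (\<lambda>k. x k * cnj (y k))"
proof (rule summable_comparison_test')
  show "summable (\<lambda>k. (cmod (x k))\<^sup>2 + (cmod (y k))\<^sup>2)"
    using assms by (intro summable_add)
  show "norm (x k * cnj (y k)) \<le> (cmod (x k))\<^sup>2 + (cmod (y k))\<^sup>2" for k
    using sum_squares_bound[of "cmod (x k)" "cmod (y k)"] mult_nonneg_nonneg[of "cmod (x k)" "cmod (y k)"]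
    by (simp add: norm_mult del: mult_nonneg_nonneg)
qed

lift_definition cscale :: "complex \<Rightarrow> ell2 \<Rightarrow> ell2"  (infixr \<open>*\<^sub>C\<close> 75)
  is "\<lambda>c x k. c * x k"
  by (rule summable_ell2_mult)

text \<open>The inner product is linear in its first argument.\<close>

lift_definition cinner :: "ell2 \<Rightarrow> ell2 \<Rightarrow> complex"
  is "\<lambda>x y. \<Sum>k. x k * cnj (y k)" .

instantiation ell2 :: real_inner
begin

lift_definition zero_ell2 :: ell2 is "\<lambda>_. 0" by simp
lift_definition plus_ell2 :: "ell2 \<Rightarrow> ell2 \<Rightarrow> ell2" is "\<lambda>x y k. x k + y k"
  by (rule summable_ell2_add)
lift_definition uminus_ell2 :: "ell2 \<Rightarrow> ell2" is "\<lambda>x k. - x k" by simp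
lift_definition minus_ell2 :: "ell2 \<Rightarrow> ell2 \<Rightarrow> ell2" is "\<lambda>x y k. x k - y k"
  using summable_ell2_add[of _ "\<lambda>k. - _ k"] by simp
lift_definition scaleR_ell2 :: "real \<Rightarrow> ell2 \<Rightarrow> ell2" is "\<lambda>r x k. of_real r * x k"
  by (rule summable_ell2_mult)
lift_definition norm_ell2 :: "ell2 \<Rightarrow> real" is "\<lambda>x. sqrt (\<Sum>k. (cmod (x k))\<^sup>2)" .
definition inner_ell2 :: "ell2 \<Rightarrow> ell2 \<Rightarrow> real" where "inner_ell2 x y = Re (cinner x y)"
definition sgn_ell2 :: "ell2 \<Rightarrow> ell2" where "sgn_ell2 x = scaleR (inverse (norm x)) x"
definition dist_ell2 :: "ell2 \<Rightarrow> ell2 \<Rightarrow> real" where "dist_ell2 x y = norm (x - y)"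
definition uniformity_ell2 :: "(ell2 \<times> ell2) filter"
  where "uniformity_ell2 = (INF e\<in>{0<..}. principal {(x, y). dist x y < e})"
definition open_ell2 :: "ell2 set \<Rightarrow> bool"
  where "open_ell2 U = (\<forall>x\<in>U. \<forall>\<^sub>F (x', y) in uniformity. x' = x \<longrightarrow> y \<in> U)"

lemma Re_cinner_sums:
  "(\<lambda>k. Re (coeff x k * cnj (coeff y k))) sums Re (cinner x y)"
  unfolding cinner.rep_eq
  by (intro sums_Re summable_sums summable_ell2_cinner summable_coeff)

instance
proof
  fix x y z :: ell2 and a b :: real
  show "x + y + z = x + (y + z)" by transfer (auto simp: add.assoc)
  show "x + y = y + x" by transfer (auto simp: add.commute)
  show "0 + x = x" by transfer auto
  show "- x + x = 0" by transfer auto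
  show "x - y = x + - y" by transfer auto
  show "a *\<^sub>R (x + y) = a *\<^sub>R x + a *\<^sub>R y" by transfer (auto simp: algebra_simps)
  show "(a + b) *\<^sub>R x = a *\<^sub>R x + b *\<^sub>R x" by transfer (auto simp: algebra_simps)
  show "a *\<^sub>R b *\<^sub>R x = (a * b) *\<^sub>R x" by transfer (auto simp: algebra_simps)
  show "1 *\<^sub>R x = x" by transfer auto
  show "dist x y = norm (x - y)" by (rule dist_ell2_def)
  show "sgn x = inverse (norm x) *\<^sub>R x" by (rule sgn_ell2_def)
  show "uniformity = (INF e\<in>{0<..}. principal {(x, y :: ell2). dist x y < e})"
    by (rule uniformity_ell2_def)
  show "open U = (\<forall>x\<in>U. \<forall>\<^sub>F (x', y) in uniformity. x' = x \<longrightarrow> y \<in> U)" for U :: "ell2 set"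
    by (rule open_ell2_def)
  have eq: "inner x y = (\<Sum>k. Re (coeff x k * cnj (coeff y k)))" for x y :: ell2
    using Re_cinner_sums[of x y] by (simp add: inner_ell2_def sums_iff)
  have sm: "summable (\<lambda>k. Re (coeff x k * cnj (coeff y k)))" for x y :: ell2
    using Re_cinner_sums[of x y] by (simp add: sums_iff)
  have sq: "inner x x = (\<Sum>k. (cmod (coeff x k))\<^sup>2)" for x :: ell2
    unfolding eq by (simp only: complex_norm_square[symmetric] Re_complex_of_real)
  show "inner x y = inner y x"
    unfolding eq by (simp add: mult.commute)
  show "inner (x + y) z = inner x z + inner y z"
    unfolding eq using suminf_add[OF sm[of x z] sm[of y z]]
    by (simp add: plus_ell2.rep_eq algebra_simps)
  show "inner (a *\<^sub>R x) y = a * inner x y"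
    unfolding eq using suminf_mult[OF sm[of x y], of a]
    by (simp add: scaleR_ell2.rep_eq algebra_simps)
  show "0 \<le> inner x x"
    unfolding sq by (intro suminf_nonneg summable_coeff) simp
  show "inner x x = 0 \<longleftrightarrow> x = 0"
    unfolding sq using suminf_eq_zero_iff[OF summable_coeff[of x]]
    by (simp add: coeff_inject[symmetric] zero_ell2.rep_eq fun_eq_iff)
  show "norm x = sqrt (inner x x)"
    unfolding sq by (simp add: norm_ell2.rep_eq)
qed

end

global_interpretation cvec: vector_space cscale
  by unfold_locales (transfer; auto simp: algebra_simps)+

lift_definition basis_vec :: "nat \<Rightarrow> ell2" is "\<lambda>n k. if k = n then 1 else 0"
  by (rule summable_finite[of "{_}"]) auto


lift_definition proj :: "nat \<Rightarrow> ell2 \<Rightarrow> ell2" is "\<lambda>n x k. if k < n then x k else 0"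
  by (rule summable_comparison_test', assumption) auto

lemma proj_eq_sum: "proj n x = (\<Sum>k<n. cinner x (basis_vec k) *\<^sub>C basis_vec k)"
proof -
  have coeff_sum: "coeff (sum g A) j = (\<Sum>k\<in>A. coeff (g k) j)" for g :: "nat \<Rightarrow> ell2" and A j
    by (induction A rule: infinite_finite_induct) (auto simp: zero_ell2.rep_eq plus_ell2.rep_eq)
  have ci: "cinner x (basis_vec k) = coeff x k" for k
  proof -
    have "(\<Sum>j. coeff x j * cnj (coeff (basis_vec k) j)) = (\<Sum>j\<in>{k}. coeff x j * cnj (coeff (basis_vec k) j))"
      by (rule suminf_finite) (auto simp: basis_vec.rep_eq)
    thus ?thesis by (simp add: cinner.rep_eq basis_vec.rep_eq)
  qed
  have "coeff (proj n x) j = coeff (\<Sum>k<n. cinner x (basis_vec k) *\<^sub>C basis_vec k) j" for j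
    by (simp add: coeff_sum ci cscale.rep_eq basis_vec.rep_eq proj.rep_eq if_distrib sum.delta' cong: if_cong)
  thus ?thesis by (metis coeff_inject ext)
qed

section \<open>Unbounded operators\<close>

text \<open>A partially defined operator is represented by its graph.\<close>

type_synonym operator = "(ell2 \<times> ell2) set"

definition linear_operator :: "operator \<Rightarrow> bool" where
  "linear_operator T \<longleftrightarrow> single_valued T \<and> (0, 0) \<in> T \<and>
     (\<forall>(x, y)\<in>T. \<forall>(x', y')\<in>T. (x + x', y + y') \<in> T) \<and>
     (\<forall>c. \<forall>(x, y)\<in>T. (c *\<^sub>C x, c *\<^sub>C y) \<in> T)"

definition app :: "operator \<Rightarrow> ell2 \<Rightarrow> ell2" where
  "app T x = (THE y. (x, y) \<in> T)"

definition adjoint :: "operator \<Rightarrow> operator" where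
  "adjoint T = {(y, w). \<forall>(x, v)\<in>T. cinner v y = cinner x w}"

definition is_core :: "ell2 set \<Rightarrow> operator \<Rightarrow> bool" where
  "is_core D T \<longleftrightarrow> D \<subseteq> Domain T \<and> closure {(x, y) \<in> T. x \<in> D} = T"

definition C_ell2 :: "operator set" where
  "C_ell2 = {T. linear_operator T \<and> closed T \<and> closure (Domain T) = UNIV \<and>
     is_core (cvec.span (range basis_vec)) T \<and>
     is_core (cvec.span (range basis_vec)) (adjoint T)}"

definition Omega_N :: "operator set" where
  "Omega_N = {T \<in> C_ell2. Domain T = Domain (adjoint T) \<and>
     (\<forall>x\<in>Domain T. norm (app T x) = norm (app (adjoint T) x))}"

definition shift :: "operator \<Rightarrow> complex \<Rightarrow> operator" where
  "shift T z = {(x, y - z *\<^sub>C x) | x y. (x, y) \<in> T}"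

definition spectrum :: "operator \<Rightarrow> complex set" where
  "spectrum T = {z. \<not> (\<exists>R. bounded_linear R \<and> (shift T z)\<inverse> = {(y, R y) | y. True})}"

definition resolvent :: "complex \<Rightarrow> operator \<Rightarrow> ell2 \<Rightarrow> ell2" where
  "resolvent z T = app ((shift T z)\<inverse>)"

text \<open>\<open>dispersion T m n\<close> is the operator norm of \<open>(I - P\<^sub>m) T P\<^sub>n\<close>.\<close>

definition dispersion :: "operator \<Rightarrow> nat \<Rightarrow> nat \<Rightarrow> real" where
  "dispersion T m n = onorm (\<lambda>v. app T (proj n v) - proj m (app T (proj n v)))"

text \<open>Here and below, sequences are indexed by the positive integers: their value at 0 is
  irrelevant. The bounds \<open>O(\<alpha>\<^sub>n)\<close> and \<open>O(\<beta>\<^sub>n)\<close> are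
  meant for all indices \<open>n \<ge> 1\<close>, so that a vanishing \<open>\<alpha>\<^sub>n\<close> forces the
  corresponding dispersion to vanish.\<close>

definition Omega_N_f ::
  "(nat \<Rightarrow> nat) \<Rightarrow> (nat \<Rightarrow> real) \<Rightarrow> (nat \<Rightarrow> real) \<Rightarrow> (operator \<times> ell2) set" where
  "Omega_N_f f \<alpha> \<beta> =
     {T \<in> Omega_N. \<exists>C. \<forall>n\<ge>1. dispersion T (f n) n \<le> C * \<alpha> n} \<times>
     {x. \<exists>C. \<forall>n\<ge>1. norm (proj n x - x) \<le> C * \<beta> n}"

type_synonym input = "operator \<times> ell2 \<times> complex"

definition S_class ::
  "(nat \<Rightarrow> nat) \<Rightarrow> (nat \<Rightarrow> real) \<Rightarrow> (nat \<Rightarrow> real) \<Rightarrow> input set" where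
  "S_class f \<alpha> \<beta> = {(T, x, z). (T, x) \<in> Omega_N_f f \<alpha> \<beta> \<and> z \<notin> spectrum T}"

text \<open>Any upper bounds of admissible constants are admissible again, as the sequences are
  nonnegative.\<close>

definition admissible_constants ::
  "(nat \<Rightarrow> nat) \<Rightarrow> (nat \<Rightarrow> real) \<Rightarrow> (nat \<Rightarrow> real) \<Rightarrow> operator \<Rightarrow> ell2 \<Rightarrow> real \<Rightarrow> real \<Rightarrow> bool" where
  "admissible_constants f \<alpha> \<beta> T x C\<^sub>1 C\<^sub>2 \<longleftrightarrow> 0 \<le> C\<^sub>1 \<and> 0 \<le> C\<^sub>2 \<and>
     (\<forall>n\<ge>1. dispersion T (f n) n \<le> C\<^sub>1 * \<alpha> n) \<and>
     (\<forall>n\<ge>1. norm (proj n x - x) \<le> C\<^sub>2 * \<beta> n)"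

text \<open>In \<open>error_bound\<close> the vector \<open>y\<close> is the approximation of the
  resolvent applied to \<open>x\<close>.\<close>

definition error_bound ::
  "(nat \<Rightarrow> nat) \<Rightarrow> (nat \<Rightarrow> real) \<Rightarrow> (nat \<Rightarrow> real) \<Rightarrow> real \<Rightarrow> real \<Rightarrow> nat \<Rightarrow>
   operator \<Rightarrow> ell2 \<Rightarrow> complex \<Rightarrow> ell2 \<Rightarrow> real" where
  "error_bound f \<alpha> \<beta> C\<^sub>1 C\<^sub>2 n T x z y =
     (C\<^sub>2 * \<beta> (f n) + C\<^sub>1 * \<alpha> n * norm y +
        norm (proj (f n) (app (shift T z) y) - proj (f n) x)) /
     infdist z (spectrum T)"

section \<open>Blum--Shub--Smale machines with oracles\<close>

text \<open>
  Machines over the reals, in the random access form of the Blum--Shub--Smale model: a finite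
  program acts on real registers \<open>Z\<^sub>0, Z\<^sub>1, \<dots>\<close> and on natural number registers
  \<open>I\<^sub>0, I\<^sub>1, \<dots>\<close>, which serve as counters and as addresses of real
  registers. A complex number is a pair of reals. No real constants are built in, except those
  obtained from natural numbers; hence on rational data all registers remain rational
  and a program can be run by a Turing machine. Programs can divide by 0, with result 0.

  A machine accesses its input only through oracle calls. A complex-valued oracle, with names
  \<open>'q\<close> and two natural number arguments, gives the values of the evaluation functions.
  A list of real sequences holds further data which do not vary with the input.
\<close>

datatype arith = Plus | Minus | Times | Divide

fun nat_arith :: "arith \<Rightarrow> nat \<Rightarrow> nat \<Rightarrow> nat" where
  "nat_arith Plus a b = a + b"
| "nat_arith Minus a b = a - b"
| "nat_arith Times a b = a * b"
| "nat_arith Divide a b = a div b"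

fun real_arith :: "arith \<Rightarrow> real \<Rightarrow> real \<Rightarrow> real" where
  "real_arith Plus a b = a + b"
| "real_arith Minus a b = a - b"
| "real_arith Times a b = a * b"
| "real_arith Divide a b = a / b"

text \<open>All operands are numbers of \<open>I\<close>-registers, except for the constant of
  \<open>IConst\<close>, the jump targets and the position of a sequence in \<open>Lookup\<close>.\<close>

datatype 'q instr =
    IConst nat nat
  | IArith arith nat nat nat
  | ILess nat nat nat
  | ZNat nat nat
  | ZArith arith nat nat nat
  | ZLess nat nat nat
  | Ask nat 'q nat nat
  | Lookup nat nat nat

record 'q machine_state =
  pc :: nat
  Ireg :: "nat \<Rightarrow> nat"
  Zreg :: "nat \<Rightarrow> real"
  asked :: "('q \<times> nat \<times> nat) set"

definition initial_state :: "nat \<Rightarrow> 'q machine_state" where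
  "initial_state n = \<lparr>pc = 0, Ireg = (\<lambda>_. 0)(0 := n), Zreg = (\<lambda>_. 0), asked = {}\<rparr>"

fun exec_instr ::
  "('q \<Rightarrow> nat \<Rightarrow> nat \<Rightarrow> complex) \<Rightarrow> (nat \<Rightarrow> real) list \<Rightarrow> 'q instr \<Rightarrow>
   'q machine_state \<Rightarrow> 'q machine_state" where
  "exec_instr orc seqs (IConst a c) s =
     s\<lparr>pc := Suc (pc s), Ireg := (Ireg s)(a := c)\<rparr>"
| "exec_instr orc seqs (IArith p a b c) s =
     s\<lparr>pc := Suc (pc s), Ireg := (Ireg s)(a := nat_arith p (Ireg s b) (Ireg s c))\<rparr>"
| "exec_instr orc seqs (ILess a b t) s =
     s\<lparr>pc := if Ireg s a < Ireg s b then t else Suc (pc s)\<rparr>"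
| "exec_instr orc seqs (ZNat a b) s =
     s\<lparr>pc := Suc (pc s), Zreg := (Zreg s)(Ireg s a := real (Ireg s b))\<rparr>"
| "exec_instr orc seqs (ZArith p a b c) s =
     s\<lparr>pc := Suc (pc s),
       Zreg := (Zreg s)(Ireg s a := real_arith p (Zreg s (Ireg s b)) (Zreg s (Ireg s c)))\<rparr>"
| "exec_instr orc seqs (ZLess a b t) s =
     s\<lparr>pc := if Zreg s (Ireg s a) < Zreg s (Ireg s b) then t else Suc (pc s)\<rparr>"
| "exec_instr orc seqs (Ask a q b c) s =
     (let v = orc q (Ireg s b) (Ireg s c) in
      s\<lparr>pc := Suc (pc s),
        Zreg := (Zreg s)(Ireg s a := Re v, Suc (Ireg s a) := Im v),
        asked := insert (q, Ireg s b, Ireg s c) (asked s)\<rparr>)"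
| "exec_instr orc seqs (Lookup a k b) s =
     s\<lparr>pc := Suc (pc s),
       Zreg := (Zreg s)(Ireg s a := if k < length seqs then (seqs ! k) (Ireg s b) else 0)\<rparr>"

text \<open>A machine halts when its program counter leaves the program.\<close>

definition step ::
  "'q instr list \<Rightarrow> ('q \<Rightarrow> nat \<Rightarrow> nat \<Rightarrow> complex) \<Rightarrow> (nat \<Rightarrow> real) list \<Rightarrow>
   'q machine_state \<Rightarrow> 'q machine_state" where
  "step prog orc seqs s =
     (if pc s < length prog then exec_instr orc seqs (prog ! pc s) s else s)"

text \<open>The output is a finite string of complex numbers, of length \<open>I\<^sub>0\<close>, with real
  and imaginary parts stored alternately in \<open>Z\<^sub>0, Z\<^sub>1, \<dots>\<close>.\<close>

definition output_of :: "'q machine_state \<Rightarrow> complex list" where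
  "output_of s = map (\<lambda>i. Complex (Zreg s (2 * i)) (Zreg s (2 * i + 1))) [0..<Ireg s 0]"

definition halts_in ::
  "'q instr list \<Rightarrow> ('q \<Rightarrow> nat \<Rightarrow> nat \<Rightarrow> complex) \<Rightarrow> (nat \<Rightarrow> real) list \<Rightarrow> nat \<Rightarrow>
   'q machine_state \<Rightarrow> bool" where
  "halts_in prog orc seqs n s \<longleftrightarrow>
     (\<exists>k. s = (step prog orc seqs ^^ k) (initial_state n)) \<and> length prog \<le> pc s"

section \<open>General and arithmetic algorithms\<close>

text \<open>\<open>general_algorithm \<Omega> \<Lambda> \<Gamma> L\<close>: the map \<open>\<Gamma>\<close>
  is a general algorithm on \<open>\<Omega>\<close>, where \<open>L A\<close> is the set of evaluation functions
  used at the input \<open>A\<close>.\<close>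

definition general_algorithm ::
  "'a set \<Rightarrow> ('a \<Rightarrow> complex) set \<Rightarrow> ('a \<Rightarrow> 'm) \<Rightarrow> ('a \<Rightarrow> ('a \<Rightarrow> complex) set) \<Rightarrow> bool" where
  "general_algorithm \<Omega> \<Lambda> \<Gamma> L \<longleftrightarrow>
     (\<forall>A\<in>\<Omega>. finite (L A) \<and> L A \<noteq> {} \<and> L A \<subseteq> \<Lambda> \<and>
       (\<forall>B\<in>\<Omega>. (\<forall>g\<in>L A. g B = g A) \<longrightarrow> \<Gamma> B = \<Gamma> A \<and> L B = L A))"

text \<open>A sequence of arithmetic algorithms is computed by one machine, which receives the index
  \<open>n\<close>. The evaluation functions are given as a family \<open>ev\<close>, and \<open>decode\<close>
  identifies finite strings with elements of the target space.\<close>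

definition arithmetic_algorithms ::
  "'a set \<Rightarrow> ('q \<Rightarrow> nat \<Rightarrow> nat \<Rightarrow> 'a \<Rightarrow> complex) \<Rightarrow> (nat \<Rightarrow> real) list \<Rightarrow>
   (complex list \<Rightarrow> 'm) \<Rightarrow> (nat \<Rightarrow> 'a \<Rightarrow> 'm) \<Rightarrow> bool" where
  "arithmetic_algorithms \<Omega> ev seqs decode \<Gamma> \<longleftrightarrow>
     (\<exists>prog. \<forall>n\<ge>1. \<exists>L.
        general_algorithm \<Omega> {ev q i j | q i j. True} (\<Gamma> n) L \<and>
        (\<forall>A\<in>\<Omega>. \<exists>s. halts_in prog (\<lambda>q i j. ev q i j A) seqs n s \<and>
           \<Gamma> n A = decode (output_of s) \<and> (\<forall>(q, i, j)\<in>asked s. ev q i j \<in> L A)))"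

definition vector_of_list :: "complex list \<Rightarrow> ell2" where
  "vector_of_list cs = (\<Sum>k<length cs. (cs ! k) *\<^sub>C basis_vec k)"

definition real_of_list :: "complex list \<Rightarrow> real" where
  "real_of_list cs = Re (hd cs)"

datatype query = Entry | Coeff | Point

fun Lambda1 :: "query \<Rightarrow> nat \<Rightarrow> nat \<Rightarrow> input \<Rightarrow> complex" where
  "Lambda1 Entry i j (T, x, z) = cinner (app T (basis_vec j)) (basis_vec i)"
| "Lambda1 Coeff i _ (T, x, z) = cinner x (basis_vec i)"
| "Lambda1 Point _ _ (T, x, z) = z"

text \<open>The input of a problem can be extended by a list of real parameters; the query
  \<open>None\<close> returns its entries.\<close>

fun with_parameters ::
  "('q \<Rightarrow> nat \<Rightarrow> nat \<Rightarrow> 'a \<Rightarrow> complex) \<Rightarrow> 'q option \<Rightarrow> nat \<Rightarrow> nat \<Rightarrow> 'a \<times> real list \<Rightarrow> complex" where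
  "with_parameters ev (Some q) i j (A, rs) = ev q i j A"
| "with_parameters ev None i _ (A, rs) = (if i < length rs then of_real (rs ! i) else 0)"

end

theory Submission
  imports Defs
begin

text \<open>
  Write \<open>R = (T - z)\<^sup>-\<^sup>1\<close>. A vector \<open>y\<close> for which \<open>(T - z) y\<close> is close to \<open>x\<close> is close to
  \<open>R x\<close>, because \<open>\<parallel>y - R x\<parallel> \<le> \<parallel>R\<parallel> \<parallel>(T - z) y - x\<parallel>\<close>. If \<open>y\<close> is supported on the first \<open>n\<close> basis
  vectors, the residual splits into \<open>P\<^sub>m ((T - z) y - x)\<close> with \<open>m = f n\<close>, which finitely many matrix
  entries determine, a tail of \<open>T y\<close> bounded by the dispersion, and a tail of \<open>x\<close>. As the finitely
  supported vectors form a core, their images come arbitrarily close to \<open>x\<close>, and so do those of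
  the finitely supported vectors with coefficients on a rational grid
  (\<open>candidate_approximation\<close>).

  This suggests an algorithm without any linear algebra: at level \<open>n\<close>, run through a finite list of
  grid vectors and keep one with the smallest computable residual. The list is arranged such that
  every grid vector belongs to it from some level on, so the residuals of the chosen vectors tend
  to 0, and a small tail estimate turns this into convergence (\<open>approximant_tendsto\<close>). Only squares
  of norms are compared, so that arithmetic operations and comparisons suffice.

  The error bound needs \<open>\<parallel>R\<parallel> = 1 / dist(z, \<sigma>(T))\<close> (\<open>infdist_spectrum\<close>), and this is where normality
  is used. One inequality is the Neumann series. For the other, normality gives
  \<open>\<parallel>R v\<parallel>\<^sup>2 \<le> \<parallel>v\<parallel> \<parallel>R\<^sup>2 v\<parallel>\<close>, hence a vector that \<open>R\<close> stretches almost by the factor \<open>\<parallel>R\<parallel>\<close> is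
  stretched by almost the same factor in each of many successive applications. Averaging the vectors
  \<open>\<Sum>\<^sub>j \<mu>\<^sup>j R\<^sup>n\<^sup>-\<^sup>j v\<close> over the roots of unity \<open>\<mu>\<close> shows that one of them is long, although
  \<open>R - \<mu>\<close> maps it to a short vector (all after scaling \<open>R\<close> to norm 1). So the circle of radius
  \<open>\<parallel>R\<parallel>\<close> contains an approximate eigenvalue of \<open>R\<close> (\<open>approximate_eigenvalue\<close>), and inverting it
  yields a point of \<open>\<sigma>(T)\<close> at distance \<open>1 / \<parallel>R\<parallel>\<close> from \<open>z\<close>.

  To evaluate the error bound, square roots are approximated by counting multiples of a
  tolerance. If the distance to the spectrum is not given, its reciprocal is the limit of
  the largest quotients \<open>\<parallel>u\<parallel> / \<parallel>P\<^sub>f\<^sub>(\<^sub>m\<^sub>) (T - z) u\<parallel>\<close> over the candidates \<open>u\<close> of level \<open>m\<close>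
  (\<open>best_score_tendsto\<close>), which the same search program finds.

  The programs are written in a small structured language with complex variables, whose compiler
  to machine code is verified once (\<open>exec_simulated\<close>); \<open>arithmetic_algorithms_com\<close> reduces each
  computability claim to the correctness of such a program.
\<close>

section \<open>What a machine run depends on\<close>

lemma step_halted: "length prog \<le> pc s \<Longrightarrow> (step prog orc seqs ^^ k) s = s"
  by (induction k) (auto simp: step_def)

lemma asked_exec_mono: "asked s \<subseteq> asked (exec_instr orc seqs i s)"
  by (cases i) (auto simp: Let_def)

lemma asked_step_mono: "asked s \<subseteq> asked (step prog orc seqs s)"
  using asked_exec_mono[of s orc seqs "prog ! pc s"] by (simp add: step_def)

lemma asked_run_mono:
  "j \<le> k \<Longrightarrow> asked ((step prog orc seqs ^^ j) s) \<subseteq> asked ((step prog orc seqs ^^ k) s)"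
proof (induction k rule: dec_induct)
  case (step k)
  then show ?case using asked_step_mono[of "(step prog orc seqs ^^ k) s" prog orc seqs] by auto
qed simp

lemma finite_asked_run: "finite (asked ((step prog orc seqs ^^ k) (initial_state n)))"
proof (induction k)
  case 0
  then show ?case by (simp add: initial_state_def)
next
  case (Suc k)
  have "finite (asked (exec_instr orc seqs i s))" if "finite (asked s)" for i and s :: "'a machine_state"
    using that by (cases i) (auto simp: Let_def)
  with Suc show ?case by (simp add: step_def)
qed

lemma step_cong_asked:
  assumes "\<And>q i j. (q, i, j) \<in> asked (step prog orc seqs s) \<Longrightarrow> orc' q i j = orc q i j"
  shows "step prog orc' seqs s = step prog orc seqs s"
proof (cases "pc s < length prog")
  case True
  with assms show ?thesis by (cases "prog ! pc s") (auto simp: step_def Let_def)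
qed (simp add: step_def)

lemma run_cong_asked:
  assumes "\<And>q i j. (q, i, j) \<in> asked ((step prog orc seqs ^^ k) s) \<Longrightarrow> orc' q i j = orc q i j"
  shows "(step prog orc' seqs ^^ k) s = (step prog orc seqs ^^ k) s"
  using assms
proof (induction k)
  case (Suc k)
  have "asked ((step prog orc seqs ^^ k) s) \<subseteq> asked ((step prog orc seqs ^^ Suc k) s)"
    by (rule asked_run_mono) simp
  with Suc have eq: "(step prog orc' seqs ^^ k) s = (step prog orc seqs ^^ k) s" by blast
  have "step prog orc' seqs ((step prog orc seqs ^^ k) s) = step prog orc seqs ((step prog orc seqs ^^ k) s)"
    using Suc.prems by (intro step_cong_asked) simp
  then show ?case by (simp add: eq)
qed simp

lemma halts_in_unique:
  assumes "halts_in prog orc seqs n s" "halts_in prog orc seqs n t"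
  shows "s = t"
proof -
  have *: "s = t" if "j \<le> k" and s: "s = (step prog orc seqs ^^ j) (initial_state n)" "length prog \<le> pc s"
    and t: "t = (step prog orc seqs ^^ k) (initial_state n)" for j k s t
  proof -
    have "t = (step prog orc seqs ^^ (k - j)) ((step prog orc seqs ^^ j) (initial_state n))"
      using \<open>j \<le> k\<close> t by (metis comp_apply funpow_add le_add_diff_inverse2)
    with s show "s = t" by (simp add: step_halted)
  qed
  from assms obtain j k where
    j: "s = (step prog orc seqs ^^ j) (initial_state n)" "length prog \<le> pc s" and
    k: "t = (step prog orc seqs ^^ k) (initial_state n)" "length prog \<le> pc t"
    unfolding halts_in_def by blast
  show ?thesis
  proof (cases "j \<le> k")
    case True
    then show ?thesis using *[OF _ j k(1)] by simp
  next
    case False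
    then show ?thesis using *[OF _ k j(1)] by simp
  qed
qed

text \<open>A run is determined by the answers that it receives: if they agree for two inputs on the
  queries of one run, the other run is the same. Hence the queries of a halting run,
  together with one fixed query that keeps the set nonempty, are a legitimate set of evaluation
  functions for a general algorithm.\<close>

lemma arithmetic_algorithmsI:
  fixes ev :: "'q \<Rightarrow> nat \<Rightarrow> nat \<Rightarrow> 'a \<Rightarrow> complex"
  assumes halt: "\<And>n A. n \<ge> 1 \<Longrightarrow> A \<in> \<Omega> \<Longrightarrow>
    \<exists>s. halts_in prog (\<lambda>q i j. ev q i j A) seqs n s \<and> \<Gamma> n A = decode (output_of s)"
  shows "arithmetic_algorithms \<Omega> ev seqs decode \<Gamma>"
  unfolding arithmetic_algorithms_def
proof (intro exI[of _ prog] allI impI)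
  fix n :: nat assume n: "n \<ge> 1"
  define fin where "fin A = (SOME s. halts_in prog (\<lambda>q i j. ev q i j A) seqs n s)" for A
  define L where
    "L A = insert (ev undefined 0 0) ((\<lambda>(q, i, j). ev q i j) ` asked (fin A))" for A
  have fin: "halts_in prog (\<lambda>q i j. ev q i j A) seqs n (fin A)"
    and \<Gamma>: "\<Gamma> n A = decode (output_of (fin A))" if A: "A \<in> \<Omega>" for A
  proof -
    obtain s where s: "halts_in prog (\<lambda>q i j. ev q i j A) seqs n s"
      "\<Gamma> n A = decode (output_of s)" using halt[OF n A] by blast
    then show "halts_in prog (\<lambda>q i j. ev q i j A) seqs n (fin A)"
      unfolding fin_def by (auto intro: someI)
    from halts_in_unique[OF this s(1)] s(2) show "\<Gamma> n A = decode (output_of (fin A))" by simp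
  qed
  have same: "fin B = fin A" if A: "A \<in> \<Omega>" and B: "B \<in> \<Omega>" and agree: "\<forall>g\<in>L A. g B = g A" for A B
  proof -
    obtain k where k: "fin A = (step prog (\<lambda>q i j. ev q i j A) seqs ^^ k) (initial_state n)"
      and h: "length prog \<le> pc (fin A)" using fin[OF A] unfolding halts_in_def by blast
    have "ev q i j B = ev q i j A" if "(q, i, j) \<in> asked (fin A)" for q i j
      using agree that unfolding L_def by force
    then have "fin A = (step prog (\<lambda>q i j. ev q i j B) seqs ^^ k) (initial_state n)"
      unfolding k by (intro run_cong_asked[symmetric]) blast
    then have "halts_in prog (\<lambda>q i j. ev q i j B) seqs n (fin A)"
      unfolding halts_in_def by (intro conjI exI[of _ k] h)
    with fin[OF B] show ?thesis by (rule halts_in_unique)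
  qed
  have "finite (L A)" if "A \<in> \<Omega>" for A
  proof -
    have "finite (asked (fin A))"
      using fin[OF that] finite_asked_run unfolding halts_in_def by auto
    then show ?thesis by (simp add: L_def)
  qed
  then have gen: "general_algorithm \<Omega> {ev q i j | q i j. True} (\<Gamma> n) L"
    unfolding general_algorithm_def
  proof (intro ballI conjI impI)
    fix A B assume A: "A \<in> \<Omega>" and B: "B \<in> \<Omega>" and agree: "\<forall>g\<in>L A. g B = g A"
    from same[OF this] have eq: "fin B = fin A" .
    then show "\<Gamma> n B = \<Gamma> n A" using \<Gamma>[OF A] \<Gamma>[OF B] by simp
    show "L B = L A" by (simp add: L_def eq)
  qed (auto simp: L_def)
  have run: "\<exists>s. halts_in prog (\<lambda>q i j. ev q i j A) seqs n s \<and>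
      \<Gamma> n A = decode (output_of s) \<and> (\<forall>(q, i, j)\<in>asked s. ev q i j \<in> L A)" if "A \<in> \<Omega>" for A
  proof (intro exI[of _ "fin A"] conjI)
    show "\<forall>(q, i, j)\<in>asked (fin A). ev q i j \<in> L A" unfolding L_def by force
  qed (use fin[OF that] \<Gamma>[OF that] in simp_all)
  show "\<exists>L. general_algorithm \<Omega> {ev q i j | q i j. True} (\<Gamma> n) L \<and>
      (\<forall>A\<in>\<Omega>. \<exists>s. halts_in prog (\<lambda>q i j. ev q i j A) seqs n s \<and>
         \<Gamma> n A = decode (output_of s) \<and> (\<forall>(q, i, j)\<in>asked s. ev q i j \<in> L A))"
  proof (intro exI[of _ L] conjI ballI)
    show "general_algorithm \<Omega> {ev q i j | q i j. True} (\<Gamma> n) L" by (rule gen)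
  qed (rule run)
qed

section \<open>A structured programming language for the machine\<close>

datatype nexp = Num nat | NVar nat | NOp arith nexp nexp

text \<open>Variables hold complex values, which saves the programs from separating real and imaginary
  parts. \<open>Term k e\<close> is an entry of the \<open>k\<close>-th sequence. Division is restricted to real parts, as
  all denominators that occur are real.\<close>

datatype 'q cexp =
    OfNat nexp
  | CVar nat
  | Term nat nexp
  | Query 'q nexp nexp
  | CAdd "'q cexp" "'q cexp"
  | CSub "'q cexp" "'q cexp"
  | CMul "'q cexp" "'q cexp"
  | ReDiv "'q cexp" "'q cexp"
  | Cnj "'q cexp"
  | MkComplex "'q cexp" "'q cexp"

text \<open>The only test compares the real parts of two expressions. \<open>Unless a b c\<close> skips \<open>c\<close>
  if the test succeeds, and \<open>Repeat c a b\<close> executes \<open>c\<close> again as long as it succeeds: these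
  are the two control structures that a conditional jump can realise without a second jump.\<close>

datatype 'q com =
    NAssign nat nexp
  | CAssign nat "'q cexp"
  | Emit nexp "'q cexp"
  | Seq "'q com" "'q com"  (infixr \<open>;;\<close> 60)
  | Unless "'q cexp" "'q cexp" "'q com"
  | Repeat "'q com" "'q cexp" "'q cexp"

record store =
  nvar :: "nat \<Rightarrow> nat"
  cvar :: "nat \<Rightarrow> complex"
  outp :: "nat \<Rightarrow> complex"

fun nval :: "nexp \<Rightarrow> (nat \<Rightarrow> nat) \<Rightarrow> nat" where
  "nval (Num c) i = c"
| "nval (NVar v) i = i v"
| "nval (NOp p a b) i = nat_arith p (nval a i) (nval b i)"

fun cval :: "('q \<Rightarrow> nat \<Rightarrow> nat \<Rightarrow> complex) \<Rightarrow> (nat \<Rightarrow> real) list \<Rightarrow> 'q cexp \<Rightarrow> store \<Rightarrow> complex" where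
  "cval orc seqs (OfNat e) s = of_nat (nval e (nvar s))"
| "cval orc seqs (CVar v) s = cvar s v"
| "cval orc seqs (Term k e) s =
     of_real (if k < length seqs then (seqs ! k) (nval e (nvar s)) else 0)"
| "cval orc seqs (Query q a b) s = orc q (nval a (nvar s)) (nval b (nvar s))"
| "cval orc seqs (CAdd a b) s = cval orc seqs a s + cval orc seqs b s"
| "cval orc seqs (CSub a b) s = cval orc seqs a s - cval orc seqs b s"
| "cval orc seqs (CMul a b) s = cval orc seqs a s * cval orc seqs b s"
| "cval orc seqs (ReDiv a b) s = of_real (Re (cval orc seqs a s) / Re (cval orc seqs b s))"
| "cval orc seqs (Cnj a) s = cnj (cval orc seqs a s)"
| "cval orc seqs (MkComplex a b) s = Complex (Re (cval orc seqs a s)) (Re (cval orc seqs b s))"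

text \<open>The bound \<open>n\<close> on the addresses in \<open>Emit\<close> is the number of output cells that lie
  below the memory of the program.\<close>

inductive exec :: "('q \<Rightarrow> nat \<Rightarrow> nat \<Rightarrow> complex) \<Rightarrow> (nat \<Rightarrow> real) list \<Rightarrow> nat \<Rightarrow>
    'q com \<Rightarrow> store \<Rightarrow> store \<Rightarrow> bool"
  for orc :: "'q \<Rightarrow> nat \<Rightarrow> nat \<Rightarrow> complex" and seqs :: "(nat \<Rightarrow> real) list" and n :: nat
where
  NAssign: "exec orc seqs n (NAssign v e) s (s\<lparr>nvar := (nvar s)(v := nval e (nvar s))\<rparr>)"
| CAssign: "exec orc seqs n (CAssign v e) s (s\<lparr>cvar := (cvar s)(v := cval orc seqs e s)\<rparr>)"
| Emit: "nval a (nvar s) < n \<Longrightarrow>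
    exec orc seqs n (Emit a e) s (s\<lparr>outp := (outp s)(nval a (nvar s) := cval orc seqs e s)\<rparr>)"
| Seq: "exec orc seqs n c s t \<Longrightarrow> exec orc seqs n d t u \<Longrightarrow> exec orc seqs n (c ;; d) s u"
| UnlessSkip: "Re (cval orc seqs a s) < Re (cval orc seqs b s) \<Longrightarrow>
    exec orc seqs n (Unless a b c) s s"
| UnlessDo: "\<not> Re (cval orc seqs a s) < Re (cval orc seqs b s) \<Longrightarrow> exec orc seqs n c s t \<Longrightarrow>
    exec orc seqs n (Unless a b c) s t"
| RepeatStop: "exec orc seqs n c s t \<Longrightarrow> \<not> Re (cval orc seqs a t) < Re (cval orc seqs b t) \<Longrightarrow>
    exec orc seqs n (Repeat c a b) s t"
| RepeatGo: "exec orc seqs n c s t \<Longrightarrow> Re (cval orc seqs a t) < Re (cval orc seqs b t) \<Longrightarrow>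
    exec orc seqs n (Repeat c a b) t u \<Longrightarrow> exec orc seqs n (Repeat c a b) s u"

section \<open>Compilation\<close>

text \<open>The output has to be placed at the real registers \<open>Z\<^sub>0, Z\<^sub>1, \<dots>\<close> and its length depends on
  \<open>n\<close>, so the memory of a program starts at the address \<open>b = 2 n\<close>, which is kept in \<open>I\<^sub>1\<close>. The
  registers \<open>I\<^sub>2, I\<^sub>3, I\<^sub>4\<close> receive addresses. Natural variables and intermediate results alternate
  from \<open>I\<^sub>5\<close> on; complex variables and intermediate results alternate from \<open>Z\<^sub>b\<close> on, with two real
  registers each. Hence no number of variables has to be declared.\<close>

definition zero_cell :: "nat \<Rightarrow> 'q instr list" where
  "zero_cell u = [IConst 2 u, IArith Plus 2 2 1, IConst 3 0, ZNat 2 3]"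

definition real_op :: "arith \<Rightarrow> nat \<Rightarrow> nat \<Rightarrow> nat \<Rightarrow> 'q instr list" where
  "real_op p u v w =
     [IConst 2 u, IArith Plus 2 2 1, IConst 3 v, IArith Plus 3 3 1, IConst 4 w, IArith Plus 4 4 1,
      ZArith p 2 3 4]"

text \<open>The machine has no instruction that moves a real number; adding to a cleared cell replaces it.\<close>

definition copy_cell :: "nat \<Rightarrow> nat \<Rightarrow> 'q instr list" where
  "copy_cell u v = zero_cell u @ real_op Plus u u v"

fun ncode :: "nexp \<Rightarrow> nat \<Rightarrow> 'q instr list" where
  "ncode (Num c) d = [IConst (6 + 2 * d) c]"
| "ncode (NVar v) d = [IConst (6 + 2 * d) 0, IArith Plus (6 + 2 * d) (6 + 2 * d) (5 + 2 * v)]"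
| "ncode (NOp p a b) d =
     ncode a d @ ncode b (Suc d) @ [IArith p (6 + 2 * d) (6 + 2 * d) (6 + 2 * Suc d)]"

text \<open>At depth \<open>d\<close>, the value of the expression is left in the cells \<open>4 d + 2\<close> and
  \<open>4 d + 3\<close>, while the second operand of a binary operation is computed at depth \<open>d + 1\<close>. A product
  stores its four partial products at the depths \<open>d + 2\<close> and \<open>d + 3\<close>.\<close>

fun ccode :: "'q cexp \<Rightarrow> nat \<Rightarrow> 'q instr list" where
  "ccode (OfNat e) d = zero_cell (4 * d + 3) @ ncode e 0 @
     [IConst 2 (4 * d + 2), IArith Plus 2 2 1, ZNat 2 6]"
| "ccode (CVar v) d = copy_cell (4 * d + 2) (4 * v) @ copy_cell (4 * d + 3) (4 * v + 1)"
| "ccode (Term k e) d = zero_cell (4 * d + 3) @ ncode e 0 @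
     [IConst 2 (4 * d + 2), IArith Plus 2 2 1, Lookup 2 k 6]"
| "ccode (Query q a b) d = ncode a 0 @ ncode b 1 @
     [IConst 2 (4 * d + 2), IArith Plus 2 2 1, Ask 2 q 6 8]"
| "ccode (CAdd a b) d = ccode a d @ ccode b (Suc d) @
     real_op Plus (4 * d + 2) (4 * d + 2) (4 * d + 6) @
     real_op Plus (4 * d + 3) (4 * d + 3) (4 * d + 7)"
| "ccode (CSub a b) d = ccode a d @ ccode b (Suc d) @
     real_op Minus (4 * d + 2) (4 * d + 2) (4 * d + 6) @
     real_op Minus (4 * d + 3) (4 * d + 3) (4 * d + 7)"
| "ccode (CMul a b) d = ccode a d @ ccode b (Suc d) @
     real_op Times (4 * d + 10) (4 * d + 2) (4 * d + 6) @
     real_op Times (4 * d + 11) (4 * d + 3) (4 * d + 7) @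
     real_op Times (4 * d + 14) (4 * d + 2) (4 * d + 7) @
     real_op Times (4 * d + 15) (4 * d + 3) (4 * d + 6) @
     real_op Minus (4 * d + 2) (4 * d + 10) (4 * d + 11) @
     real_op Plus (4 * d + 3) (4 * d + 14) (4 * d + 15)"
| "ccode (ReDiv a b) d = ccode a d @ ccode b (Suc d) @
     real_op Divide (4 * d + 2) (4 * d + 2) (4 * d + 6) @ zero_cell (4 * d + 3)"
| "ccode (Cnj a) d = ccode a d @ zero_cell (4 * d + 7) @
     real_op Minus (4 * d + 3) (4 * d + 7) (4 * d + 3)"
| "ccode (MkComplex a b) d = ccode a d @ ccode b (Suc d) @ copy_cell (4 * d + 3) (4 * d + 6)"

definition load_comparands :: "'q cexp \<Rightarrow> 'q cexp \<Rightarrow> 'q instr list" where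
  "load_comparands a b = ccode a 0 @ ccode b 1 @
     [IConst 2 2, IArith Plus 2 2 1, IConst 3 6, IArith Plus 3 3 1]"

text \<open>The second argument of \<open>compile\<close> is the position at which the code is placed.\<close>

fun compile :: "'q com \<Rightarrow> nat \<Rightarrow> 'q instr list" where
  "compile (NAssign v e) p = ncode e 0 @ [IConst 2 0, IArith Plus (5 + 2 * v) 6 2]"
| "compile (CAssign v e) p = ccode e 0 @ copy_cell (4 * v) 2 @ copy_cell (4 * v + 1) 3"
| "compile (Emit a e) p = ccode e 0 @ ncode a 0 @
     [IArith Plus 6 6 6, IConst 2 0, ZNat 6 2, IConst 3 2, IArith Plus 3 3 1, ZArith Plus 6 6 3,
      IConst 4 1, IArith Plus 6 6 4, ZNat 6 2, IArith Plus 3 3 4, ZArith Plus 6 6 3]"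
| "compile (c ;; d) p = compile c p @ compile d (p + length (compile c p))"
| "compile (Unless a b c) p =
     (let t = load_comparands a b; code = compile c (p + length t + 1)
      in t @ [ZLess 2 3 (p + length t + 1 + length code)] @ code)"
| "compile (Repeat c a b) p = compile c p @ load_comparands a b @ [ZLess 2 3 p]"

fun jump_free :: "'q instr \<Rightarrow> bool" where
  "jump_free (ILess a b t) = False"
| "jump_free (ZLess a b t) = False"
| "jump_free _ = True"

abbreviation run_block :: "('q \<Rightarrow> nat \<Rightarrow> nat \<Rightarrow> complex) \<Rightarrow> (nat \<Rightarrow> real) list \<Rightarrow> 'q instr list \<Rightarrow>
    'q machine_state \<Rightarrow> 'q machine_state" where
  "run_block orc seqs code \<equiv> fold (exec_instr orc seqs) code"

lemma run_jump_free:
  assumes "prog = pre @ code @ post" "pc \<sigma> = length pre" "list_all jump_free code"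
  shows "(step prog orc seqs ^^ length code) \<sigma> = run_block orc seqs code \<sigma> \<and>
    pc (run_block orc seqs code \<sigma>) = length pre + length code"
  using assms
proof (induction code arbitrary: pre \<sigma>)
  case (Cons i code)
  have pc: "pc (exec_instr orc seqs i \<sigma>) = Suc (pc \<sigma>)"
    using Cons.prems by (cases i) (auto simp: Let_def)
  have st: "step prog orc seqs \<sigma> = exec_instr orc seqs i \<sigma>"
    using Cons.prems by (simp add: step_def nth_append)
  have "(step prog orc seqs ^^ length (i # code)) \<sigma> =
      (step prog orc seqs ^^ length code) (exec_instr orc seqs i \<sigma>)"
    by (simp add: funpow_Suc_right st del: funpow.simps(2))
  then show ?case
    using Cons.IH[of "pre @ [i]" "exec_instr orc seqs i \<sigma>"] Cons.prems pc by simp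
qed simp

lemma jump_free_ncode: "list_all jump_free (ncode e d)"
  by (induction e arbitrary: d) auto

lemma jump_free_blocks [simp]:
  "list_all jump_free (zero_cell u)" "list_all jump_free (real_op p u v w)"
  "list_all jump_free (copy_cell u v)"
  by (simp_all add: zero_cell_def real_op_def copy_cell_def)

lemma jump_free_ccode: "list_all jump_free (ccode e d)"
  by (induction e arbitrary: d) (auto simp: jump_free_ncode)

lemma jump_free_load_comparands: "list_all jump_free (load_comparands a b)"
  by (simp add: load_comparands_def jump_free_ccode)

lemma Zreg_zero_cell:
  "Zreg (run_block orc seqs (zero_cell u) \<sigma>) = (Zreg \<sigma>)(Ireg \<sigma> 1 + u := 0)"
  by (simp add: zero_cell_def add.commute)

lemma Ireg_zero_cell:
  "r \<noteq> 2 \<Longrightarrow> r \<noteq> 3 \<Longrightarrow> Ireg (run_block orc seqs (zero_cell u) \<sigma>) r = Ireg \<sigma> r"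
  by (simp add: zero_cell_def)

lemma Zreg_real_op:
  "Zreg (run_block orc seqs (real_op p u v w) \<sigma>) =
     (Zreg \<sigma>)(Ireg \<sigma> 1 + u := real_arith p (Zreg \<sigma> (Ireg \<sigma> 1 + v)) (Zreg \<sigma> (Ireg \<sigma> 1 + w)))"
  by (simp add: real_op_def add.commute)

lemma Ireg_real_op:
  "r \<noteq> 2 \<Longrightarrow> r \<noteq> 3 \<Longrightarrow> r \<noteq> 4 \<Longrightarrow> Ireg (run_block orc seqs (real_op p u v w) \<sigma>) r = Ireg \<sigma> r"
  by (simp add: real_op_def)

lemma Zreg_copy_cell:
  "u \<noteq> v \<Longrightarrow> Zreg (run_block orc seqs (copy_cell u v) \<sigma>) =
     (Zreg \<sigma>)(Ireg \<sigma> 1 + u := Zreg \<sigma> (Ireg \<sigma> 1 + v))"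
  by (simp add: copy_cell_def Zreg_zero_cell Ireg_zero_cell Zreg_real_op)

lemma Ireg_copy_cell:
  "r \<noteq> 2 \<Longrightarrow> r \<noteq> 3 \<Longrightarrow> r \<noteq> 4 \<Longrightarrow> Ireg (run_block orc seqs (copy_cell u v) \<sigma>) r = Ireg \<sigma> r"
  by (simp add: copy_cell_def Ireg_zero_cell Ireg_real_op)

lemmas block_simps = Zreg_zero_cell Ireg_zero_cell Zreg_real_op Ireg_real_op
  Zreg_copy_cell Ireg_copy_cell

lemma run_ncode:
  "Zreg (run_block orc seqs (ncode e d) \<sigma>) = Zreg \<sigma> \<and>
   (\<forall>r. (\<forall>k\<ge>d. r \<noteq> 6 + 2 * k) \<longrightarrow> Ireg (run_block orc seqs (ncode e d) \<sigma>) r = Ireg \<sigma> r) \<and>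
   Ireg (run_block orc seqs (ncode e d) \<sigma>) (6 + 2 * d) = nval e (\<lambda>v. Ireg \<sigma> (5 + 2 * v))"
proof (induction e arbitrary: d \<sigma>)
  case (NVar v)
  have "5 + 2 * v \<noteq> 6 + 2 * d" by presburger
  then show ?case by simp
next
  case (NOp p a b)
  let ?\<sigma>1 = "run_block orc seqs (ncode a d) \<sigma>"
  have odd: "5 + 2 * v \<noteq> 6 + 2 * k" for v k :: nat by presburger
  have env: "(\<lambda>v. Ireg ?\<sigma>1 (5 + 2 * v)) = (\<lambda>v. Ireg \<sigma> (5 + 2 * v))"
    using NOp(1)[of d \<sigma>] odd by simp
  have keep: "Ireg (run_block orc seqs (ncode b (Suc d)) ?\<sigma>1) (6 + 2 * d) = Ireg ?\<sigma>1 (6 + 2 * d)"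
    using NOp(2)[of "Suc d" ?\<sigma>1] by simp
  show ?case
    using NOp(1)[of d \<sigma>] NOp(2)[of "Suc d" ?\<sigma>1] keep unfolding env by simp
qed simp

lemma ncode_env:
  "Ireg (run_block orc seqs (ncode e d) \<sigma>) (5 + 2 * v) = Ireg \<sigma> (5 + 2 * v)"
  "r < 5 \<Longrightarrow> Ireg (run_block orc seqs (ncode e d) \<sigma>) r = Ireg \<sigma> r"
  "k < d \<Longrightarrow> Ireg (run_block orc seqs (ncode e d) \<sigma>) (6 + 2 * k) = Ireg \<sigma> (6 + 2 * k)"
proof -
  have "5 + 2 * v \<noteq> 6 + 2 * k" for k by presburger
  then show "Ireg (run_block orc seqs (ncode e d) \<sigma>) (5 + 2 * v) = Ireg \<sigma> (5 + 2 * v)"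
    using run_ncode[of orc seqs e d \<sigma>] by simp
qed (use run_ncode[of orc seqs e d \<sigma>] in simp_all)

text \<open>Only variables and output cells take part in the simulation relation; address registers and
  intermediate results are free, so that loops may leave arbitrary values there.\<close>

definition sim :: "nat \<Rightarrow> store \<Rightarrow> 'q machine_state \<Rightarrow> bool" where
  "sim n s \<sigma> \<longleftrightarrow> Ireg \<sigma> 1 = 2 * n \<and> (\<forall>v. Ireg \<sigma> (5 + 2 * v) = nvar s v) \<and>
     (\<forall>v. Zreg \<sigma> (2 * n + 4 * v) = Re (cvar s v) \<and> Zreg \<sigma> (2 * n + 4 * v + 1) = Im (cvar s v)) \<and>
     (\<forall>j<n. Zreg \<sigma> (2 * j) = Re (outp s j) \<and> Zreg \<sigma> (2 * j + 1) = Im (outp s j))"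

text \<open>The code of an expression at depth \<open>d\<close> leaves everything in place except for
  address registers and intermediate results at depths from \<open>d\<close> on.\<close>

definition above_only :: "nat \<Rightarrow> nat \<Rightarrow> 'q machine_state \<Rightarrow> 'q machine_state \<Rightarrow> bool" where
  "above_only n d \<sigma> \<sigma>' \<longleftrightarrow> Ireg \<sigma>' 1 = Ireg \<sigma> 1 \<and> (\<forall>v. Ireg \<sigma>' (5 + 2 * v) = Ireg \<sigma> (5 + 2 * v)) \<and>
     (\<forall>a. (\<forall>k\<ge>d. a \<noteq> 2 * n + 4 * k + 2 \<and> a \<noteq> 2 * n + 4 * k + 3) \<longrightarrow> Zreg \<sigma>' a = Zreg \<sigma> a)"

lemma above_only_trans: "above_only n d \<sigma> \<sigma>' \<Longrightarrow> above_only n d \<sigma>' \<sigma>'' \<Longrightarrow> above_only n d \<sigma> \<sigma>''"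
  unfolding above_only_def by metis

lemma above_only_Suc: "above_only n (Suc d) \<sigma> \<sigma>' \<Longrightarrow> above_only n d \<sigma> \<sigma>'"
  unfolding above_only_def by (metis Suc_leD)

lemma above_only_sim:
  assumes "above_only n d \<sigma> \<sigma>'" "sim n s \<sigma>" shows "sim n s \<sigma>'"
proof -
  have *: "Zreg \<sigma>' a = Zreg \<sigma> a"
    if "\<forall>k. a \<noteq> 2 * n + 4 * k + 2 \<and> a \<noteq> 2 * n + 4 * k + 3" for a
    using assms(1) that unfolding above_only_def by blast
  have "Zreg \<sigma>' (2 * n + 4 * v) = Zreg \<sigma> (2 * n + 4 * v)"
    "Zreg \<sigma>' (2 * n + 4 * v + 1) = Zreg \<sigma> (2 * n + 4 * v + 1)" for v
    by (rule *; presburger)+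
  moreover have "Zreg \<sigma>' (2 * j) = Zreg \<sigma> (2 * j)" "Zreg \<sigma>' (2 * j + 1) = Zreg \<sigma> (2 * j + 1)"
    if "j < n" for j
    using that by (auto intro!: *)
  ultimately show ?thesis using assms unfolding sim_def above_only_def by simp
qed

lemma above_only_zero_cell:
  "Ireg \<sigma> 1 = 2 * n \<Longrightarrow> u \<in> {4 * d + 2, 4 * d + 3} \<Longrightarrow> d0 \<le> d \<Longrightarrow>
   above_only n d0 \<sigma> (run_block orc seqs (zero_cell u) \<sigma>)"
  unfolding above_only_def by (auto simp: block_simps)

lemma above_only_real_op:
  "Ireg \<sigma> 1 = 2 * n \<Longrightarrow> u \<in> {4 * d + 2, 4 * d + 3} \<Longrightarrow> d0 \<le> d \<Longrightarrow>
   above_only n d0 \<sigma> (run_block orc seqs (real_op p u v w) \<sigma>)"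
  unfolding above_only_def by (auto simp: block_simps)

lemma above_only_base: "above_only n d \<sigma> \<sigma>' \<Longrightarrow> Ireg \<sigma> 1 = 2 * n \<Longrightarrow> Ireg \<sigma>' 1 = 2 * n"
  by (simp add: above_only_def)

lemma above_only_copy_cell:
  "Ireg \<sigma> 1 = 2 * n \<Longrightarrow> u \<in> {4 * d + 2, 4 * d + 3} \<Longrightarrow> d0 \<le> d \<Longrightarrow>
   above_only n d0 \<sigma> (run_block orc seqs (copy_cell u v) \<sigma>)"
  unfolding copy_cell_def fold_append o_apply
  by (rule above_only_trans[OF above_only_zero_cell above_only_real_op]; (simp add: Ireg_zero_cell)?)

lemma above_only_ncode: "above_only n d \<sigma> (run_block orc seqs (ncode e k) \<sigma>)"
  unfolding above_only_def by (simp add: ncode_env conjunct1[OF run_ncode])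

lemma nval_sim: "sim n s \<sigma> \<Longrightarrow>
    Ireg (run_block orc seqs (ncode e d) \<sigma>) (6 + 2 * d) = nval e (nvar s)"
  using run_ncode[of orc seqs e d \<sigma>] by (simp add: sim_def)

lemma run_ccode:
  assumes "sim n s \<sigma>"
  shows "above_only n d \<sigma> (run_block orc seqs (ccode e d) \<sigma>) \<and>
    Zreg (run_block orc seqs (ccode e d) \<sigma>) (2 * n + (4 * d + 2)) = Re (cval orc seqs e s) \<and>
    Zreg (run_block orc seqs (ccode e d) \<sigma>) (2 * n + (4 * d + 3)) = Im (cval orc seqs e s)"
  using assms
proof (induction e arbitrary: d \<sigma>)
  \<comment> \<open>The first operand survives the computation of the second, which only writes at greater depth.\<close>
  have two: "above_only n d \<sigma> \<sigma>2" "Ireg \<sigma>2 1 = 2 * n"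
      "Zreg \<sigma>2 (2 * n + (4 * d + 2)) = Re (cval orc seqs a s)"
      "Zreg \<sigma>2 (2 * n + (4 * d + 3)) = Im (cval orc seqs a s)"
      "Zreg \<sigma>2 (2 * n + (4 * d + 6)) = Re (cval orc seqs b s)"
      "Zreg \<sigma>2 (2 * n + (4 * d + 7)) = Im (cval orc seqs b s)"
    if sim: "sim n s \<sigma>"
      and a: "\<And>d \<sigma>. sim n s \<sigma> \<Longrightarrow> above_only n d \<sigma> (run_block orc seqs (ccode a d) \<sigma>) \<and>
        Zreg (run_block orc seqs (ccode a d) \<sigma>) (2 * n + (4 * d + 2)) = Re (cval orc seqs a s) \<and>
        Zreg (run_block orc seqs (ccode a d) \<sigma>) (2 * n + (4 * d + 3)) = Im (cval orc seqs a s)"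
      and b: "\<And>d \<sigma>. sim n s \<sigma> \<Longrightarrow> above_only n d \<sigma> (run_block orc seqs (ccode b d) \<sigma>) \<and>
        Zreg (run_block orc seqs (ccode b d) \<sigma>) (2 * n + (4 * d + 2)) = Re (cval orc seqs b s) \<and>
        Zreg (run_block orc seqs (ccode b d) \<sigma>) (2 * n + (4 * d + 3)) = Im (cval orc seqs b s)"
      and \<sigma>2: "\<sigma>2 = run_block orc seqs (ccode b (Suc d)) (run_block orc seqs (ccode a d) \<sigma>)"
    for a b d \<sigma> \<sigma>2
  proof -
    define \<sigma>1 where "\<sigma>1 = run_block orc seqs (ccode a d) \<sigma>"
    have \<sigma>2_def: "\<sigma>2 = run_block orc seqs (ccode b (Suc d)) \<sigma>1" by (simp add: \<sigma>2 \<sigma>1_def)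
    have 1: "above_only n d \<sigma> \<sigma>1" and sim1: "sim n s \<sigma>1"
      using a[OF sim, of d] above_only_sim[OF _ sim] unfolding \<sigma>1_def by blast+
    have 2: "above_only n (Suc d) \<sigma>1 \<sigma>2" using b[OF sim1] unfolding \<sigma>2_def by blast
    have keep: "Zreg \<sigma>2 (2 * n + (4 * d + 2)) = Zreg \<sigma>1 (2 * n + (4 * d + 2))"
      "Zreg \<sigma>2 (2 * n + (4 * d + 3)) = Zreg \<sigma>1 (2 * n + (4 * d + 3))"
      using 2 unfolding above_only_def by (auto; presburger)+
    show "above_only n d \<sigma> \<sigma>2" using 1 2 above_only_Suc above_only_trans by blast
    then show "Ireg \<sigma>2 1 = 2 * n" using sim by (simp add: above_only_def sim_def)
    have e: "4 * Suc d + 2 = 4 * d + 6" "4 * Suc d + 3 = 4 * d + 7" by simp_all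
    show "Zreg \<sigma>2 (2 * n + (4 * d + 2)) = Re (cval orc seqs a s)"
      "Zreg \<sigma>2 (2 * n + (4 * d + 3)) = Im (cval orc seqs a s)"
      "Zreg \<sigma>2 (2 * n + (4 * d + 6)) = Re (cval orc seqs b s)"
      "Zreg \<sigma>2 (2 * n + (4 * d + 7)) = Im (cval orc seqs b s)"
      using a[OF sim, of d] b[OF sim1, of "Suc d", unfolded e] keep
      unfolding \<sigma>1_def[symmetric] \<sigma>2_def[symmetric] by auto
  qed
  \<comment> \<open>The common beginning of the code for \<open>OfNat\<close> and \<open>Term\<close>.\<close>
  have fetch: "above_only n d \<sigma> m" "Ireg m 6 = nval e (nvar s)"
      "Zreg m = (Zreg \<sigma>)(2 * n + (4 * d + 3) := 0)" "Ireg m 1 = 2 * n"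
    if sim: "sim n s \<sigma>"
      and m: "m = run_block orc seqs (ncode e 0) (run_block orc seqs (zero_cell (4 * d + 3)) \<sigma>)"
    for m e d \<sigma>
  proof -
    let ?z = "run_block orc seqs (zero_cell (4 * d + 3)) \<sigma>"
    have base: "Ireg \<sigma> 1 = 2 * n" using sim by (simp add: sim_def)
    have z: "above_only n d \<sigma> ?z" by (rule above_only_zero_cell[OF base]) auto
    show up: "above_only n d \<sigma> m" unfolding m by (rule above_only_trans[OF z above_only_ncode])
    show "Ireg m 6 = nval e (nvar s)"
      using nval_sim[OF above_only_sim[OF z sim], of orc seqs e 0] by (simp add: m)
    show "Zreg m = (Zreg \<sigma>)(2 * n + (4 * d + 3) := 0)"
      using run_ncode[of orc seqs e 0 ?z] base by (simp add: m Zreg_zero_cell)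
    show "Ireg m 1 = 2 * n" by (rule above_only_base[OF up base])
  qed
  note trans = above_only_trans
  {
    case (OfNat e)
    from fetch[OF OfNat refl, where d = d and e = e] show ?case by (auto simp: above_only_def)
  next
    case (CVar v)
    let ?z = "run_block orc seqs (copy_cell (4 * d + 2) (4 * v)) \<sigma>"
    have base: "Ireg \<sigma> 1 = 2 * n" using CVar by (simp add: sim_def)
    have z: "above_only n d \<sigma> ?z" by (rule above_only_copy_cell[OF base]) auto
    have ne: "4 * d + 2 \<noteq> 4 * v" "4 * d + 3 \<noteq> 4 * v + 1" "4 * d + 2 \<noteq> 4 * v + 1" by presburger+
    have "above_only n d \<sigma> (run_block orc seqs (copy_cell (4 * d + 3) (4 * v + 1)) ?z)"
      by (rule trans[OF z above_only_copy_cell[OF above_only_base[OF z base]]]) auto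
    moreover have "Zreg (run_block orc seqs (copy_cell (4 * d + 3) (4 * v + 1)) ?z) =
      (Zreg \<sigma>)(2 * n + (4 * d + 2) := Re (cvar s v), 2 * n + (4 * d + 3) := Im (cvar s v))"
      using CVar base ne ne[symmetric] by (simp add: block_simps sim_def)
    ultimately show ?case by simp
  next
    case (Term k e)
    from fetch[OF Term refl, where d = d and e = e] show ?case by (auto simp: above_only_def)
  next
    case (Query q a b)
    let ?z = "run_block orc seqs (ncode a 0) \<sigma>"
    let ?m = "run_block orc seqs (ncode b 1) ?z"
    have base: "Ireg \<sigma> 1 = 2 * n" using Query by (simp add: sim_def)
    have z: "above_only n d \<sigma> ?z" by (rule above_only_ncode)
    have m: "above_only n d \<sigma> ?m" by (rule trans[OF z above_only_ncode])
    have vals: "Ireg ?m 6 = nval a (nvar s)" "Ireg ?m 8 = nval b (nvar s)"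
      using nval_sim[OF Query, of orc seqs a 0] ncode_env(3)[of 0 1 orc seqs b ?z]
        nval_sim[OF above_only_sim[OF z Query], of orc seqs b 1] by simp_all
    have bm: "Ireg ?m 1 = 2 * n" by (rule above_only_base[OF m base])
    show ?case using m vals bm by (auto simp: above_only_def Let_def)
  next
    case (CAdd a b)
    define \<sigma>2 where "\<sigma>2 = run_block orc seqs (ccode b (Suc d)) (run_block orc seqs (ccode a d) \<sigma>)"
    note f = two[OF CAdd(3,1,2) \<sigma>2_def]
    have "above_only n d \<sigma>2 (run_block orc seqs (ccode (CAdd a b) d) \<sigma>)"
      unfolding ccode.simps fold_append o_apply \<sigma>2_def[symmetric]
      by (rule trans[OF above_only_real_op[where d = d] above_only_real_op[where d = d]];
          simp add: f(2)[simplified] Ireg_real_op)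
    from trans[OF f(1) this] show ?case
      using f(2-) by (simp add: \<sigma>2_def[symmetric] block_simps)
  next
    case (CSub a b)
    define \<sigma>2 where "\<sigma>2 = run_block orc seqs (ccode b (Suc d)) (run_block orc seqs (ccode a d) \<sigma>)"
    note f = two[OF CSub(3,1,2) \<sigma>2_def]
    have "above_only n d \<sigma>2 (run_block orc seqs (ccode (CSub a b) d) \<sigma>)"
      unfolding ccode.simps fold_append o_apply \<sigma>2_def[symmetric]
      by (rule trans[OF above_only_real_op[where d = d] above_only_real_op[where d = d]];
          simp add: f(2)[simplified] Ireg_real_op)
    from trans[OF f(1) this] show ?case
      using f(2-) by (simp add: \<sigma>2_def[symmetric] block_simps)
  next
    case (CMul a b)
    define \<sigma>2 where "\<sigma>2 = run_block orc seqs (ccode b (Suc d)) (run_block orc seqs (ccode a d) \<sigma>)"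
    note f = two[OF CMul(3,1,2) \<sigma>2_def]
    have up: "above_only n d \<tau> (run_block orc seqs (real_op p (4 * d + u) v w) \<tau>) \<and>
        Ireg (run_block orc seqs (real_op p (4 * d + u) v w) \<tau>) 1 = 2 * n"
      if "Ireg \<tau> 1 = 2 * n" "u \<in> {2, 3, 10, 11, 14, 15}" for \<tau> p u v w
    proof -
      have "\<exists>k\<ge>d. 4 * d + u \<in> {4 * k + 2, 4 * k + 3}"
        using that(2) by (auto intro: exI[of _ d] exI[of _ "d + 2"] exI[of _ "d + 3"])
      then obtain k where "k \<ge> d" "4 * d + u \<in> {4 * k + 2, 4 * k + 3}" by blast
      from above_only_real_op[OF that(1) this(2,1)] that(1) show ?thesis
        by (simp add: Ireg_real_op)
    qed
    have "above_only n d \<sigma>2 (run_block orc seqs (ccode (CMul a b) d) \<sigma>)"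
      unfolding ccode.simps fold_append o_apply \<sigma>2_def[symmetric]
      by (intro trans[OF _ conjunct1[OF up]] conjunct2[OF up] conjunct1[OF up] f) simp_all
    from trans[OF f(1) this] show ?case
      using f(2-) by (simp add: \<sigma>2_def[symmetric] block_simps)
  next
    case (ReDiv a b)
    define \<sigma>2 where "\<sigma>2 = run_block orc seqs (ccode b (Suc d)) (run_block orc seqs (ccode a d) \<sigma>)"
    note f = two[OF ReDiv(3,1,2) \<sigma>2_def]
    have "above_only n d \<sigma>2 (run_block orc seqs (ccode (ReDiv a b) d) \<sigma>)"
      unfolding ccode.simps fold_append o_apply \<sigma>2_def[symmetric]
      by (rule trans[OF above_only_real_op[where d = d] above_only_zero_cell[where d = d]];
          simp add: f(2)[simplified] Ireg_real_op)
    from trans[OF f(1) this] show ?case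
      using f(2-) by (simp add: \<sigma>2_def[symmetric] block_simps)
  next
    case (Cnj a)
    let ?\<sigma>1 = "run_block orc seqs (ccode a d) \<sigma>"
    note f = Cnj(1)[OF Cnj(2), of d]
    have b: "Ireg ?\<sigma>1 1 = 2 * n"
      using above_only_base[OF conjunct1[OF f]] Cnj(2) by (simp add: sim_def)
    have "above_only n d ?\<sigma>1 (run_block orc seqs (ccode (Cnj a) d) \<sigma>)"
      unfolding ccode.simps fold_append o_apply
      by (rule trans[OF above_only_zero_cell[where d = "Suc d"] above_only_real_op[where d = d]];
          simp add: b[simplified] Ireg_zero_cell)
    from trans[OF conjunct1[OF f] this] show ?case
      using f b by (simp add: block_simps)
  next
    case (MkComplex a b)
    define \<sigma>2 where "\<sigma>2 = run_block orc seqs (ccode b (Suc d)) (run_block orc seqs (ccode a d) \<sigma>)"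
    note f = two[OF MkComplex(3,1,2) \<sigma>2_def]
    have "above_only n d \<sigma>2 (run_block orc seqs (ccode (MkComplex a b) d) \<sigma>)"
      unfolding ccode.simps fold_append o_apply \<sigma>2_def[symmetric]
      by (rule above_only_copy_cell[where d = d]) (simp_all add: f(2)[simplified])
    from trans[OF f(1) this] show ?case
      using f(2-) by (simp add: \<sigma>2_def[symmetric] block_simps)
  }
qed

lemma run_ccode_sim: "sim n s \<sigma> \<Longrightarrow> sim n s (run_block orc seqs (ccode e d) \<sigma>)"
  using run_ccode above_only_sim by blast

lemma run_load_comparands:
  assumes "sim n s \<sigma>"
  shows "sim n s (run_block orc seqs (load_comparands a b) \<sigma>) \<and>
    (let \<sigma>' = run_block orc seqs (load_comparands a b) \<sigma> in
      Zreg \<sigma>' (Ireg \<sigma>' 2) = Re (cval orc seqs a s) \<and> Zreg \<sigma>' (Ireg \<sigma>' 3) = Re (cval orc seqs b s))"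
proof -
  define \<sigma>1 where "\<sigma>1 = run_block orc seqs (ccode a 0) \<sigma>"
  define \<sigma>2 where "\<sigma>2 = run_block orc seqs (ccode b 1) \<sigma>1"
  have s1: "sim n s \<sigma>1" and s2: "sim n s \<sigma>2"
    using run_ccode_sim assms unfolding \<sigma>1_def \<sigma>2_def by blast+
  have "Zreg \<sigma>2 (2 * n + 2) = Zreg \<sigma>1 (2 * n + 2)"
    using run_ccode[OF s1, of 1 orc seqs b] unfolding \<sigma>2_def[symmetric] above_only_def by auto
  moreover have "Zreg \<sigma>1 (2 * n + 2) = Re (cval orc seqs a s)"
    using run_ccode[OF assms, of 0 orc seqs a] unfolding \<sigma>1_def[symmetric] by simp
  moreover have "Zreg \<sigma>2 (2 * n + 6) = Re (cval orc seqs b s)"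
    using run_ccode[OF s1, of 1 orc seqs b] unfolding \<sigma>2_def[symmetric] by simp
  ultimately show ?thesis
    using s2 unfolding load_comparands_def fold_append o_apply \<sigma>1_def[symmetric] \<sigma>2_def[symmetric]
    by (simp add: sim_def Let_def add.commute)
qed

text \<open>In the three lemmas below, variables, intermediate results and output cells occupy
  different residue classes or different ranges of addresses, so that writing one of them
  does not disturb the others.\<close>

lemma run_NAssign:
  assumes "sim n s \<sigma>"
  shows "sim n (s\<lparr>nvar := (nvar s)(v := nval e (nvar s))\<rparr>)
    (run_block orc seqs (compile (NAssign v e) p) \<sigma>)"
proof -
  let ?m = "run_block orc seqs (ncode e 0) \<sigma>"
  have "sim n s ?m" by (rule above_only_sim[OF above_only_ncode assms])
  moreover have "Ireg ?m 6 = nval e (nvar s)"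
    using nval_sim[OF assms, of orc seqs e 0] by simp
  ultimately show ?thesis by (simp add: sim_def)
qed

lemma run_CAssign:
  assumes "sim n s \<sigma>"
  shows "sim n (s\<lparr>cvar := (cvar s)(v := cval orc seqs e s)\<rparr>)
    (run_block orc seqs (compile (CAssign v e) p) \<sigma>)"
proof -
  let ?m = "run_block orc seqs (ccode e 0) \<sigma>"
  define \<sigma>' where "\<sigma>' = run_block orc seqs (compile (CAssign v e) p) \<sigma>"
  have m: "sim n s ?m" by (rule run_ccode_sim[OF assms])
  have val: "Zreg ?m (2 * n + 2) = Re (cval orc seqs e s)" "Zreg ?m (2 * n + 3) = Im (cval orc seqs e s)"
    using run_ccode[OF assms, of 0 orc seqs e] by simp_all
  have ne: "4 * v \<noteq> 2" "4 * v + 1 \<noteq> 3" "4 * v \<noteq> 3" "4 * w \<noteq> 4 * v + 1" "4 * w + 1 \<noteq> 4 * v" for w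
    by presburger+
  have Z: "Zreg \<sigma>' = (Zreg ?m)
      (2 * n + 4 * v := Re (cval orc seqs e s), 2 * n + (4 * v + 1) := Im (cval orc seqs e s))"
    using m val ne by (simp add: \<sigma>'_def block_simps sim_def)
  have I: "Ireg \<sigma>' r = Ireg ?m r"
    if "r = 1 \<or> r \<ge> 5" for r
    using that by (auto simp: \<sigma>'_def block_simps)
  have out: "2 * n + 4 * v \<noteq> 2 * j" "2 * n + 4 * v \<noteq> 2 * j + 1"
    "2 * n + (4 * v + 1) \<noteq> 2 * j" "2 * n + (4 * v + 1) \<noteq> 2 * j + 1" if "j < n" for j
    using that by presburger+
  show ?thesis
    using m ne ne(4,5)[symmetric] out out[symmetric] unfolding \<sigma>'_def[symmetric] sim_def Z by (simp add: I)
qed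

lemma run_Emit:
  assumes "sim n s \<sigma>" "nval a (nvar s) < n"
  shows "sim n (s\<lparr>outp := (outp s)(nval a (nvar s) := cval orc seqs e s)\<rparr>)
    (run_block orc seqs (compile (Emit a e) p) \<sigma>)"
proof -
  define j where "j = nval a (nvar s)"
  define \<sigma>' where "\<sigma>' = run_block orc seqs (compile (Emit a e) p) \<sigma>"
  let ?m = "run_block orc seqs (ccode e 0) \<sigma>"
  let ?k = "run_block orc seqs (ncode a 0) ?m"
  have m: "sim n s ?m" by (rule run_ccode_sim[OF assms(1)])
  have k: "sim n s ?k" by (rule above_only_sim[OF above_only_ncode m])
  have Zk: "Zreg ?k = Zreg ?m" using run_ncode[of orc seqs a 0 ?m] by simp
  have val: "Zreg ?k (2 * n + 2) = Re (cval orc seqs e s)" "Zreg ?k (2 * n + 3) = Im (cval orc seqs e s)"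
    using run_ccode[OF assms(1), of 0 orc seqs e] by (simp_all add: Zk)
  have j: "Ireg ?k 6 = j" "j < n"
    using nval_sim[OF m, of orc seqs a 0] assms(2) by (simp_all add: j_def)
  have b: "Ireg ?k 1 = 2 * n" using k by (simp add: sim_def)
  have Z: "Zreg \<sigma>' =
      (Zreg ?k)(2 * j := Re (cval orc seqs e s), 2 * j + 1 := Im (cval orc seqs e s))"
    using j b val val(2)[unfolded numeral_3_eq_3] by (simp add: \<sigma>'_def mult_2[symmetric] fun_upd_def fun_eq_iff)
  have I: "Ireg \<sigma>' r = Ireg ?k r"
    if "r = 1 \<or> r \<ge> 5" "r \<noteq> 6" for r
    using that by (auto simp: \<sigma>'_def)
  have ne: "2 * i \<noteq> 2 * j + 1" "2 * i + 1 \<noteq> 2 * j" for i j :: nat by presburger+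
  show ?thesis
    using k j(2) ne unfolding \<sigma>'_def[symmetric] sim_def Z j_def[symmetric] by (simp add: I)
qed

definition reaches where
  "reaches prog orc seqs \<sigma> \<sigma>' \<longleftrightarrow> (\<exists>k. (step prog orc seqs ^^ k) \<sigma> = \<sigma>')"

lemma reaches_trans:
  "reaches prog orc seqs \<sigma> \<sigma>' \<Longrightarrow> reaches prog orc seqs \<sigma>' \<sigma>'' \<Longrightarrow> reaches prog orc seqs \<sigma> \<sigma>''"
  unfolding reaches_def by (metis comp_apply funpow_add)

lemma reaches_block:
  assumes "prog = pre @ code @ post" "pc \<sigma> = length pre" "list_all jump_free code"
  shows "reaches prog orc seqs \<sigma> (run_block orc seqs code \<sigma>)"
    and "pc (run_block orc seqs code \<sigma>) = length pre + length code"
  using run_jump_free[OF assms, of orc seqs] unfolding reaches_def by blast+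

lemma run_test:
  assumes "sim n s \<sigma>" "pc \<sigma> = length pre" "prog = pre @ load_comparands a b @ ZLess 2 3 e # post"
  shows "\<exists>\<sigma>'. reaches prog orc seqs \<sigma> \<sigma>' \<and> sim n s \<sigma>' \<and> pc \<sigma>' =
    (if Re (cval orc seqs a s) < Re (cval orc seqs b s) then e else length pre + length (load_comparands a b) + 1)"
proof -
  let ?\<sigma>1 = "run_block orc seqs (load_comparands a b) \<sigma>"
  let ?e = "if Re (cval orc seqs a s) < Re (cval orc seqs b s) then e
    else length pre + length (load_comparands a b) + 1"
  note r = reaches_block[OF assms(3,2) jump_free_load_comparands, of orc seqs]
  note t = run_load_comparands[OF assms(1), of orc seqs a b, unfolded Let_def]
  have "step prog orc seqs ?\<sigma>1 = ?\<sigma>1\<lparr>pc := ?e\<rparr>"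
    using r(2) t by (simp add: step_def assms(3) nth_append)
  then have "(step prog orc seqs ^^ 1) ?\<sigma>1 = ?\<sigma>1\<lparr>pc := ?e\<rparr>" by simp
  then have "reaches prog orc seqs ?\<sigma>1 (?\<sigma>1\<lparr>pc := ?e\<rparr>)" unfolding reaches_def by blast
  from reaches_trans[OF r(1) this] t show ?thesis
    by (intro exI[of _ "?\<sigma>1\<lparr>pc := ?e\<rparr>"]) (simp add: sim_def)
qed

text \<open>Correctness of the compiler. Induction on the execution, not on the program, also covers
  loops: the jump back returns to a state in which the hypothesis for the remaining iterations
  applies to the same piece of code.\<close>

lemma exec_simulated:
  assumes "exec orc seqs n c s t" "sim n s \<sigma>" "pc \<sigma> = length pre"
    "prog = pre @ compile c (length pre) @ post"
  shows "\<exists>\<sigma>'. reaches prog orc seqs \<sigma> \<sigma>' \<and> sim n t \<sigma>' \<and>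
    pc \<sigma>' = length pre + length (compile c (length pre))"
  using assms
proof (induction arbitrary: \<sigma> pre post rule: exec.induct)
  case (NAssign v e s)
  have "list_all jump_free (compile (NAssign v e) (length pre) :: 'a instr list)"
    by (simp add: jump_free_ncode)
  note r = reaches_block[OF NAssign(3,2) this]
  show ?case by (rule exI, rule conjI, rule r(1), rule conjI, rule run_NAssign[OF NAssign(1)], rule r(2))
next
  case (CAssign v e s)
  have "list_all jump_free (compile (CAssign v e) (length pre))"
    by (simp add: jump_free_ccode)
  note r = reaches_block[OF CAssign(3,2) this]
  show ?case by (rule exI, rule conjI, rule r(1), rule conjI, rule run_CAssign[OF CAssign(1)], rule r(2))
next
  case (Emit a s e)
  have "list_all jump_free (compile (Emit a e) (length pre))"
    by (simp add: jump_free_ccode jump_free_ncode)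
  note r = reaches_block[OF Emit(4,3) this]
  show ?case by (rule exI, rule conjI, rule r(1), rule conjI, rule run_Emit[OF Emit(2,1)], rule r(2))
next
  case (Seq c s t d u)
  let ?c = "compile c (length pre)"
  let ?d = "compile d (length pre + length ?c)"
  have 1: "prog = pre @ ?c @ (?d @ post)" and 2: "prog = (pre @ ?c) @ compile d (length (pre @ ?c)) @ post"
    using Seq.prems(3) by simp_all
  from Seq.IH(1)[OF Seq.prems(1,2) 1] obtain \<sigma>1 where
    \<sigma>1: "reaches prog orc seqs \<sigma> \<sigma>1" "sim n t \<sigma>1" "pc \<sigma>1 = length (pre @ ?c)" by auto
  from Seq.IH(2)[OF \<sigma>1(2,3) 2] reaches_trans[OF \<sigma>1(1)] show ?case by (auto simp: add.assoc)
next
  case (UnlessSkip a s b c)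
  let ?p = "length pre + length (load_comparands a b) + 1"
  have "prog = pre @ load_comparands a b @ ZLess 2 3 (?p + length (compile c ?p)) # compile c ?p @ post"
    using UnlessSkip.prems(3) by (simp add: Let_def)
  from run_test[OF UnlessSkip.prems(1,2) this, of orc seqs] UnlessSkip.hyps
  show ?case by (auto simp: Let_def)
next
  case (UnlessDo a s b c t)
  let ?p = "length pre + length (load_comparands a b) + 1"
  let ?pre = "pre @ load_comparands a b @ [ZLess 2 3 (?p + length (compile c ?p))]"
  have prog: "prog = pre @ load_comparands a b @ ZLess 2 3 (?p + length (compile c ?p)) # compile c ?p @ post"
    using UnlessDo.prems(3) by (simp add: Let_def)
  from run_test[OF UnlessDo.prems(1,2) this, of orc seqs] UnlessDo.hyps obtain \<sigma>1 where
    \<sigma>1: "reaches prog orc seqs \<sigma> \<sigma>1" "sim n s \<sigma>1" "pc \<sigma>1 = length ?pre" by auto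
  have "prog = ?pre @ compile c (length ?pre) @ post" by (simp add: prog)
  from UnlessDo.IH[OF \<sigma>1(2,3) this] reaches_trans[OF \<sigma>1(1)] show ?case
    by (auto simp: Let_def add.assoc)
next
  case (RepeatStop c s t a b)
  let ?c = "compile c (length pre)"
  have 1: "prog = pre @ ?c @ (load_comparands a b @ [ZLess 2 3 (length pre)] @ post)"
    using RepeatStop.prems(3) by simp
  from RepeatStop.IH[OF RepeatStop.prems(1,2) 1] obtain \<sigma>1 where
    \<sigma>1: "reaches prog orc seqs \<sigma> \<sigma>1" "sim n t \<sigma>1" "pc \<sigma>1 = length (pre @ ?c)" by auto
  have "prog = (pre @ ?c) @ load_comparands a b @ ZLess 2 3 (length pre) # post" using 1 by simp
  from run_test[OF \<sigma>1(2,3) this, of orc seqs] RepeatStop.hyps reaches_trans[OF \<sigma>1(1)]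
  show ?case by (auto simp: add.assoc)
next
  case (RepeatGo c s t a b u)
  let ?c = "compile c (length pre)"
  have 1: "prog = pre @ ?c @ (load_comparands a b @ [ZLess 2 3 (length pre)] @ post)"
    using RepeatGo.prems(3) by simp
  from RepeatGo.IH(1)[OF RepeatGo.prems(1,2) 1] obtain \<sigma>1 where
    \<sigma>1: "reaches prog orc seqs \<sigma> \<sigma>1" "sim n t \<sigma>1" "pc \<sigma>1 = length (pre @ ?c)" by auto
  have "prog = (pre @ ?c) @ load_comparands a b @ ZLess 2 3 (length pre) # post" using 1 by simp
  from run_test[OF \<sigma>1(2,3) this, of orc seqs] RepeatGo.hyps(2) obtain \<sigma>2 where
    \<sigma>2: "reaches prog orc seqs \<sigma>1 \<sigma>2" "sim n t \<sigma>2" "pc \<sigma>2 = length pre" by auto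
  from RepeatGo.IH(2)[OF \<sigma>2(2,3) RepeatGo.prems(3)] reaches_trans[OF \<sigma>1(1)] reaches_trans[OF \<sigma>2(1)]
  show ?case by blast
qed

text \<open>The conventions for complete programs: the natural variable 0 initially holds the index
  \<open>n\<close>, and the variable 1 finally holds the number of output cells that are used.\<close>

definition initial_store :: "nat \<Rightarrow> store" where
  "initial_store n = \<lparr>nvar = (\<lambda>_. 0)(0 := n), cvar = (\<lambda>_. 0), outp = (\<lambda>_. 0)\<rparr>"

definition assemble :: "'q com \<Rightarrow> 'q instr list" where
  "assemble c = [IConst 2 2, IArith Times 1 0 2, IConst 3 0, IArith Plus 5 0 3] @
     compile c 4 @ [IConst 2 0, IArith Plus 0 7 2]"

lemma halts_in_assemble:
  assumes "exec orc seqs n c (initial_store n) t" "nvar t 1 \<le> n"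
  shows "\<exists>s. halts_in (assemble c) orc seqs n s \<and> output_of s = map (outp t) [0..<nvar t 1]"
proof -
  define pre :: "'a instr list" where
    "pre = [IConst 2 2, IArith Times 1 0 2, IConst 3 0, IArith Plus 5 0 3]"
  have len: "length pre = 4" and jf: "list_all jump_free pre" by (simp_all add: pre_def)
  let ?post = "[IConst 2 0, IArith Plus 0 7 2] :: 'a instr list"
  let ?prog = "assemble c"
  let ?\<sigma>0 = "run_block orc seqs pre (initial_state n)"
  have prog: "?prog = [] @ pre @ (compile c 4 @ ?post)"
    "?prog = pre @ compile c (length pre) @ ?post"
    "?prog = (pre @ compile c 4) @ ?post @ []"
    by (simp_all only: len) (simp_all add: assemble_def pre_def)
  have 0: "reaches ?prog orc seqs (initial_state n) ?\<sigma>0" "pc ?\<sigma>0 = length pre"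
    using reaches_block[OF prog(1) _ jf, of "initial_state n" orc seqs]
    by (simp_all add: initial_state_def)
  have "sim n (initial_store n) ?\<sigma>0"
    by (auto simp: pre_def sim_def initial_store_def initial_state_def)
  from exec_simulated[OF assms(1) this 0(2) prog(2)] obtain \<sigma>1 where
    1: "reaches ?prog orc seqs ?\<sigma>0 \<sigma>1" "sim n t \<sigma>1" "pc \<sigma>1 = length (pre @ compile c 4)"
    unfolding length_append len by blast
  let ?\<sigma>2 = "run_block orc seqs ?post \<sigma>1"
  have 2: "reaches ?prog orc seqs \<sigma>1 ?\<sigma>2" "pc ?\<sigma>2 = length ?prog"
    using reaches_block[OF prog(3) 1(3), of orc seqs] by (simp_all add: prog(3))
  have "halts_in ?prog orc seqs n ?\<sigma>2"
    using reaches_trans[OF reaches_trans[OF 0(1) 1(1)] 2(1)] 2(2)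
    unfolding halts_in_def reaches_def by (metis order_refl)
  moreover have "output_of ?\<sigma>2 = map (outp t) [0..<nvar t 1]"
  proof -
    have "Ireg \<sigma>1 (5 + 2 * 1) = nvar t 1" using 1(2) unfolding sim_def by blast
    then have "Ireg \<sigma>1 7 = nvar t 1" by simp
    then show ?thesis using 1(2) assms(2)
      by (auto simp: output_of_def sim_def complex_eq_iff)
  qed
  ultimately show ?thesis by blast
qed

lemma arithmetic_algorithms_com:
  assumes "\<And>n A. n \<ge> 1 \<Longrightarrow> A \<in> \<Omega> \<Longrightarrow>
    \<exists>t. exec (\<lambda>q i j. ev q i j A) seqs n c (initial_store n) t \<and> nvar t 1 \<le> n \<and>
      \<Gamma> n A = decode (map (outp t) [0..<nvar t 1])"
  shows "arithmetic_algorithms \<Omega> ev seqs decode \<Gamma>"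
proof (rule arithmetic_algorithmsI[where prog = "assemble c"])
  fix n :: nat and A assume "n \<ge> 1" "A \<in> \<Omega>"
  from assms[OF this] obtain t where t: "exec (\<lambda>q i j. ev q i j A) seqs n c (initial_store n) t"
    "nvar t 1 \<le> n" "\<Gamma> n A = decode (map (outp t) [0..<nvar t 1])" by blast
  from halts_in_assemble[OF t(1,2)] obtain s where
    "halts_in (assemble c) (\<lambda>q i j. ev q i j A) seqs n s" "output_of s = map (outp t) [0..<nvar t 1]"
    by blast
  then show "\<exists>s. halts_in (assemble c) (\<lambda>q i j. ev q i j A) seqs n s \<and> \<Gamma> n A = decode (output_of s)"
    by (intro exI[of _ s]) (simp add: t(3))
qed

section \<open>Reasoning about programs\<close>

fun nmods :: "'q com \<Rightarrow> nat set" where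
  "nmods (NAssign v e) = {v}"
| "nmods (c ;; d) = nmods c \<union> nmods d"
| "nmods (Unless a b c) = nmods c"
| "nmods (Repeat c a b) = nmods c"
| "nmods _ = {}"

fun cmods :: "'q com \<Rightarrow> nat set" where
  "cmods (CAssign v e) = {v}"
| "cmods (c ;; d) = cmods c \<union> cmods d"
| "cmods (Unless a b c) = cmods c"
| "cmods (Repeat c a b) = cmods c"
| "cmods _ = {}"

text \<open>The frame of a program is read off from its syntax, so that specifications need not
  mention the variables that a program leaves alone.\<close>

definition unchanged :: "'q com \<Rightarrow> store \<Rightarrow> store \<Rightarrow> bool" where
  "unchanged c s t \<longleftrightarrow> (\<forall>v. v \<notin> nmods c \<longrightarrow> nvar t v = nvar s v) \<and> (\<forall>v. v \<notin> cmods c \<longrightarrow> cvar t v = cvar s v)"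

lemma exec_unchanged: "exec orc seqs n c s t \<Longrightarrow> unchanged c s t"
  unfolding unchanged_def by (induction rule: exec.induct) auto

text \<open>Total correctness: termination is part of the claim.\<close>

definition wp where
  "wp orc seqs n c P s \<longleftrightarrow> (\<exists>t. exec orc seqs n c s t \<and> P t)"

inductive_cases NAssignE: "exec orc seqs n (NAssign v e) s t"
inductive_cases CAssignE: "exec orc seqs n (CAssign v e) s t"
inductive_cases EmitE: "exec orc seqs n (Emit a e) s t"
inductive_cases SeqE: "exec orc seqs n (c ;; d) s t"
inductive_cases UnlessE: "exec orc seqs n (Unless a b c) s t"

lemma wp_simps [simp]:
  "wp orc seqs n (NAssign v e) P s \<longleftrightarrow> P (s\<lparr>nvar := (nvar s)(v := nval e (nvar s))\<rparr>)"
  "wp orc seqs n (CAssign w a) P s \<longleftrightarrow> P (s\<lparr>cvar := (cvar s)(w := cval orc seqs a s)\<rparr>)"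
  "wp orc seqs n (Emit e a) P s \<longleftrightarrow> nval e (nvar s) < n \<and>
     P (s\<lparr>outp := (outp s)(nval e (nvar s) := cval orc seqs a s)\<rparr>)"
  "wp orc seqs n (c ;; d) P s \<longleftrightarrow> wp orc seqs n c (wp orc seqs n d P) s"
  "wp orc seqs n (Unless a b c) P s \<longleftrightarrow>
     (if Re (cval orc seqs a s) < Re (cval orc seqs b s) then P s else wp orc seqs n c P s)"
  unfolding wp_def
  by (auto intro: exec.intros elim!: NAssignE CAssignE EmitE SeqE UnlessE)

lemma wp_mono:
  "wp orc seqs n c P s \<Longrightarrow> (\<And>t. P t \<Longrightarrow> unchanged c s t \<Longrightarrow> Q t) \<Longrightarrow> wp orc seqs n c Q s"
  unfolding wp_def using exec_unchanged by blast

lemma wp_Repeat: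
  fixes m :: "store \<Rightarrow> nat"
  assumes "Inv s"
    and body: "\<And>t. Inv t \<Longrightarrow> wp orc seqs n c (\<lambda>u. if Re (cval orc seqs a u) < Re (cval orc seqs b u)
      then Inv u \<and> m u < m t else Q u) t"
  shows "wp orc seqs n (Repeat c a b) Q s"
  using assms(1)
proof (induction "m s" arbitrary: s rule: less_induct)
  case less
  obtain u where u: "exec orc seqs n c s u" "if Re (cval orc seqs a u) < Re (cval orc seqs b u)
      then Inv u \<and> m u < m s else Q u"
    using body[OF less.prems] unfolding wp_def by blast
  show ?case
  proof (cases "Re (cval orc seqs a u) < Re (cval orc seqs b u)")
    case True
    with u(2) less.hyps have "wp orc seqs n (Repeat c a b) Q u" by simp
    with u(1) True show ?thesis unfolding wp_def by (blast intro: RepeatGo)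
  next
    case False
    with u show ?thesis unfolding wp_def by (auto intro: RepeatStop)
  qed
qed

text \<open>The test comes after the body, which is therefore executed at least once; all bounds that
  occur are positive.\<close>

definition For :: "nat \<Rightarrow> nat \<Rightarrow> 'q com \<Rightarrow> 'q com" where
  "For v b c = NAssign v (Num 0) ;;
     Repeat (c ;; NAssign v (NOp Plus (NVar v) (Num 1))) (OfNat (NVar v)) (OfNat (NVar b))"

lemma mods_For [simp]: "nmods (For v b c) = insert v (nmods c)" "cmods (For v b c) = cmods c"
  by (auto simp: For_def)

lemma wp_For:
  assumes b: "nvar s b = N" "N \<ge> 1" "b \<noteq> v" "v \<notin> nmods c" "b \<notin> nmods c"
    and init: "Inv 0 (s\<lparr>nvar := (nvar s)(v := 0)\<rparr>)"
    and body: "\<And>k t. k < N \<Longrightarrow> Inv k t \<Longrightarrow> nvar t v = k \<Longrightarrow> unchanged (For v b c) s t \<Longrightarrow>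
      wp orc seqs n c (\<lambda>u. Inv (Suc k) (u\<lparr>nvar := (nvar u)(v := Suc k)\<rparr>)) t"
  shows "wp orc seqs n (For v b c) (Inv N) s"
  unfolding For_def wp_simps(4) wp_simps(1)
proof (rule wp_Repeat[where m = "\<lambda>t. N - nvar t v" and
    Inv = "\<lambda>t. nvar t v < N \<and> Inv (nvar t v) t \<and> unchanged (For v b c) s t"])
  fix t assume t: "nvar t v < N \<and> Inv (nvar t v) t \<and> unchanged (For v b c) s t"
  then have "wp orc seqs n c (\<lambda>u. Inv (Suc (nvar t v)) (u\<lparr>nvar := (nvar u)(v := Suc (nvar t v))\<rparr>)) t"
    using body by blast
  then show "wp orc seqs n (c ;; NAssign v (NOp Plus (NVar v) (Num 1)))
      (\<lambda>u. if Re (cval orc seqs (OfNat (NVar v)) u) < Re (cval orc seqs (OfNat (NVar b)) u)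
        then (nvar u v < N \<and> Inv (nvar u v) u \<and> unchanged (For v b c) s u) \<and> N - nvar u v < N - nvar t v
        else Inv N u) t"
    unfolding wp_simps(4)
  proof (rule wp_mono)
    fix u assume I: "Inv (Suc (nvar t v)) (u\<lparr>nvar := (nvar u)(v := Suc (nvar t v))\<rparr>)"
      and un: "unchanged c t u"
    have v: "nvar u v = nvar t v" and bu: "nvar u b = N"
      using t un b by (auto simp: unchanged_def)
    have "unchanged (For v b c) s (u\<lparr>nvar := (nvar u)(v := Suc (nvar t v))\<rparr>)"
      using t un by (auto simp: unchanged_def)
    then show "wp orc seqs n (NAssign v (NOp Plus (NVar v) (Num 1)))
      (\<lambda>u. if Re (cval orc seqs (OfNat (NVar v)) u) < Re (cval orc seqs (OfNat (NVar b)) u)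
        then (nvar u v < N \<and> Inv (nvar u v) u \<and> unchanged (For v b c) s u) \<and> N - nvar u v < N - nvar t v
        else Inv N u) u"
      using I t v bu b(3) by (auto simp: less_Suc_eq not_less) (metis le_antisym Suc_leI)+
  qed
qed (use assms in \<open>auto simp: unchanged_def\<close>)

section \<open>The candidates\<close>

text \<open>Four digits of a natural number in base \<open>s\<^sup>2\<close> encode a complex number: differences of two
  digits, divided by \<open>s\<close>, are the multiples of \<open>1 / s\<close> strictly between \<open>- s\<close> and \<open>s\<close>. Leading zeros
  encode 0, so a number encodes a finitely supported vector.\<close>

definition quad_digits :: "nat \<Rightarrow> nat \<Rightarrow> complex" where
  "quad_digits s r = (let b = s * s in Complex
     ((real (r mod b) - real (r div b mod b)) / real s)
     ((real (r div b div b mod b) - real (r div b div b div b mod b)) / real s))"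

definition drop4 :: "nat \<Rightarrow> nat \<Rightarrow> nat" where
  "drop4 s q = q div (s * s) div (s * s) div (s * s) div (s * s)"

definition grid :: "nat \<Rightarrow> nat \<Rightarrow> nat \<Rightarrow> complex" where
  "grid s q j = quad_digits s ((drop4 s ^^ j) q)"

text \<open>The index \<open>k < l\<^sup>2\<close> encodes a pair of numbers below \<open>l\<close>, the resolution (less 1) and the
  number whose digits are taken. So every vector of every grid is a candidate at all sufficiently
  large levels.\<close>

definition cand :: "nat \<Rightarrow> nat \<Rightarrow> nat \<Rightarrow> complex" where
  "cand l k = grid (k div l + 1) (k mod l)"

text \<open>For the matrix \<open>a\<close> of \<open>T\<close> this is \<open>\<parallel>P\<^sub>m ((T - z) u - g x)\<parallel>\<^sup>2\<close>.\<close>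

definition residual :: "(nat \<Rightarrow> nat \<Rightarrow> complex) \<Rightarrow> (nat \<Rightarrow> complex) \<Rightarrow> complex \<Rightarrow> nat \<Rightarrow> nat \<Rightarrow>
    real \<Rightarrow> (nat \<Rightarrow> complex) \<Rightarrow> real" where
  "residual a x z l m g u =
     (\<Sum>i<m. (cmod ((\<Sum>j<l. (a i j - (if i = j then z else 0)) * u j) - of_real g * x i))\<^sup>2)"

definition mass :: "nat \<Rightarrow> (nat \<Rightarrow> complex) \<Rightarrow> real" where
  "mass l u = (\<Sum>j<l. (cmod (u j))\<^sup>2)"

text \<open>The weight \<open>g\<close> selects one of two searches. For \<open>g = 1\<close> the score is \<open>1 / (residual + 1)\<close>, whose
  maximum belongs to the least residual; the summand 1 keeps the denominator positive. For
  \<open>g = 0\<close> it is \<open>\<parallel>u\<parallel>\<^sup>2 / \<parallel>P\<^sub>m (T - z) u\<parallel>\<^sup>2\<close>, where \<open>u = 0\<close> scores 0 because \<open>0 / 0 = 0\<close>.\<close>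

definition score :: "(nat \<Rightarrow> nat \<Rightarrow> complex) \<Rightarrow> (nat \<Rightarrow> complex) \<Rightarrow> complex \<Rightarrow> nat \<Rightarrow> nat \<Rightarrow>
    real \<Rightarrow> (nat \<Rightarrow> complex) \<Rightarrow> real" where
  "score a x z l m g u = (g + (1 - g) * mass l u) / (residual a x z l m g u + g)"

fun last_argmax :: "(nat \<Rightarrow> real) \<Rightarrow> nat \<Rightarrow> nat" where
  "last_argmax f 0 = 0"
| "last_argmax f (Suc k) = (if f k < f (last_argmax f k) then last_argmax f k else k)"

lemma last_argmax_max: "k < M \<Longrightarrow> f k \<le> f (last_argmax f M)"
  by (induction M) (auto simp: less_Suc_eq intro: order_trans)

definition best :: "(nat \<Rightarrow> nat \<Rightarrow> complex) \<Rightarrow> (nat \<Rightarrow> complex) \<Rightarrow> complex \<Rightarrow> nat \<Rightarrow> nat \<Rightarrow> real \<Rightarrow> nat" where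
  "best a x z l m g = last_argmax (\<lambda>k. score a x z l m g (cand l k)) (l * l)"

section \<open>The programs\<close>

text \<open>The natural variables: index and output length (fixed by the conventions above); level and
  number of rows of the truncated matrix; candidate, row and column counters; remaining digits,
  resolution and base of the current candidate; number of candidates, best candidate; counters
  for square roots and for the accuracy. The complex variables: the weight \<open>g\<close>; an entry of the
  residual, a coordinate of the candidate; squared residual and squared norm of the candidate;
  its score and the best score; an approximate square root, the tolerance and the radicand; the
  accumulated error bound.\<close>

abbreviation (input) "IDX \<equiv> 0::nat"
abbreviation (input) "LEN \<equiv> 1::nat"
abbreviation (input) "LEVEL \<equiv> 2::nat"
abbreviation (input) "ROWS \<equiv> 3::nat"
abbreviation (input) "CND \<equiv> 4::nat"
abbreviation (input) "ROW \<equiv> 5::nat"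
abbreviation (input) "COL \<equiv> 6::nat"
abbreviation (input) "DGT \<equiv> 7::nat"
abbreviation (input) "SCL \<equiv> 8::nat"
abbreviation (input) "BASE \<equiv> 9::nat"
abbreviation (input) "TOTAL \<equiv> 10::nat"
abbreviation (input) "BEST \<equiv> 11::nat"
abbreviation (input) "TRY \<equiv> 12::nat"
abbreviation (input) "CNT \<equiv> 13::nat"

abbreviation (input) "MODE \<equiv> 0::nat"
abbreviation (input) "ENT \<equiv> 1::nat"
abbreviation (input) "CRD \<equiv> 2::nat"
abbreviation (input) "NUM \<equiv> 3::nat"
abbreviation (input) "DEN \<equiv> 4::nat"
abbreviation (input) "SCORE \<equiv> 5::nat"
abbreviation (input) "TOP \<equiv> 6::nat"
abbreviation (input) "ROOT \<equiv> 7::nat"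
abbreviation (input) "TOL \<equiv> 8::nat"
abbreviation (input) "ARG \<equiv> 9::nat"
abbreviation (input) "ACC \<equiv> 10::nat"

definition "nmod a b = NOp Minus a (NOp Times (NOp Divide a b) b)"

lemma nval_nmod [simp]: "nval (nmod a b) i = nval a i mod nval b i"
  by (simp add: nmod_def minus_div_mult_eq_mod)

definition digits_exp :: "'q cexp" where
  "digits_exp = (let d = (\<lambda>e. OfNat (nmod e (NVar BASE))); r = (\<lambda>e. NOp Divide e (NVar BASE)) in
     MkComplex
       (ReDiv (CSub (d (NVar DGT)) (d (r (NVar DGT)))) (OfNat (NVar SCL)))
       (ReDiv (CSub (d (r (r (NVar DGT)))) (d (r (r (r (NVar DGT)))))) (OfNat (NVar SCL))))"

lemma cval_digits_exp:
  "nvar t BASE = nvar t SCL * nvar t SCL \<Longrightarrow> cval orc seqs digits_exp t = quad_digits (nvar t SCL) (nvar t DGT)"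
  by (simp add: digits_exp_def quad_digits_def Let_def)

definition drop4_exp :: nexp where
  "drop4_exp = (let r = (\<lambda>e. NOp Divide e (NVar BASE)) in r (r (r (r (NVar DGT)))))"

lemma nval_drop4_exp: "i BASE = i SCL * i SCL \<Longrightarrow> nval drop4_exp i = drop4 (i SCL) (i DGT)"
  by (simp add: drop4_exp_def drop4_def Let_def)

text \<open>Kronecker's delta of row and column, by truncated subtraction.\<close>

definition delta_exp :: "'q cexp" where
  "delta_exp = OfNat (NOp Minus (NOp Minus (Num 1) (NOp Minus (NVar ROW) (NVar COL)))
     (NOp Minus (NVar COL) (NVar ROW)))"

lemma cval_delta_exp: "cval orc seqs delta_exp t = (if nvar t ROW = nvar t COL then 1 else 0)"
  by (auto simp: delta_exp_def)

definition start_digits :: "nat \<Rightarrow> 'q com" where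
  "start_digits k = NAssign SCL (NOp Plus (NOp Divide (NVar k) (NVar LEVEL)) (Num 1)) ;;
     NAssign BASE (NOp Times (NVar SCL) (NVar SCL)) ;; NAssign DGT (nmod (NVar k) (NVar LEVEL))"

text \<open>The squared norm of the candidate is accumulated along the diagonal: every column index
  is also a row index, so each coordinate is counted once.\<close>

definition entry_step :: "(query \<Rightarrow> 'q) \<Rightarrow> 'q com" where
  "entry_step h =
     CAssign CRD digits_exp ;;
     NAssign DGT drop4_exp ;;
     CAssign DEN (CAdd (CVar DEN) (CMul delta_exp (CMul (CVar CRD) (Cnj (CVar CRD))))) ;;
     CAssign ENT (CAdd (CVar ENT)
       (CMul (CSub (Query (h Entry) (NVar ROW) (NVar COL)) (CMul delta_exp (Query (h Point) (Num 0) (Num 0))))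
         (CVar CRD)))"

definition add_row :: "(query \<Rightarrow> 'q) \<Rightarrow> 'q com" where
  "add_row h =
     CAssign ENT (CSub (OfNat (Num 0)) (CMul (CVar MODE) (Query (h Coeff) (NVar ROW) (Num 0)))) ;;
     start_digits CND ;;
     For COL LEVEL (entry_step h) ;;
     CAssign NUM (CAdd (CVar NUM) (CMul (CVar ENT) (Cnj (CVar ENT))))"

definition evaluate :: "(query \<Rightarrow> 'q) \<Rightarrow> 'q com" where
  "evaluate h =
     CAssign NUM (OfNat (Num 0)) ;; CAssign DEN (OfNat (Num 0)) ;; For ROW ROWS (add_row h)"

text \<open>Scores are nonnegative, so the initial value 0 of the best score is overwritten by the first
  candidate; later, a candidate replaces the best one unless it is strictly worse.\<close>

definition search :: "(query \<Rightarrow> 'q) \<Rightarrow> 'q com" where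
  "search h =
     NAssign TOTAL (NOp Times (NVar LEVEL) (NVar LEVEL)) ;;
     NAssign BEST (Num 0) ;;
     CAssign TOP (OfNat (Num 0)) ;;
     For CND TOTAL (
       evaluate h ;;
       CAssign SCORE (ReDiv (CAdd (CVar MODE) (CMul (CSub (OfNat (Num 1)) (CVar MODE)) (CVar DEN)))
         (CAdd (CVar NUM) (CVar MODE))) ;;
       Unless (CVar SCORE) (CVar TOP) (NAssign BEST (NVar CND) ;; CAssign TOP (CVar SCORE)))"

definition count_up :: "nat \<Rightarrow> 'q cexp \<Rightarrow> 'q com" where
  "count_up v e = NAssign v (Num 0) ;;
     Repeat (NAssign v (NOp Plus (NVar v) (Num 1))) (OfNat (NVar v)) e"

text \<open>The least positive multiple of the tolerance whose square reaches the radicand.\<close>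

definition sqrt_approx :: "'q cexp \<Rightarrow> 'q com" where
  "sqrt_approx e = CAssign ARG e ;; NAssign TRY (Num 0) ;;
     Repeat (NAssign TRY (NOp Plus (NVar TRY) (Num 1)) ;; CAssign ROOT (CMul (OfNat (NVar TRY)) (CVar TOL)))
       (CMul (CVar ROOT) (CVar ROOT)) (CVar ARG)"

definition find_best :: "(query \<Rightarrow> 'q) \<Rightarrow> nat \<Rightarrow> nat \<Rightarrow> 'q com" where
  "find_best h l g = NAssign LEVEL (NVar l) ;; count_up ROWS (Term 0 (NVar LEVEL)) ;;
     CAssign MODE (OfNat (Num g)) ;; search h"

definition solve :: "(query \<Rightarrow> 'q) \<Rightarrow> 'q com" where
  "solve h = find_best h IDX 1 ;; start_digits BEST ;;
     For COL LEVEL (Emit (NVar COL) digits_exp ;; NAssign DGT drop4_exp) ;;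
     NAssign LEN (NVar IDX)"

definition bound_numerator :: "query option com" where
  "bound_numerator = find_best Some IDX 1 ;; NAssign CND (NVar BEST) ;; evaluate Some ;;
     sqrt_approx (CMul (CMul (CMul (Query None (Num 0) (Num 0)) (Term 1 (NVar IDX)))
       (CMul (Query None (Num 0) (Num 0)) (Term 1 (NVar IDX)))) (CVar DEN)) ;;
     CAssign ACC (CAdd (CMul (Query None (Num 1) (Num 0)) (Term 2 (NVar ROWS))) (CVar ROOT)) ;;
     sqrt_approx (CVar NUM) ;;
     CAssign ACC (CAdd (CVar ACC) (CVar ROOT))"

definition return_value :: "'q cexp \<Rightarrow> 'q com" where
  "return_value e = Emit (Num 0) e ;; NAssign LEN (Num 1)"

definition bound_known_distance :: "query option com" where
  "bound_known_distance =
     CAssign TOL (ReDiv (CMul (Query None (Num 3) (Num 0)) (Query None (Num 2) (Num 0))) (OfNat (Num 2))) ;;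
     bound_numerator ;;
     return_value (ReDiv (CVar ACC) (Query None (Num 2) (Num 0)))"

text \<open>The last parameter is a real number, from which a natural number is recovered by
  counting. It serves as the level of the search for the distance and as the reciprocal of the
  tolerance.\<close>

definition bound_in_limit :: "query option com" where
  "bound_in_limit =
     count_up CNT (Query None (Num 2) (Num 0)) ;;
     CAssign TOL (ReDiv (OfNat (Num 1)) (OfNat (NVar CNT))) ;;
     bound_numerator ;;
     find_best Some CNT 0 ;;
     sqrt_approx (CVar TOP) ;;
     return_value (CMul (CVar ACC) (CVar ROOT))"

lemma mods_start_digits [simp]: "nmods (start_digits k) = {SCL, BASE, DGT}" "cmods (start_digits k) = {}"
  by (auto simp: start_digits_def)

lemma mods_entry_step [simp]: "nmods (entry_step h) = {DGT}" "cmods (entry_step h) = {CRD, DEN, ENT}"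
  by (auto simp: entry_step_def)

lemma mods_add_row [simp]:
  "nmods (add_row h) = {COL, SCL, BASE, DGT}" "cmods (add_row h) = {NUM, DEN, ENT, CRD}"
  by (auto simp: add_row_def)

lemma mods_evaluate [simp]:
  "nmods (evaluate h) = {ROW, COL, SCL, BASE, DGT}" "cmods (evaluate h) = {NUM, DEN, ENT, CRD}"
  by (auto simp: evaluate_def)

lemma mods_search [simp]:
  "nmods (search h) = {TOTAL, BEST, CND, ROW, COL, SCL, BASE, DGT}"
  "cmods (search h) = {TOP, SCORE, NUM, DEN, ENT, CRD}"
  by (auto simp: search_def)

lemma mods_count_up [simp]: "nmods (count_up v e) = {v}" "cmods (count_up v e) = {}"
  by (auto simp: count_up_def)

lemma mods_sqrt_approx [simp]: "nmods (sqrt_approx e) = {TRY}" "cmods (sqrt_approx e) = {ARG, ROOT}"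
  by (auto simp: sqrt_approx_def)

lemma mods_find_best [simp]:
  "nmods (find_best h l g) = {LEVEL, ROWS, TOTAL, BEST, CND, ROW, COL, SCL, BASE, DGT}"
  "cmods (find_best h l g) = {MODE, TOP, SCORE, NUM, DEN, ENT, CRD}"
  by (auto simp: find_best_def)

lemma mods_bound_numerator [simp]:
  "nmods bound_numerator = {LEVEL, ROWS, TOTAL, BEST, CND, ROW, COL, SCL, BASE, DGT, TRY}"
  "cmods bound_numerator = {MODE, TOP, SCORE, NUM, DEN, ENT, CRD, ARG, ROOT, ACC}"
  by (auto simp: bound_numerator_def)

lemma mult_cnj_of_real: "w * cnj w = of_real ((cmod w)\<^sup>2)"
  by (simp add: complex_norm_square[symmetric])

text \<open>The programs see the input only through these three queries, so their correctness is stated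
  for an arbitrary matrix, vector and point.\<close>

definition answers :: "('q \<Rightarrow> nat \<Rightarrow> nat \<Rightarrow> complex) \<Rightarrow> (query \<Rightarrow> 'q) \<Rightarrow>
    (nat \<Rightarrow> nat \<Rightarrow> complex) \<Rightarrow> (nat \<Rightarrow> complex) \<Rightarrow> complex \<Rightarrow> bool" where
  "answers orc h a x z \<longleftrightarrow>
     (\<forall>i j. orc (h Entry) i j = a i j) \<and> (\<forall>i. orc (h Coeff) i 0 = x i) \<and> orc (h Point) 0 0 = z"

lemma wp_add_row:
  assumes l: "nvar s LEVEL = l" "l \<ge> 1" and k: "nvar s CND = k" and i: "nvar s ROW = i"
    and g: "cvar s MODE = of_real g"
    and orc: "answers orc h a x z"
  shows "wp orc seqs n (add_row h)
    (\<lambda>t. cvar t NUM = cvar s NUM + of_real ((cmod ((\<Sum>j<l. (a i j - (if i = j then z else 0)) *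
        cand l k j) - of_real g * x i))\<^sup>2) \<and>
      cvar t DEN = cvar s DEN + of_real (if i < l then (cmod (cand l k i))\<^sup>2 else 0)) s"
proof -
  define u where "u = cand l k"
  define r where "r j' = (\<Sum>j<j'. (a i j - (if i = j then z else 0)) * u j) - of_real g * x i" for j'
  define Inv where "Inv j t \<longleftrightarrow> cvar t ENT = r j \<and>
    cvar t DEN = cvar s DEN + of_real (\<Sum>j'<j. if i = j' then (cmod (u j'))\<^sup>2 else 0) \<and>
    cvar t NUM = cvar s NUM \<and> nvar t ROW = i \<and> nvar t SCL = k div l + 1 \<and>
    nvar t BASE = nvar t SCL * nvar t SCL \<and> nvar t DGT = (drop4 (k div l + 1) ^^ j) (k mod l)"
    for j and t :: store
  have r_Suc: "r (Suc j) = r j + (a i j - (if i = j then z else 0)) * u j" for j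
    by (simp add: r_def)
  have u_digits: "u j = quad_digits (k div l + 1) ((drop4 (k div l + 1) ^^ j) (k mod l))" for j
    by (simp add: u_def cand_def grid_def)
  have r_l: "(\<Sum>j<l. (a i j - (if i = j then z else 0)) * u j) - of_real g * x i = r l"
    by (simp add: r_def)
  show ?thesis
    unfolding add_row_def start_digits_def wp_simps u_def[symmetric]
    unfolding r_l
  proof (rule wp_mono[OF wp_For[where Inv = Inv and N = l]], goal_cases)
    case (7 j t)
    then have inv: "Inv j t" and j: "nvar t COL = j" by simp_all
    have uj: "cval orc seqs digits_exp t = u j"
      using inv by (simp add: Inv_def cval_digits_exp u_digits)
    show ?case
    proof (cases "i = j")
      case True
      then show ?thesis using inv j orc
        by (simp add: Inv_def entry_step_def uj cval_delta_exp nval_drop4_exp answers_def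
            mult_cnj_of_real r_Suc del: of_real_power)
    next
      case False
      then show ?thesis using inv j orc
        by (simp add: Inv_def entry_step_def uj cval_delta_exp nval_drop4_exp answers_def
            mult_cnj_of_real r_Suc del: of_real_power)
    qed
  next
    case (8 t)
    then show ?case
      by (simp add: Inv_def mult_cnj_of_real del: of_real_power)
  qed (use assms in \<open>simp_all add: Inv_def r_def answers_def\<close>)
qed

lemma wp_evaluate:
  assumes l: "nvar s LEVEL = l" "l \<ge> 1" and m: "nvar s ROWS = m" "m \<ge> l" and k: "nvar s CND = k"
    and g: "cvar s MODE = of_real g"
    and orc: "answers orc h a x z"
  shows "wp orc seqs n (evaluate h)
    (\<lambda>t. cvar t NUM = of_real (residual a x z l m g (cand l k)) \<and>
      cvar t DEN = of_real (mass l (cand l k))) s"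
proof -
  define num where "num i' = (\<Sum>i<i'. (cmod ((\<Sum>j<l. (a i j - (if i = j then z else 0)) *
    cand l k j) - of_real g * x i))\<^sup>2)" for i'
  define den where "den i' = (\<Sum>i<i'. if i < l then (cmod (cand l k i))\<^sup>2 else 0)" for i'
  define Inv where "Inv i t \<longleftrightarrow> cvar t NUM = of_real (num i) \<and> cvar t DEN = of_real (den i) \<and>
    nvar t LEVEL = l \<and> nvar t CND = k \<and> cvar t MODE = of_real g"
    for i and t :: store
  have "wp orc seqs n (evaluate h) (Inv m) s"
    unfolding evaluate_def wp_simps
  proof (rule wp_For)
    fix i t
    assume inv: "Inv i t" and i: "nvar t ROW = i"
    then have t: "nvar t LEVEL = l" "nvar t CND = k" "cvar t MODE = of_real g"
      by (simp_all add: Inv_def)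
    show "wp orc seqs n (add_row h) (\<lambda>u. Inv (Suc i) (u\<lparr>nvar := (nvar u)(ROW := Suc i)\<rparr>)) t"
      using inv by (intro wp_mono[OF wp_add_row[OF t(1) l(2) t(2) i t(3) orc]])
        (use t in \<open>simp_all add: Inv_def num_def den_def unchanged_def del: of_real_power\<close>)
  qed (use l m k g in \<open>simp_all add: Inv_def num_def den_def\<close>)
  moreover have "den m = mass l (cand l k)"
  proof -
    have "den m = (\<Sum>i<l. if i < l then (cmod (cand l k i))\<^sup>2 else 0)"
      unfolding den_def using m(2) by (intro sum.mono_neutral_right) auto
    then show ?thesis by (simp add: mass_def)
  qed
  ultimately show ?thesis
    by (elim wp_mono) (simp add: Inv_def num_def residual_def)
qed

lemma wp_search:
  assumes l: "nvar s LEVEL = l" "l \<ge> 1" and m: "nvar s ROWS = m" "m \<ge> l"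
    and g: "cvar s MODE = of_real g" "0 \<le> g" "g \<le> 1"
    and orc: "answers orc h a x z"
  shows "wp orc seqs n (search h)
    (\<lambda>t. nvar t BEST = best a x z l m g \<and>
      cvar t TOP = of_real (score a x z l m g (cand l (best a x z l m g)))) s"
proof -
  define f where "f k = score a x z l m g (cand l k)" for k
  have best: "best a x z l m g = last_argmax f (l * l)"
    by (simp add: best_def f_def[abs_def])
  define Inv where "Inv k t \<longleftrightarrow> nvar t BEST = last_argmax f k \<and>
    cvar t TOP = of_real (if k = 0 then 0 else f (last_argmax f k)) \<and>
    nvar t LEVEL = l \<and> nvar t ROWS = m \<and> cvar t MODE = of_real g" for k and t :: store
  have "wp orc seqs n (search h) (Inv (l * l)) s"
    unfolding search_def wp_simps(1,2,4)
  proof (rule wp_For)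
    fix k t
    assume inv: "Inv k t" and k: "nvar t CND = k"
    from inv have t: "nvar t LEVEL = l" "nvar t ROWS = m" "cvar t MODE = of_real g" by (simp_all add: Inv_def)
    show "wp orc seqs n (evaluate h ;;
       CAssign SCORE (ReDiv (CAdd (CVar MODE) (CMul (CSub (OfNat (Num 1)) (CVar MODE)) (CVar DEN)))
         (CAdd (CVar NUM) (CVar MODE))) ;;
       Unless (CVar SCORE) (CVar TOP) (NAssign BEST (NVar CND) ;; CAssign TOP (CVar SCORE)))
      (\<lambda>u. Inv (Suc k) (u\<lparr>nvar := (nvar u)(CND := Suc k)\<rparr>)) t"
      unfolding wp_simps(4)
    proof (rule wp_mono[OF wp_evaluate[OF t(1) l(2) t(2) m(2) k t(3) orc]])
      fix u assume val: "cvar u NUM = of_real (residual a x z l m g (cand l k)) \<and>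
        cvar u DEN = of_real (mass l (cand l k))" and un: "unchanged (evaluate h) t u"
      have u: "nvar u LEVEL = l" "nvar u ROWS = m" "cvar u MODE = of_real g" "nvar u CND = k"
        "nvar u BEST = nvar t BEST" "cvar u TOP = cvar t TOP"
        using un t k by (simp_all add: unchanged_def)
      have fk: "f k = Re (cvar u MODE + (1 - cvar u MODE) * cvar u DEN) / Re (cvar u NUM + cvar u MODE)"
        using val u by (simp add: f_def score_def)
      have "0 \<le> f k"
        using g(2,3) by (auto simp: f_def score_def residual_def mass_def sum_nonneg
            intro!: divide_nonneg_nonneg add_nonneg_nonneg)
      then have "0 \<le> Re (cvar u MODE + (1 - cvar u MODE) * cvar u DEN) / Re (cvar u NUM + cvar u MODE)"
        by (simp add: fk)
      with fk show "wp orc seqs n (CAssign SCORE (ReDiv (CAdd (CVar MODE) (CMul (CSub (OfNat (Num 1)) (CVar MODE))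
          (CVar DEN))) (CAdd (CVar NUM) (CVar MODE))))
        (wp orc seqs n (Unless (CVar SCORE) (CVar TOP) (NAssign BEST (NVar CND) ;; CAssign TOP (CVar SCORE)))
          (\<lambda>u. Inv (Suc k) (u\<lparr>nvar := (nvar u)(CND := Suc k)\<rparr>))) u"
        using inv u by (auto simp: Inv_def not_less f_def[symmetric])
    qed
  qed (use l m g in \<open>simp_all add: Inv_def\<close>)
  then show ?thesis
    using l(2) by (elim wp_mono) (simp add: Inv_def best f_def)
qed

lemma wp_count_up:
  assumes e: "\<And>t. unchanged (count_up v e) s t \<Longrightarrow> Re (cval orc seqs e t) = r"
    and stop: "1 \<le> stop" "r \<le> real stop" "\<And>k. 1 \<le> k \<Longrightarrow> k < stop \<Longrightarrow> real k < r"
  shows "wp orc seqs n (count_up v e) (\<lambda>t. nvar t v = stop) s"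
  unfolding count_up_def wp_simps(1,4)
proof (rule wp_Repeat[where Inv = "\<lambda>t. nvar t v < stop \<and> unchanged (count_up v e) s t" and
    m = "\<lambda>t. stop - nvar t v"])
  fix t assume t: "nvar t v < stop \<and> unchanged (count_up v e) s t"
  let ?t = "t\<lparr>nvar := (nvar t)(v := Suc (nvar t v))\<rparr>"
  have un: "unchanged (count_up v e) s ?t" using t by (simp add: unchanged_def)
  from e[OF this] have "Re (cval orc seqs e ?t) = r" .
  moreover have "real (Suc (nvar t v)) < r \<longleftrightarrow> Suc (nvar t v) < stop"
    using stop(2) stop(3)[of "Suc (nvar t v)"] t by (auto simp: not_less)
  ultimately show "wp orc seqs n (NAssign v (NOp Plus (NVar v) (Num 1)))
     (\<lambda>u. if Re (cval orc seqs (OfNat (NVar v)) u) < Re (cval orc seqs e u)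
       then (nvar u v < stop \<and> unchanged (count_up v e) s u) \<and> stop - nvar u v < stop - nvar t v
       else nvar u v = stop) t"
    using un t by auto
qed (use stop in \<open>simp_all add: unchanged_def\<close>)

text \<open>The loop stops because the multiples of \<open>\<delta>\<close> are unbounded. The last multiple is at least
  \<open>sqrt A\<close>, and the previous one is smaller than \<open>sqrt A\<close> or zero.\<close>

lemma wp_sqrt_approx:
  assumes e: "cval orc seqs e s = of_real A" and d: "cvar s TOL = of_real \<delta>" "\<delta> > 0"
    and A: "A \<ge> 0"
  shows "wp orc seqs n (sqrt_approx e) (\<lambda>t. \<exists>R. cvar t ROOT = of_real R \<and> \<bar>R - sqrt A\<bar> \<le> \<delta>) s"
proof -
  define bnd where "bnd = nat \<lceil>sqrt A / \<delta>\<rceil> + 1"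
  have bnd: "sqrt A \<le> real bnd * \<delta>"
  proof -
    have "sqrt A / \<delta> \<le> real bnd" unfolding bnd_def by linarith
    then show ?thesis using d(2) by (simp add: field_simps)
  qed
  have sq: "(real k * \<delta>) * (real k * \<delta>) < A \<longleftrightarrow> real k * \<delta> < sqrt A" for k
  proof -
    have "0 \<le> real k * \<delta>" using d(2) by simp
    then have "sqrt ((real k * \<delta>) * (real k * \<delta>)) = real k * \<delta>"
      by (simp only: real_sqrt_mult_self real_sqrt_abs2 abs_of_nonneg)
    then show ?thesis using real_sqrt_less_iff by metis
  qed
  define Inv where "Inv t \<longleftrightarrow> cvar t TOL = of_real \<delta> \<and> cvar t ARG = of_real A \<and>
    (nvar t TRY = 0 \<or> real (nvar t TRY) * \<delta> < sqrt A)" for t :: store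
  show ?thesis
    unfolding sqrt_approx_def wp_simps(1,2,4)
  proof (rule wp_Repeat[where Inv = Inv and m = "\<lambda>t. bnd - nvar t TRY"])
    fix t assume inv: "Inv t"
    define k where "k = nvar t TRY"
    have kN: "k < bnd"
    proof (cases "k = 0")
      case False
      then have "real k * \<delta> < real bnd * \<delta>" using inv bnd by (simp add: Inv_def k_def)
      then show ?thesis using d(2) by simp
    qed (simp add: bnd_def)
    have val: "Re ((of_nat (Suc k) * of_real \<delta>) * (of_nat (Suc k) * of_real \<delta>)) < A \<longleftrightarrow>
        real (Suc k) * \<delta> < sqrt A"
      unfolding sq[symmetric] by simp
    have near: "\<bar>real (Suc k) * \<delta> - sqrt A\<bar> \<le> \<delta>" if "\<not> real (Suc k) * \<delta> < sqrt A"
    proof (cases "k = 0")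
      case True
      then show ?thesis using that A by auto
    next
      case False
      then have "real k * \<delta> < sqrt A" using inv by (simp add: Inv_def k_def)
      then show ?thesis using that by (simp add: algebra_simps)
    qed
    show "wp orc seqs n (NAssign TRY (NOp Plus (NVar TRY) (Num 1)) ;;
        CAssign ROOT (CMul (OfNat (NVar TRY)) (CVar TOL)))
      (\<lambda>u. if Re (cval orc seqs (CMul (CVar ROOT) (CVar ROOT)) u) < Re (cval orc seqs (CVar ARG) u)
        then Inv u \<and> bnd - nvar u TRY < bnd - nvar t TRY
        else \<exists>R. cvar u ROOT = of_real R \<and> \<bar>R - sqrt A\<bar> \<le> \<delta>) t"
    proof (cases "real (Suc k) * \<delta> < sqrt A")
      case True
      with val inv kN show ?thesis by (simp add: Inv_def k_def[symmetric])
    next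
      case False
      with val inv near[OF False] show ?thesis
        by (auto simp: Inv_def k_def[symmetric] intro!: exI[of _ "real (Suc k) * \<delta>"])
    qed
  qed (use e d in \<open>simp add: Inv_def\<close>)
qed


lemma wp_find_best:
  assumes seqs: "seqs \<noteq> []" "seqs ! 0 = (\<lambda>n. real (f n))"
    and l: "nvar s v = l" "l \<ge> 1" "f l \<ge> l" and g: "g \<le> 1"
    and orc: "answers orc h a x z"
  shows "wp orc seqs n (find_best h v g)
    (\<lambda>t. nvar t BEST = best a x z l (f l) (real g) \<and>
      cvar t TOP = of_real (score a x z l (f l) (real g) (cand l (best a x z l (f l) (real g)))) \<and>
      nvar t LEVEL = l \<and> nvar t ROWS = f l \<and> cvar t MODE = of_real (real g)) s"
  unfolding find_best_def wp_simps(1,4)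
proof (rule wp_mono[OF wp_count_up[where r = "real (f l)" and stop = "f l"]])
  fix t assume "nvar t ROWS = f l"
    and "unchanged (count_up ROWS (Term 0 (NVar LEVEL) :: 'a cexp))
      (s\<lparr>nvar := (nvar s)(LEVEL := nval (NVar v) (nvar s))\<rparr>) t"
  then have t: "nvar t ROWS = f l" "nvar t LEVEL = l" using l by (simp_all add: unchanged_def)
  show "wp orc seqs n (CAssign MODE (OfNat (Num g))) (wp orc seqs n (search h)
    (\<lambda>t. nvar t BEST = best a x z l (f l) (real g) \<and>
      cvar t TOP = of_real (score a x z l (f l) (real g) (cand l (best a x z l (f l) (real g)))) \<and>
      nvar t LEVEL = l \<and> nvar t ROWS = f l \<and> cvar t MODE = of_real (real g))) t"
    unfolding wp_simps(2)
  proof (rule wp_mono[OF wp_search[where l = l and m = "f l" and g = "real g", OF _ l(2) _ l(3) _ _ _ orc]])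
    fix u
    assume "nvar u BEST = best a x z l (f l) (real g) \<and>
        cvar u TOP = of_real (score a x z l (f l) (real g) (cand l (best a x z l (f l) (real g))))"
      and "unchanged (search h) (t\<lparr>cvar := (cvar t)(MODE := cval orc seqs (OfNat (Num g)) t)\<rparr>) u"
    then show "nvar u BEST = best a x z l (f l) (real g) \<and>
        cvar u TOP = of_real (score a x z l (f l) (real g) (cand l (best a x z l (f l) (real g)))) \<and>
        nvar u LEVEL = l \<and> nvar u ROWS = f l \<and> cvar u MODE = of_real (real g)"
      using t by (simp add: unchanged_def)
  qed (use t g in simp_all)
next
  fix t :: store
  assume "unchanged (count_up ROWS (Term 0 (NVar LEVEL) :: 'a cexp))
      (s\<lparr>nvar := (nvar s)(LEVEL := nval (NVar v) (nvar s))\<rparr>) t"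
  then show "Re (cval orc seqs (Term 0 (NVar LEVEL)) t) = real (f l)"
    using seqs l by (simp add: unchanged_def)
qed (use l in simp_all)

lemma wp_solve:
  assumes seqs: "seqs \<noteq> []" "seqs ! 0 = (\<lambda>n. real (f n))"
    and n: "n \<ge> 1" "f n \<ge> n" and orc: "answers orc h a x z"
  shows "wp orc seqs n (solve h)
    (\<lambda>t. nvar t LEN = n \<and> (\<forall>j<n. outp t j = cand n (best a x z n (f n) 1) j)) (initial_store n)"
proof -
  define b where "b = best a x z n (f n) 1"
  have find: "wp orc seqs n (find_best h IDX 1)
      (\<lambda>t. nvar t BEST = b \<and> nvar t LEVEL = n \<and> nvar t IDX = n) (initial_store n)"
    by (rule wp_mono[OF wp_find_best[where l = n and f = f and a = a and x = x and z = z, OF seqs _ n(1,2) _ orc]])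
      (simp_all add: initial_store_def unchanged_def b_def)
  define Inv where "Inv j u \<longleftrightarrow> (\<forall>j'<j. outp u j' = cand n b j') \<and> nvar u IDX = n \<and>
    nvar u SCL = b div n + 1 \<and> nvar u BASE = nvar u SCL * nvar u SCL \<and>
    nvar u DGT = (drop4 (b div n + 1) ^^ j) (b mod n)" for j and u :: store
  have step: "wp orc seqs n (Emit (NVar COL) digits_exp ;; NAssign DGT drop4_exp)
      (\<lambda>v. Inv (Suc j) (v\<lparr>nvar := (nvar v)(COL := Suc j)\<rparr>)) u"
    if "j < n" "Inv j u" "nvar u COL = j" for j u
    using that by (auto simp: Inv_def cval_digits_exp nval_drop4_exp cand_def grid_def less_Suc_eq)
  have loop: "wp orc seqs n (For COL LEVEL (Emit (NVar COL) digits_exp ;; NAssign DGT drop4_exp)) (Inv n) u"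
    if "nvar u LEVEL = n" "Inv 0 (u\<lparr>nvar := (nvar u)(COL := 0)\<rparr>)" for u
    using that n(1) by (intro wp_For step) simp_all
  from find show ?thesis
    unfolding solve_def start_digits_def wp_simps(1,4) b_def[symmetric]
  proof (rule wp_mono, goal_cases)
    case (1 t)
    then show ?case by (intro wp_mono[OF loop]) (simp_all add: Inv_def)
  qed
qed

definition parameters :: "(query option \<Rightarrow> nat \<Rightarrow> nat \<Rightarrow> complex) \<Rightarrow> real list \<Rightarrow> bool" where
  "parameters orc rs \<longleftrightarrow> (\<forall>i<length rs. orc None i 0 = of_real (rs ! i))"

lemma wp_bound_numerator:
  assumes n: "nvar s IDX = n" "n \<ge> 1" "f n \<ge> n" and orc: "answers orc Some a x z"
    and par: "orc None 0 0 = of_real C\<^sub>1" "orc None 1 0 = of_real C\<^sub>2" "0 \<le> C\<^sub>1" "0 \<le> \<alpha> n"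
    and d: "cvar s TOL = of_real \<delta>" "\<delta> > 0"
    and u: "u = cand n (best a x z n (f n) 1)"
  shows "wp orc [\<lambda>n. real (f n), \<alpha>, \<beta>] n' bound_numerator
    (\<lambda>t. \<exists>v. cvar t ACC = of_real v \<and> \<bar>v - (C\<^sub>2 * \<beta> (f n) + C\<^sub>1 * \<alpha> n * sqrt (mass n u) +
        sqrt (residual a x z n (f n) 1 u))\<bar> \<le> 2 * \<delta>) s"
proof -
  define b where "b = best a x z n (f n) 1"
  define num where "num = residual a x z n (f n) 1 u"
  define den where "den = (C\<^sub>1 * \<alpha> n) * (C\<^sub>1 * \<alpha> n) * mass n u"
  let ?seqs = "[\<lambda>n. real (f n), \<alpha>, \<beta>]"
  have pos: "num \<ge> 0" "den \<ge> 0"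
    by (simp_all add: num_def den_def residual_def mass_def sum_nonneg)
  have sqrt_den: "sqrt den = C\<^sub>1 * \<alpha> n * sqrt (mass n u)"
    using par(3,4) by (simp add: den_def real_sqrt_mult)
  have 1: "wp orc ?seqs n' (find_best Some IDX 1) (\<lambda>t. nvar t BEST = b \<and> nvar t LEVEL = n \<and>
      nvar t ROWS = f n \<and> cvar t MODE = of_real 1 \<and> nvar t IDX = n \<and> cvar t TOL = of_real \<delta>) s"
    using n(1) d(1)
    by (intro wp_mono[OF wp_find_best[where l = n and f = f and a = a and x = x and z = z, OF _ _ n _ orc]])
      (simp_all add: unchanged_def b_def)
  have 2: "wp orc ?seqs n' (evaluate Some) (\<lambda>t. cvar t NUM = of_real num \<and>
      cvar t DEN = of_real (mass n u) \<and> nvar t IDX = n \<and> cvar t TOL = of_real \<delta> \<and> nvar t ROWS = f n) t"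
    if "nvar t CND = b" "nvar t LEVEL = n" "nvar t ROWS = f n" "cvar t MODE = of_real 1" "nvar t IDX = n"
      "cvar t TOL = of_real \<delta>" for t
    by (rule wp_mono[OF wp_evaluate[OF that(2) n(2) that(3) n(3) that(1,4) orc]])
      (use that in \<open>simp_all add: unchanged_def num_def u b_def\<close>)
  have 3: "wp orc ?seqs n' (sqrt_approx (CMul (CMul (CMul (Query None (Num 0) (Num 0)) (Term 1 (NVar IDX)))
       (CMul (Query None (Num 0) (Num 0)) (Term 1 (NVar IDX)))) (CVar DEN)))
      (\<lambda>t. cvar t NUM = of_real num \<and> cvar t TOL = of_real \<delta> \<and> nvar t ROWS = f n \<and>
        (\<exists>R. cvar t ROOT = of_real R \<and> \<bar>R - sqrt den\<bar> \<le> \<delta>)) t"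
    if "cvar t NUM = of_real num" "cvar t DEN = of_real (mass n u)" "nvar t IDX = n"
      "cvar t TOL = of_real \<delta>" "nvar t ROWS = f n" for t
    by (rule wp_mono[OF wp_sqrt_approx[OF _ that(4) d(2) pos(2)]])
      (use that par in \<open>simp_all add: unchanged_def den_def\<close>)
  have 4: "wp orc ?seqs n' (sqrt_approx (CVar NUM))
      (\<lambda>t. cvar t ACC = cvar t' ACC \<and> (\<exists>R. cvar t ROOT = of_real R \<and> \<bar>R - sqrt num\<bar> \<le> \<delta>)) t'"
    if "cvar t' NUM = of_real num" "cvar t' TOL = of_real \<delta>" for t'
    by (rule wp_mono[OF wp_sqrt_approx[OF _ that(2) d(2) pos(1)]])
      (use that in \<open>simp_all add: unchanged_def\<close>)
  show ?thesis
    unfolding bound_numerator_def wp_simps(4)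
  proof (rule wp_mono[OF 1], goal_cases)
    case (1 t)
    show ?case
      unfolding wp_simps(1)
    proof (rule wp_mono[OF 2], goal_cases)
      case (7 t)
      show ?case
      proof (rule wp_mono[OF 3], goal_cases)
        case (6 t)
        then obtain R where R: "cvar t ROOT = of_real R" "\<bar>R - sqrt den\<bar> \<le> \<delta>" by blast
        show ?case
          unfolding wp_simps(2)
        proof (rule wp_mono[OF 4], goal_cases)
          case (3 t')
          then obtain R' where R': "cvar t' ROOT = of_real R'" "\<bar>R' - sqrt num\<bar> \<le> \<delta>" by blast
          show ?case
            using 3 6 R R' par by (intro exI[of _ "C\<^sub>2 * \<beta> (f n) + R + R'"])
              (auto simp: sqrt_den num_def abs_le_iff)
        qed (use 6 in simp_all)
      qed (use 7 in simp_all)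
    qed (use 1 in simp_all)
  qed
qed

lemma wp_bound_known_distance:
  assumes n: "n \<ge> 1" "f n \<ge> n" and orc: "answers orc Some a x z"
    and par: "parameters orc [C\<^sub>1, C\<^sub>2, d, \<epsilon>]" "0 \<le> C\<^sub>1" "0 \<le> \<alpha> n" "d > 0" "\<epsilon> > 0"
    and u: "u = cand n (best a x z n (f n) 1)"
  shows "wp orc [\<lambda>n. real (f n), \<alpha>, \<beta>] n bound_known_distance
    (\<lambda>t. nvar t LEN = 1 \<and> (\<exists>v. outp t 0 = of_real v \<and>
      \<bar>v - (C\<^sub>2 * \<beta> (f n) + C\<^sub>1 * \<alpha> n * sqrt (mass n u) + sqrt (residual a x z n (f n) 1 u)) / d\<bar> \<le> \<epsilon>))
    (initial_store n)"
proof -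
  have p: "orc None 0 0 = of_real C\<^sub>1" "orc None 1 0 = of_real C\<^sub>2" "orc None 2 0 = of_real d"
    "orc None 3 0 = of_real \<epsilon>"
    using par(1) unfolding parameters_def
    by (force dest: spec[of _ 0] spec[of _ 1] spec[of _ 2] spec[of _ 3] simp: eval_nat_numeral)+
  have "0 < \<epsilon> * d / 2" using par by simp
  note num = wp_bound_numerator[where f = f and n = n and \<alpha> = \<alpha> and \<delta> = "\<epsilon> * d / 2", OF _ n orc p(1,2) par(2,3) _ this u]
  show ?thesis
    unfolding bound_known_distance_def return_value_def wp_simps(2,4)
  proof (rule wp_mono[OF num], goal_cases)
    case (3 t)
    then obtain v where v: "cvar t ACC = of_real v" "\<bar>v - (C\<^sub>2 * \<beta> (f n) + C\<^sub>1 * \<alpha> n * sqrt (mass n u) +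
        sqrt (residual a x z n (f n) 1 u))\<bar> \<le> \<epsilon> * d" by auto
    from v(2) have "\<bar>v / d - (C\<^sub>2 * \<beta> (f n) + C\<^sub>1 * \<alpha> n * sqrt (mass n u) +
        sqrt (residual a x z n (f n) 1 u)) / d\<bar> \<le> \<epsilon>"
      using par(4) by (simp add: diff_divide_distrib[symmetric] abs_divide pos_divide_le_eq)
    then show ?case using v(1) p n(1) by (auto intro!: exI[of _ "v / d"])
  qed (use p in \<open>simp_all add: initial_store_def\<close>)
qed

lemma wp_bound_in_limit:
  assumes n: "n \<ge> 1" and f: "\<And>n. n \<ge> 1 \<Longrightarrow> f n \<ge> n" and orc: "answers orc Some a x z"
    and par: "parameters orc [C\<^sub>1, C\<^sub>2, real m]" "0 \<le> C\<^sub>1" "0 \<le> \<alpha> n"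
    and u: "u = cand n (best a x z n (f n) 1)"
    and l: "l = max 1 m"
  shows "wp orc [\<lambda>n. real (f n), \<alpha>, \<beta>] n bound_in_limit
    (\<lambda>t. nvar t LEN = 1 \<and> (\<exists>v R. outp t 0 = of_real (v * R) \<and>
      \<bar>v - (C\<^sub>2 * \<beta> (f n) + C\<^sub>1 * \<alpha> n * sqrt (mass n u) + sqrt (residual a x z n (f n) 1 u))\<bar> \<le> 2 / real l \<and>
      \<bar>R - sqrt (score a x z l (f l) 0 (cand l (best a x z l (f l) 0)))\<bar> \<le> 1 / real l))
    (initial_store n)"
proof -
  have p: "orc None 0 0 = of_real C\<^sub>1" "orc None 1 0 = of_real C\<^sub>2" "orc None 2 0 = of_real (real m)"
    using par(1) unfolding parameters_def
    by (force dest: spec[of _ 0] spec[of _ 1] spec[of _ 2] simp: eval_nat_numeral)+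
  have l1: "l \<ge> 1" "1 / real l > 0" and fl: "f l \<ge> l" using f[of l] l by auto
  let ?seqs = "[\<lambda>n. real (f n), \<alpha>, \<beta>]"
  define top where "top = score a x z l (f l) 0 (cand l (best a x z l (f l) 0))"
  have top: "top \<ge> 0"
    by (auto simp: top_def score_def residual_def mass_def sum_nonneg intro!: divide_nonneg_nonneg)
  note num = wp_bound_numerator[where f = f and n = n and \<alpha> = \<alpha> and \<delta> = "1 / real l",
      OF _ n f[OF n] orc p(1,2) par(2,3) _ l1(2) u]
  have count: "wp orc ?seqs n (count_up CNT (Query None (Num 2) (Num 0)))
      (\<lambda>t. nvar t CNT = l \<and> nvar t IDX = n) (initial_store n)"
    by (rule wp_mono[OF wp_count_up[where r = "real m" and stop = l]])
      (use p l in \<open>auto simp: initial_store_def unchanged_def\<close>)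
  have dist: "wp orc ?seqs n (find_best Some CNT 0) (\<lambda>t'. cvar t' TOP = of_real top \<and>
      cvar t' ACC = cvar t ACC \<and> cvar t' TOL = cvar t TOL) t" if "nvar t CNT = l" for t
    by (rule wp_mono[OF wp_find_best[where l = l and f = f and a = a and x = x and z = z,
          OF _ _ that l1(1) fl _ orc]])
      (simp_all add: unchanged_def top_def)
  have rt: "wp orc ?seqs n (sqrt_approx (CVar TOP)) (\<lambda>t'. cvar t' ACC = cvar t ACC \<and>
      (\<exists>R. cvar t' ROOT = of_real R \<and> \<bar>R - sqrt top\<bar> \<le> 1 / real l)) t"
    if "cvar t TOP = of_real top" "cvar t TOL = of_real (1 / real l)" for t
    by (rule wp_mono[OF wp_sqrt_approx[OF _ that(2) l1(2) top]])
      (use that in \<open>simp_all add: unchanged_def\<close>)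
  show ?thesis
    unfolding bound_in_limit_def return_value_def wp_simps(4) top_def[symmetric]
  proof (rule wp_mono[OF count], goal_cases)
    case (1 t)
    show ?case
      unfolding wp_simps(2)
    proof (rule wp_mono[OF num], goal_cases)
      case (3 t')
      then have TOL: "cvar t' TOL = of_real (1 / real l)" and CNT: "nvar t' CNT = l"
        using 1 by (simp_all add: unchanged_def)
      from 3 obtain v where v: "cvar t' ACC = of_real v" "\<bar>v - (C\<^sub>2 * \<beta> (f n) + C\<^sub>1 * \<alpha> n * sqrt (mass n u) +
        sqrt (residual a x z n (f n) 1 u))\<bar> \<le> 2 / real l" by auto
      show ?case
      proof (rule wp_mono[OF dist[OF CNT]], goal_cases)
        case (1 s)
        show ?case
        proof (rule wp_mono[OF rt], goal_cases)
          case (3 s')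
          then obtain R where R: "cvar s' ROOT = of_real R" "\<bar>R - sqrt top\<bar> \<le> 1 / real l" by blast
          have "\<exists>v' R'. complex_of_real v * of_real R = of_real (v' * R') \<and>
            \<bar>v' - (C\<^sub>2 * \<beta> (f n) + C\<^sub>1 * \<alpha> n * sqrt (mass n u) +
              sqrt (residual a x z n (f n) 1 u))\<bar> \<le> 2 / real l \<and> \<bar>R' - sqrt top\<bar> \<le> 1 / real l"
            by (rule exI[of _ v], rule exI[of _ R]) (simp add: v(2) R(2))
          then show ?case
            using 1 3 R(1) v(1) n by simp
        qed (use 1 TOL in simp_all)
      qed
    qed (use 1 in simp_all)
  qed
qed

section \<open>The geometry of square-summable sequences\<close>

lemma coeff_eqI: "(\<And>k. coeff x k = coeff y k) \<Longrightarrow> x = y"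
  by (metis coeff_inject ext)

lemmas coeff_simps [simp] = plus_ell2.rep_eq minus_ell2.rep_eq uminus_ell2.rep_eq
  scaleR_ell2.rep_eq zero_ell2.rep_eq cscale.rep_eq proj.rep_eq basis_vec.rep_eq

lemma coeff_sum: "coeff (sum g A) k = (\<Sum>a\<in>A. coeff (g a) k)"
  by (induction A rule: infinite_finite_induct) auto

lemma norm_sq_sums: "(\<lambda>k. (cmod (coeff x k))\<^sup>2) sums (norm x)\<^sup>2"
  using summable_coeff[of x] by (simp add: norm_ell2.rep_eq suminf_nonneg summable_sums)

lemma norm_ell2_le:
  assumes "\<And>K. (\<Sum>k<K. (cmod (coeff x k))\<^sup>2) \<le> e\<^sup>2" "0 \<le> e"
  shows "norm x \<le> e"
proof -
  have "(norm x)\<^sup>2 \<le> e\<^sup>2"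
    unfolding sums_unique[OF norm_sq_sums[of x]]
    by (rule suminf_le_const[OF sums_summable[OF norm_sq_sums] assms(1)])
  then show ?thesis using assms(2) by (rule power2_le_imp_le)
qed

lemma sum_coeff_le: "(\<Sum>k<K. (cmod (coeff x k))\<^sup>2) \<le> (norm x)\<^sup>2"
  using norm_sq_sums[of x] by (simp add: sums_iff) (metis sum_le_suminf finite_lessThan zero_le_power2)

lemma cmod_coeff_le: "cmod (coeff x k) \<le> norm x"
proof (rule power2_le_imp_le)
  have "(cmod (coeff x k))\<^sup>2 \<le> (\<Sum>j<Suc k. (cmod (coeff x j))\<^sup>2)" by (simp add: sum_nonneg)
  then show "(cmod (coeff x k))\<^sup>2 \<le> (norm x)\<^sup>2" using sum_coeff_le order_trans by blast
qed simp

lemma norm_cscale: "norm (c *\<^sub>C x) = cmod c * norm x"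
proof -
  have "(\<lambda>k. (cmod c)\<^sup>2 * (cmod (coeff x k))\<^sup>2) sums ((cmod c)\<^sup>2 * (norm x)\<^sup>2)"
    by (intro sums_mult norm_sq_sums)
  then have "(\<lambda>k. (cmod (coeff (c *\<^sub>C x) k))\<^sup>2) sums ((cmod c * norm x)\<^sup>2)"
    by (simp add: norm_mult power_mult_distrib)
  then have "(norm (c *\<^sub>C x))\<^sup>2 = (cmod c * norm x)\<^sup>2"
    using norm_sq_sums sums_unique2 by blast
  then show ?thesis by (simp add: power2_eq_iff_nonneg)
qed

lemma scaleR_cscale: "r *\<^sub>R x = of_real r *\<^sub>C x"
  by (rule coeff_eqI) simp

lemma cinner_sums: "(\<lambda>k. coeff x k * cnj (coeff y k)) sums cinner x y"
  unfolding cinner.rep_eq by (intro summable_sums summable_ell2_cinner summable_coeff)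

lemma cinner_diff_left: "cinner (x - y) w = cinner x w - cinner y w"
  using sums_diff[OF cinner_sums[of x w] cinner_sums[of y w]] cinner_sums[of "x - y" w]
  by (simp add: algebra_simps sums_iff)

lemma cinner_cscale_left: "cinner (c *\<^sub>C x) w = c * cinner x w"
  using sums_mult[OF cinner_sums[of x w], of c] cinner_sums[of "c *\<^sub>C x" w]
  by (simp add: algebra_simps sums_iff)

lemma cinner_commute: "cinner x y = cnj (cinner y x)"
  using sums_cnj[THEN iffD2, OF cinner_sums[of y x]] cinner_sums[of x y]
  by (simp add: mult.commute sums_iff)

lemma cinner_diff_right: "cinner x (y - w) = cinner x y - cinner x w"
  using cinner_commute[of x "y - w"] cinner_commute[of x y] cinner_commute[of x w]
  by (simp add: cinner_diff_left)

lemma cinner_cscale_right: "cinner x (c *\<^sub>C w) = cnj c * cinner x w"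
  using cinner_commute[of x "c *\<^sub>C w"] cinner_commute[of x w] by (simp add: cinner_cscale_left)

lemma cinner_basis_vec: "cinner x (basis_vec k) = coeff x k"
proof -
  have "(\<lambda>j. coeff x j * cnj (coeff (basis_vec k) j)) sums
      (\<Sum>j\<in>{k}. coeff x j * cnj (coeff (basis_vec k) j))"
    by (rule sums_finite) auto
  then show ?thesis using cinner_sums[of x "basis_vec k"] sums_unique2 by fastforce
qed

text \<open>The coordinates of a Cauchy sequence converge; the Cauchy estimates for finite partial sums
  pass to the limit and show both that the limit is square-summable and that it is approached in
  norm.\<close>

lemma complete_ell2: "complete (UNIV :: ell2 set)"
  unfolding complete_def
proof (intro allI impI)
  fix X :: "nat \<Rightarrow> ell2"
  assume "(\<forall>n. X n \<in> UNIV) \<and> Cauchy X"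
  then have X: "Cauchy X" by simp
  have "Cauchy (\<lambda>n. coeff (X n) k)" for k
    unfolding Cauchy_def
  proof (intro allI impI)
    fix e :: real assume "e > 0"
    with X obtain M where M: "\<And>m n. m \<ge> M \<Longrightarrow> n \<ge> M \<Longrightarrow> dist (X m) (X n) < e"
      unfolding Cauchy_def by blast
    have "dist (coeff (X m) k) (coeff (X n) k) \<le> dist (X m) (X n)" for m n
      using cmod_coeff_le[of "X m - X n" k] by (simp add: dist_norm)
    with M show "\<exists>M. \<forall>m\<ge>M. \<forall>n\<ge>M. dist (coeff (X m) k) (coeff (X n) k) < e"
      using le_less_trans by blast
  qed
  then have "\<exists>l. (\<lambda>n. coeff (X n) k) \<longlonglongrightarrow> l" for k
    by (simp add: Cauchy_convergent_iff convergent_def)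
  then obtain y where y: "\<And>k. (\<lambda>n. coeff (X n) k) \<longlonglongrightarrow> y k" by metis
  have near: "(\<Sum>k<K. (cmod (coeff (X m) k - y k))\<^sup>2) \<le> e\<^sup>2"
    if "\<And>n. n \<ge> M \<Longrightarrow> dist (X m) (X n) < e" for m M e K
  proof (rule tendsto_upperbound)
    show "(\<lambda>n. \<Sum>k<K. (cmod (coeff (X m - X n) k))\<^sup>2) \<longlonglongrightarrow> (\<Sum>k<K. (cmod (coeff (X m) k - y k))\<^sup>2)"
      unfolding coeff_simps by (intro tendsto_intros y)
    show "\<forall>\<^sub>F n in sequentially. (\<Sum>k<K. (cmod (coeff (X m - X n) k))\<^sup>2) \<le> e\<^sup>2"
      unfolding eventually_sequentially
    proof (intro exI allI impI)
      fix n assume "n \<ge> M"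
      with that have "norm (X m - X n) \<le> e" by (metis dist_norm less_imp_le)
      then show "(\<Sum>k<K. (cmod (coeff (X m - X n) k))\<^sup>2) \<le> e\<^sup>2"
        using sum_coeff_le[of "X m - X n" K] power_mono[of "norm (X m - X n)" e 2] by simp
    qed
  qed simp
  obtain M1 where M1: "\<And>m n. m \<ge> M1 \<Longrightarrow> n \<ge> M1 \<Longrightarrow> dist (X m) (X n) < 1"
    using X unfolding Cauchy_def by (meson zero_less_one)
  have "summable (\<lambda>k. (cmod (coeff (X M1) k - y k))\<^sup>2)"
    by (rule summableI_nonneg_bounded[where x = "1\<^sup>2"]) (use near[of M1 M1 1] M1 in auto)
  from summable_ell2_add[OF this summable_coeff[of "- X M1"]]
  have "summable (\<lambda>k. (cmod (- y k))\<^sup>2)" by simp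
  then have y_coeff: "coeff (Abs_ell2 y) = y" by (simp add: Abs_ell2_inverse)
  have "X \<longlonglongrightarrow> Abs_ell2 y"
  proof (rule LIMSEQ_I)
    fix r :: real assume r: "r > 0"
    then obtain M where M: "\<And>m n. m \<ge> M \<Longrightarrow> n \<ge> M \<Longrightarrow> dist (X m) (X n) < r / 2"
      using X unfolding Cauchy_def by (meson half_gt_zero)
    have "norm (X m - Abs_ell2 y) \<le> r / 2" if "m \<ge> M" for m
      using near[of M m "r / 2"] M[OF that] r by (intro norm_ell2_le) (auto simp: y_coeff)
    then show "\<exists>no. \<forall>n\<ge>no. norm (X n - Abs_ell2 y) < r" using r by (intro exI[of _ M]) fastforce
  qed
  then show "\<exists>l\<in>UNIV. X \<longlonglongrightarrow> l" by blast
qed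

section \<open>Approximate eigenvalues on the circle\<close>

lemma cis_power_root_of_unity:
  assumes "m > 0" shows "(cis (2 * pi / real m) ^ j) ^ m = 1"
proof -
  have "(cis (2 * pi / real m) ^ j) ^ m = cis (2 * pi * real j)"
    using assms by (simp add: Complex.DeMoivre mult.commute)
  then show ?thesis by (simp only: cis_multiple_2pi Ints_of_nat)
qed

text \<open>Parseval's identity for the discrete Fourier transform: after expanding the squares, the sums
  over \<open>l\<close> are geometric and vanish off the diagonal.\<close>

lemma Parseval_roots_of_unity:
  fixes b :: "nat \<Rightarrow> complex"
  assumes m: "m > 0"
  defines "\<omega> \<equiv> cis (2 * pi / real m)"
  shows "(\<Sum>l<m. (cmod (\<Sum>j<m. (\<omega> ^ l) ^ j * b j))\<^sup>2) = real m * (\<Sum>j<m. (cmod (b j))\<^sup>2)"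
proof -
  have pow: "\<omega> ^ j = cis (2 * pi * real j / real m)" for j
    unfolding \<omega>_def Complex.DeMoivre by (simp add: mult.commute)
  have root: "(\<omega> ^ j) ^ m = 1" for j
    unfolding \<omega>_def by (rule cis_power_root_of_unity[OF m])
  have orth: "(\<Sum>l<m. (\<omega> ^ l) ^ j * cnj ((\<omega> ^ l) ^ i)) = (if i = j then of_nat m else 0)"
    if "j < m" "i < m" for i j
  proof -
    define \<rho> where "\<rho> = \<omega> ^ j * cnj (\<omega> ^ i)"
    have cancel: "\<omega> ^ i * cnj (\<omega> ^ i) = 1" by (simp add: pow cis_cnj cis_mult)
    have eq: "(\<omega> ^ l) ^ j * cnj ((\<omega> ^ l) ^ i) = \<rho> ^ l" for l
      by (simp add: \<rho>_def power_mult_distrib power_mult[symmetric] mult.commute)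
    have "\<rho> ^ m = (\<omega> ^ j) ^ m * cnj ((\<omega> ^ i) ^ m)" by (simp add: \<rho>_def power_mult_distrib)
    then have "\<rho> ^ m = 1" by (simp add: root)
    show ?thesis
    proof (cases "i = j")
      case True
      then have "\<rho> = 1" using cancel by (simp add: \<rho>_def)
      then show ?thesis unfolding eq using True by simp
    next
      case False
      have "\<rho> \<noteq> 1"
      proof
        assume "\<rho> = 1"
        then have "\<omega> ^ j = \<omega> ^ i" using cancel unfolding \<rho>_def
          by (metis mult.assoc mult.commute mult_1_right)
        then show False
          using Complex.bij_betw_roots_unity[OF m] that False unfolding pow bij_betw_def inj_on_def by blast
      qed
      then show ?thesis unfolding eq using False \<open>\<rho> ^ m = 1\<close> by (simp add: sum_gp_strict)
    qed
  qed
  have "complex_of_real (\<Sum>l<m. (cmod (\<Sum>j<m. (\<omega> ^ l) ^ j * b j))\<^sup>2) =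
      (\<Sum>l<m. (\<Sum>j<m. (\<omega> ^ l) ^ j * b j) * cnj (\<Sum>i<m. (\<omega> ^ l) ^ i * b i))"
    by (simp only: of_real_sum complex_norm_square)
  also have "\<dots> = (\<Sum>l<m. \<Sum>j<m. \<Sum>i<m. ((\<omega> ^ l) ^ j * cnj ((\<omega> ^ l) ^ i)) * (b j * cnj (b i)))"
    by (simp add: sum_product cnj_sum algebra_simps)
  also have "\<dots> = (\<Sum>j<m. \<Sum>l<m. \<Sum>i<m. ((\<omega> ^ l) ^ j * cnj ((\<omega> ^ l) ^ i)) * (b j * cnj (b i)))"
    by (rule sum.swap)
  also have "\<dots> = (\<Sum>j<m. \<Sum>i<m. (\<Sum>l<m. (\<omega> ^ l) ^ j * cnj ((\<omega> ^ l) ^ i)) * (b j * cnj (b i)))"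
    unfolding sum_distrib_right by (intro sum.cong refl sum.swap)
  also have "\<dots> = (\<Sum>j<m. \<Sum>i<m. if i = j then of_nat m * (b j * cnj (b j)) else 0)"
    by (intro sum.cong refl) (simp add: orth del: complex_cnj_power)
  also have "\<dots> = of_real (real m * (\<Sum>j<m. (cmod (b j))\<^sup>2))"
    by (simp add: complex_norm_square[symmetric] sum_distrib_left)
  finally show ?thesis unfolding of_real_eq_iff .
qed

lemma Parseval_roots_of_unity_ell2:
  fixes b :: "nat \<Rightarrow> ell2"
  assumes m: "m > 0"
  defines "\<omega> \<equiv> cis (2 * pi / real m)"
  shows "(\<Sum>l<m. (norm (\<Sum>j<m. (\<omega> ^ l) ^ j *\<^sub>C b j))\<^sup>2) = real m * (\<Sum>j<m. (norm (b j))\<^sup>2)"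
proof -
  have "(\<lambda>k. \<Sum>l<m. (cmod (coeff (\<Sum>j<m. (\<omega> ^ l) ^ j *\<^sub>C b j) k))\<^sup>2) sums
      (\<Sum>l<m. (norm (\<Sum>j<m. (\<omega> ^ l) ^ j *\<^sub>C b j))\<^sup>2)"
    by (intro sums_sum norm_sq_sums)
  moreover have "(\<lambda>k. real m * (\<Sum>j<m. (cmod (coeff (b j) k))\<^sup>2)) sums (real m * (\<Sum>j<m. (norm (b j))\<^sup>2))"
    by (intro sums_mult sums_sum norm_sq_sums)
  ultimately show ?thesis
    using Parseval_roots_of_unity[OF m, folded \<omega>_def]
    by (simp add: coeff_sum sums_unique2)
qed

text \<open>Suppose that \<open>\<parallel>A x - \<mu> x\<parallel> > \<delta> \<parallel>x\<parallel>\<close> for all \<open>x \<noteq> 0\<close> on the whole circle. For an \<open>m\<close>-th root of unity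
  \<open>\<mu>\<close> and \<open>w = \<Sum>\<^sub>j \<mu>\<^sup>j A\<^sup>m\<^sup>-\<^sup>1\<^sup>-\<^sup>j v\<close>, the vector \<open>A w - \<mu> w = A\<^sup>m v - v\<close> has norm at most \<open>2 \<parallel>v\<parallel>\<close>, so
  that \<open>\<parallel>w\<parallel> \<le> 2 \<parallel>v\<parallel> / \<delta>\<close>. But by Parseval the mean of \<open>\<parallel>w\<parallel>\<^sup>2\<close> over all \<open>\<mu>\<close> is the sum of the
  \<open>\<parallel>A\<^sup>j v\<parallel>\<^sup>2\<close> with \<open>j < m\<close>, which is at least \<open>m \<parallel>v\<parallel>\<^sup>2 / 2\<close> for suitable \<open>v\<close>.\<close>

lemma approximate_eigenvalue:
  fixes A :: "ell2 \<Rightarrow> ell2"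
  assumes add: "\<And>x y. A (x + y) = A x + A y" and scale: "\<And>c x. A (c *\<^sub>C x) = c *\<^sub>C A x"
    and contr: "\<And>x. norm (A x) \<le> norm x"
    and sharp: "\<And>\<eta>. \<eta> < 1 \<Longrightarrow> \<exists>x. norm (A x) > \<eta> * norm x"
    and para: "\<And>x. (norm (A x))\<^sup>2 \<le> norm x * norm (A (A x))"
    and \<delta>: "\<delta> > 0"
  shows "\<exists>\<mu> x. cmod \<mu> = 1 \<and> x \<noteq> 0 \<and> norm (A x - \<mu> *\<^sub>C x) \<le> \<delta> * norm x"
proof (rule ccontr)
  assume "\<not> ?thesis"
  then have below: "\<delta> * norm x \<le> norm (A x - \<mu> *\<^sub>C x)" if "cmod \<mu> = 1" for \<mu> x
    using that by (cases "x = 0") (auto simp: not_le intro: less_imp_le)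
  \<comment> \<open>The two estimates contradict each other as soon as \<open>m / 2 > 4 / \<delta>\<^sup>2\<close>.\<close>
  define m where "m = nat \<lceil>8 / \<delta>\<^sup>2\<rceil> + 1"
  have m: "m > 0" "8 / \<delta>\<^sup>2 < real m" unfolding m_def by linarith+
  \<comment> \<open>A vector stretched by \<open>\<eta>\<close> keeps half of its squared norm through \<open>m\<close> applications.\<close>
  define \<eta> where "\<eta> = root (2 * m) (1 / 2)"
  have \<eta>: "0 < \<eta>" "\<eta> < 1" "\<eta> ^ (2 * m) = 1 / 2"
    using m by (simp_all add: \<eta>_def real_root_pow_pos2)
  obtain v where v: "norm (A v) > \<eta> * norm v" using sharp[OF \<eta>(2)] by blast
  have A0: "A 0 = 0" using scale[of 0 0] by simp
  have v0: "v \<noteq> 0" using v A0 by auto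
  define a where "a j = (A ^^ j) v" for j
  have a_Suc: "a (Suc j) = A (a j)" for j by (simp add: a_def)
  \<comment> \<open>By the hypothesis \<open>para\<close>, the successive stretching factors do not decrease.\<close>
  have grow: "\<eta> * norm (a j) \<le> norm (a (Suc j))" for j
  proof (induction j)
    case 0
    then show ?case using v by (simp add: a_def)
  next
    case (Suc j)
    show ?case
    proof (cases "norm (a j) = 0")
      case True
      then show ?thesis by (simp add: a_Suc A0)
    next
      case False
      have "(\<eta> * norm (a (Suc j))) * norm (a j) \<le> (norm (a (Suc j)))\<^sup>2"
        using mult_right_mono[OF Suc, of "norm (a (Suc j))"] by (simp add: power2_eq_square algebra_simps)
      also have "\<dots> \<le> norm (a (Suc (Suc j))) * norm (a j)"
        using para[of "a j"] by (simp add: a_Suc mult.commute)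
      finally show ?thesis using False by (simp add: mult_le_cancel_right)
    qed
  qed
  have a_lower: "\<eta> ^ j * norm v \<le> norm (a j)" for j
  proof (induction j)
    case (Suc j)
    then have "\<eta> * (\<eta> ^ j * norm v) \<le> \<eta> * norm (a j)" using \<eta>(1) by simp
    then show ?case using grow[of j] by simp
  qed (simp add: a_def)
  have a_upper: "norm (a j) \<le> norm v" for j
  proof (induction j)
    case (Suc j)
    then show ?case using contr[of "a j"] by (simp add: a_Suc)
  qed (simp add: a_def)
  define \<omega> where "\<omega> = cis (2 * pi / real m)"
  define b where "b j = a (m - 1 - j)" for j
  define w where "w l = (\<Sum>j<m. (\<omega> ^ l) ^ j *\<^sub>C b j)" for l
  have A_sum: "A (\<Sum>j<k. c j *\<^sub>C y j) = (\<Sum>j<k. c j *\<^sub>C A (y j))" for k :: nat and c y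
    by (induction k) (simp_all add: A0 add scale)
  \<comment> \<open>The sum telescopes under \<open>A - \<mu>\<close>.\<close>
  have tele: "A (\<Sum>j<k. \<mu> ^ j *\<^sub>C a (k - 1 - j)) - \<mu> *\<^sub>C (\<Sum>j<k. \<mu> ^ j *\<^sub>C a (k - 1 - j)) =
      a k - \<mu> ^ k *\<^sub>C v" for k \<mu>
  proof -
    have "A (\<Sum>j<k. \<mu> ^ j *\<^sub>C a (k - 1 - j)) = (\<Sum>j<k. \<mu> ^ j *\<^sub>C a (k - j))"
      unfolding A_sum by (intro sum.cong refl) (simp add: a_Suc[symmetric] Suc_diff_Suc)
    moreover have "\<mu> *\<^sub>C (\<Sum>j<k. \<mu> ^ j *\<^sub>C a (k - 1 - j)) = (\<Sum>j<k. \<mu> ^ Suc j *\<^sub>C a (k - Suc j))"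
      by (simp add: cvec.scale_sum_right)
    moreover have "(\<Sum>j<k. \<mu> ^ j *\<^sub>C a (k - j)) - (\<Sum>j<k. \<mu> ^ Suc j *\<^sub>C a (k - Suc j)) =
        \<mu> ^ 0 *\<^sub>C a (k - 0) - \<mu> ^ k *\<^sub>C a (k - k)"
      unfolding sum_subtractf[symmetric]
      by (rule sum_lessThan_telescope'[where f = "\<lambda>j. \<mu> ^ j *\<^sub>C a (k - j)"])
    ultimately show ?thesis by (simp add: a_def)
  qed
  have w_upper: "\<delta> * norm (w l) \<le> 2 * norm v" if "l < m" for l
  proof -
    have "(\<omega> ^ l) ^ m = 1"
      unfolding \<omega>_def by (rule cis_power_root_of_unity[OF m(1)])
    then have "A (w l) - (\<omega> ^ l) *\<^sub>C w l = a m - v"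
      using tele[where k = m and \<mu> = "\<omega> ^ l"] by (simp add: w_def b_def)
    moreover have "cmod (\<omega> ^ l) = 1" by (simp add: \<omega>_def norm_power)
    ultimately have "\<delta> * norm (w l) \<le> norm (a m - v)" using below by metis
    also have "\<dots> \<le> 2 * norm v" using norm_triangle_ineq4[of "a m" v] a_upper[of m] by simp
    finally show ?thesis .
  qed
  have "real m * (real m * ((norm v)\<^sup>2 / 2)) \<le> real m * (\<Sum>j<m. (norm (b j))\<^sup>2)"
  proof (intro mult_left_mono)
    have "(norm v)\<^sup>2 / 2 \<le> (norm (b j))\<^sup>2" for j
    proof -
      have "(norm v)\<^sup>2 / 2 = (\<eta> ^ m * norm v)\<^sup>2"
        using \<eta>(3) by (simp add: power_mult_distrib power_mult[symmetric] mult.commute)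
      also have "\<dots> \<le> (\<eta> ^ (m - 1 - j) * norm v)\<^sup>2"
        using \<eta> by (intro power_mono mult_right_mono power_decreasing) auto
      also have "\<dots> \<le> (norm (b j))\<^sup>2"
        using a_lower[of "m - 1 - j"] \<eta>(1) by (intro power_mono) (auto simp: b_def)
      finally show ?thesis .
    qed
    then show "real m * ((norm v)\<^sup>2 / 2) \<le> (\<Sum>j<m. (norm (b j))\<^sup>2)"
      using sum_mono[of "{..<m}" "\<lambda>_. (norm v)\<^sup>2 / 2" "\<lambda>j. (norm (b j))\<^sup>2"] by simp
  qed simp
  also have "\<dots> = (\<Sum>l<m. (norm (w l))\<^sup>2)"
    unfolding w_def using Parseval_roots_of_unity_ell2[OF m(1), of b, folded \<omega>_def] by simp
  also have "\<dots> \<le> (\<Sum>l<m. 4 * (norm v)\<^sup>2 / \<delta>\<^sup>2)"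
  proof (intro sum_mono)
    fix l assume "l \<in> {..<m}"
    then have "norm (w l) \<le> 2 * norm v / \<delta>"
      using w_upper \<delta> by (simp add: pos_le_divide_eq mult.commute)
    then show "(norm (w l))\<^sup>2 \<le> 4 * (norm v)\<^sup>2 / \<delta>\<^sup>2"
      using power_mono[of "norm (w l)" "2 * norm v / \<delta>" 2] by (simp add: power_divide power_mult_distrib)
  qed
  also have "\<dots> = real m * (4 * (norm v)\<^sup>2 / \<delta>\<^sup>2)" by simp
  finally have "real m * ((norm v)\<^sup>2 / 2) \<le> 4 * (norm v)\<^sup>2 / \<delta>\<^sup>2"
    by (rule mult_left_le_imp_le) (use m(1) in simp)
  then have "real m \<le> 8 / \<delta>\<^sup>2" using v0 \<delta> by (simp add: field_simps)
  with m(2) show False by simp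
qed

section \<open>Resolvents of normal operators\<close>

lemma linear_operatorD:
  assumes "linear_operator T"
  shows "(x, y) \<in> T \<Longrightarrow> (x, y') \<in> T \<Longrightarrow> y = y'"
    and "(0, 0) \<in> T"
    and "(x, y) \<in> T \<Longrightarrow> (x', y') \<in> T \<Longrightarrow> (x + x', y + y') \<in> T"
    and "(x, y) \<in> T \<Longrightarrow> (c *\<^sub>C x, c *\<^sub>C y) \<in> T"
  using assms unfolding linear_operator_def single_valued_def by blast+

lemma app_eqI: "linear_operator T \<Longrightarrow> (x, y) \<in> T \<Longrightarrow> app T x = y"
  unfolding app_def using linear_operatorD(1) by blast

lemma app_in: "linear_operator T \<Longrightarrow> x \<in> Domain T \<Longrightarrow> (x, app T x) \<in> T"
  using app_eqI by blast

lemma mem_shift_iff: "(x, v) \<in> shift T z \<longleftrightarrow> (x, v + z *\<^sub>C x) \<in> T"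
  unfolding shift_def by (auto simp: eq_diff_eq[symmetric] intro: exI[of _ "v + z *\<^sub>C x"])

lemma mem_shift_shift_iff: "(x, v) \<in> shift T w \<longleftrightarrow> (x, v + (w - z) *\<^sub>C x) \<in> shift T z"
  unfolding mem_shift_iff by (simp add: cvec.scale_left_diff_distrib)

lemma Domain_shift: "Domain (shift T z) = Domain T"
  unfolding shift_def by auto

lemma linear_operator_shift:
  assumes "linear_operator T" shows "linear_operator (shift T z)"
  unfolding linear_operator_def
proof (intro conjI)
  note T = linear_operatorD[OF assms]
  show "single_valued (shift T z)"
    unfolding single_valued_def mem_shift_iff using T(1) by (metis add_right_cancel)
  show "(0, 0) \<in> shift T z" using T(2) by (simp add: mem_shift_iff)
  show "\<forall>(x, y)\<in>shift T z. \<forall>(x', y')\<in>shift T z. (x + x', y + y') \<in> shift T z"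
  proof clarify
    fix x y x' y' assume "(x, y) \<in> shift T z" "(x', y') \<in> shift T z"
    then have "(x + x', (y + z *\<^sub>C x) + (y' + z *\<^sub>C x')) \<in> T"
      unfolding mem_shift_iff by (rule T(3))
    then show "(x + x', y + y') \<in> shift T z"
      unfolding mem_shift_iff by (simp add: cvec.scale_right_distrib algebra_simps)
  qed
  show "\<forall>c. \<forall>(x, y)\<in>shift T z. (c *\<^sub>C x, c *\<^sub>C y) \<in> shift T z"
  proof clarify
    fix c x y assume "(x, y) \<in> shift T z"
    then have "(c *\<^sub>C x, c *\<^sub>C (y + z *\<^sub>C x)) \<in> T" unfolding mem_shift_iff by (rule T(4))
    then show "(c *\<^sub>C x, c *\<^sub>C y) \<in> shift T z"
      unfolding mem_shift_iff by (simp add: cvec.scale_right_distrib mult.commute)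
  qed
qed

lemma Omega_N_linear: "T \<in> Omega_N \<Longrightarrow> linear_operator T"
  by (simp add: Omega_N_def C_ell2_def)

lemma adjoint_unique:
  assumes dense: "closure (Domain T) = UNIV" and "(y, w) \<in> adjoint T" "(y, w') \<in> adjoint T"
  shows "w = w'"
proof -
  have eq: "cinner x w = cinner x w'" if "x \<in> Domain T" for x
    using that assms(2,3) unfolding adjoint_def by fastforce
  have "Domain T \<subseteq> {x. inner x (w - w') = 0}"
  proof
    fix x assume "x \<in> Domain T"
    from eq[OF this] show "x \<in> {x. inner x (w - w') = 0}"
      by (simp add: inner_ell2_def cinner_diff_right)
  qed
  moreover have "closed {x. inner x (w - w') = 0}" by (intro closed_Collect_eq continuous_intros)
  ultimately have "inner (w - w') (w - w') = 0" using closure_minimal dense by blast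
  then show ?thesis by simp
qed

text \<open>The form in which normality enters. With \<open>B = T - z\<close>, one has \<open>\<parallel>B\<^sup>* v\<parallel> = \<parallel>B v\<parallel>\<close>, and therefore
  \<open>\<parallel>B u\<parallel>\<^sup>2 = \<langle>u, B\<^sup>* B u\<rangle> \<le> \<parallel>u\<parallel> \<parallel>B\<^sup>2 u\<parallel>\<close>. This avoids the adjoint of the resolvent.\<close>

lemma normal_paranormal:
  assumes T: "T \<in> Omega_N" and "(u, v) \<in> shift T z" "(v, w) \<in> shift T z"
  shows "(norm v)\<^sup>2 \<le> norm u * norm w"
proof -
  note lin = Omega_N_linear[OF T]
  define a where "a = v + z *\<^sub>C u"
  define b where "b = w + z *\<^sub>C v"
  have a: "(u, a) \<in> T" and b: "(v, b) \<in> T" using assms(2,3) by (simp_all add: a_def b_def mem_shift_iff)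
  have dense: "closure (Domain T) = UNIV" and dom: "Domain T = Domain (adjoint T)"
    and iso: "\<And>x. x \<in> Domain T \<Longrightarrow> norm (app T x) = norm (app (adjoint T) x)"
    using T unfolding Omega_N_def C_ell2_def by blast+
  have v: "v \<in> Domain T" using b by blast
  then obtain b' where b': "(v, b') \<in> adjoint T" using dom by blast
  have "app (adjoint T) v = b'"
    unfolding app_def using b' adjoint_unique[OF dense] by blast
  with iso[OF v] have nb: "norm b = norm b'" by (simp add: app_eqI[OF lin b])
  have adj: "cinner y v = cinner x b'" if "(x, y) \<in> T" for x y
    using b' that unfolding adjoint_def by blast
  define c where "c = b' - cnj z *\<^sub>C v"
  have sq: "(norm (p - q *\<^sub>C v))\<^sup>2 = (norm p)\<^sup>2 - 2 * Re (cnj q * cinner p v) + (cmod q * norm v)\<^sup>2" for p q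
    using dot_norm_neg[of p "q *\<^sub>C v"]
    by (simp add: inner_ell2_def cinner_cscale_right norm_cscale field_simps)
  have "(norm w)\<^sup>2 = (norm b)\<^sup>2 - 2 * Re (cnj z * cinner b v) + (cmod z * norm v)\<^sup>2"
    using sq[of b z] by (simp add: b_def)
  moreover have "Re (cnj z * cinner b v) = Re (z * cinner b' v)"
    using adj[OF b] cinner_commute[of v b'] by simp
  moreover have "(norm c)\<^sup>2 = (norm b')\<^sup>2 - 2 * Re (z * cinner b' v) + (cmod z * norm v)\<^sup>2"
    using sq[of b' "cnj z"] by (simp add: c_def)
  ultimately have "(norm w)\<^sup>2 = (norm c)\<^sup>2" by (simp only: nb)
  then have "norm w = norm c" by (simp add: power2_eq_iff_nonneg)
  have "cinner v v = cinner u c"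
    using adj[OF a] by (simp add: a_def c_def cinner_diff_right cinner_cscale_right)
      (metis (no_types, lifting) a_def add_diff_cancel_right' cinner_cscale_left cinner_diff_left)
  then have "inner v v = inner u c" by (simp add: inner_ell2_def)
  then have "(norm v)\<^sup>2 \<le> norm u * norm c"
    using Cauchy_Schwarz_ineq2[of u c] by (simp add: power2_norm_eq_inner)
  with \<open>norm w = norm c\<close> show ?thesis by simp
qed

definition is_resolvent :: "operator \<Rightarrow> complex \<Rightarrow> (ell2 \<Rightarrow> ell2) \<Rightarrow> bool" where
  "is_resolvent T z R \<longleftrightarrow> bounded_linear R \<and> (\<forall>u v. (u, v) \<in> shift T z \<longleftrightarrow> u = R v)"

lemma not_in_spectrum_iff: "z \<notin> spectrum T \<longleftrightarrow> (\<exists>R. is_resolvent T z R)"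
proof -
  have "(shift T z)\<inverse> = {(y, R y) | y. True} \<longleftrightarrow> (\<forall>u v. (u, v) \<in> shift T z \<longleftrightarrow> u = R v)" for R
    unfolding set_eq_iff by auto
  then show ?thesis unfolding spectrum_def is_resolvent_def by simp
qed

lemma is_resolventD:
  assumes "is_resolvent T z R"
  shows "bounded_linear R" "(R v, v) \<in> shift T z" "(u, v) \<in> shift T z \<Longrightarrow> u = R v"
  using assms unfolding is_resolvent_def by blast+

lemma resolvent_eq: "is_resolvent T z R \<Longrightarrow> resolvent z T x = R x"
  unfolding resolvent_def app_def is_resolvent_def by simp

lemma resolvent_cscale:
  assumes "linear_operator T" "is_resolvent T z R" shows "R (c *\<^sub>C x) = c *\<^sub>C R x"
  using linear_operatorD(4)[OF linear_operator_shift[OF assms(1)] is_resolventD(2)[OF assms(2)]]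
    is_resolventD(3)[OF assms(2)] by metis

lemma resolvent_onorm_pos:
  assumes "linear_operator T" "is_resolvent T z R" shows "onorm R > 0"
proof -
  have "R (basis_vec 0) \<noteq> 0"
  proof
    assume "R (basis_vec 0) = 0"
    then have "(0, basis_vec 0) \<in> shift T z" using is_resolventD(2)[OF assms(2)] by metis
    then have "basis_vec 0 = 0"
      using linear_operatorD(1,2)[OF linear_operator_shift[OF assms(1)]] by metis
    then have "coeff (basis_vec 0) 0 = 0" by simp
    then show False by simp
  qed
  then show ?thesis using onorm_pos_lt[OF is_resolventD(1)[OF assms(2)]] by blast
qed

text \<open>The Neumann series in the form of Banach's fixed point theorem: \<open>(T - w) u = y\<close> means
  \<open>u = R (y + (w - z) u)\<close>, and the right-hand side is a contraction in \<open>u\<close>.\<close>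

lemma resolvent_below_spectrum:
  assumes lin: "linear_operator T" and R: "is_resolvent T z R" and near: "cmod (w - z) * onorm R < 1"
  shows "w \<notin> spectrum T"
proof -
  note bl = is_resolventD(1)[OF R]
  interpret R: bounded_linear R by (rule bl)
  define r where "r = onorm R"
  define q where "q = w - z"
  define k where "k = cmod q * r"
  have r: "r > 0" and Rr: "norm (R x) \<le> r * norm x" for x
    using resolvent_onorm_pos[OF lin R] onorm[OF bl] by (simp_all add: r_def)
  have k: "0 \<le> k" "k < 1" using near r by (simp_all add: k_def q_def r_def)
  have mem: "(u, y) \<in> shift T w \<longleftrightarrow> R (y + q *\<^sub>C u) = u" for u y
    using R unfolding mem_shift_shift_iff[of u y T w z] is_resolvent_def q_def by auto
  have ex: "\<exists>!u. R (y + q *\<^sub>C u) = u" for y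
  proof -
    have "dist (R (y + q *\<^sub>C u)) (R (y + q *\<^sub>C u')) \<le> k * dist u u'" for u u'
      using Rr[of "q *\<^sub>C (u - u')"]
      by (simp add: dist_norm R.diff[symmetric] cvec.scale_right_diff_distrib[symmetric] norm_cscale
          k_def mult_ac)
    then show ?thesis
      using Banach_fix[OF complete_ell2 UNIV_not_empty k, of "\<lambda>u. R (y + q *\<^sub>C u)"] by auto
  qed
  define S where "S y = (THE u. R (y + q *\<^sub>C u) = u)" for y
  have S: "R (y + q *\<^sub>C S y) = S y" for y unfolding S_def by (rule theI'[OF ex])
  have S_eq: "R (y + q *\<^sub>C u) = u \<longleftrightarrow> u = S y" for u y using ex S by metis
  have "is_resolvent T w S"
    unfolding is_resolvent_def
  proof (intro conjI allI)
    show "bounded_linear S"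
    proof (rule bounded_linear_intro[where K = "r / (1 - k)"])
      fix x y
      have "R ((x + y) + q *\<^sub>C (S x + S y)) = R ((x + q *\<^sub>C S x) + (y + q *\<^sub>C S y))"
        by (simp add: cvec.scale_right_distrib algebra_simps)
      also have "\<dots> = S x + S y" by (subst R.add) (simp only: S)
      finally show "S (x + y) = S x + S y" using S_eq by metis
    next
      fix c x
      have "R (c *\<^sub>R x + q *\<^sub>C (c *\<^sub>R S x)) = R (c *\<^sub>R (x + q *\<^sub>C S x))"
        by (simp add: scaleR_cscale cvec.scale_right_distrib mult.commute)
      also have "\<dots> = c *\<^sub>R S x" by (simp only: R.scaleR S)
      finally show "S (c *\<^sub>R x) = c *\<^sub>R S x" using S_eq by metis
    next
      fix x
      have "norm (S x) \<le> r * norm (x + q *\<^sub>C S x)" using Rr[of "x + q *\<^sub>C S x"] by (simp only: S)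
      also have "\<dots> \<le> r * (norm x + cmod q * norm (S x))"
        using r norm_triangle_ineq[of x "q *\<^sub>C S x"] by (simp add: norm_cscale)
      finally have "(1 - k) * norm (S x) \<le> r * norm x" by (simp add: k_def algebra_simps)
      then show "norm (S x) \<le> norm x * (r / (1 - k))" using k by (simp add: field_simps)
    qed
    show "(u, v) \<in> shift T w \<longleftrightarrow> u = S v" for u v using mem S_eq by simp
  qed
  then show ?thesis using not_in_spectrum_iff by blast
qed

text \<open>After scaling, the preceding section provides approximate eigenvalues of \<open>R\<close> on the circle of radius
  \<open>r = \<parallel>R\<parallel>\<close>, and by compactness one \<open>r \<mu>\<close> that works for all accuracies. If \<open>R v\<close> is close to \<open>r \<mu> v\<close>,
  then \<open>T - w\<close> with \<open>w = z + 1 / (r \<mu>)\<close> maps \<open>R v\<close>, which is not small, to a small vector; so \<open>w\<close> lies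
  in the spectrum. In particular the spectrum is not empty.\<close>

lemma spectrum_on_circle:
  assumes T: "T \<in> Omega_N" and R: "is_resolvent T z R"
  shows "\<exists>w\<in>spectrum T. dist z w = 1 / onorm R"
proof -
  note lin = Omega_N_linear[OF T] and bl = is_resolventD(1)[OF R]
  interpret R: bounded_linear R by (rule bl)
  define r where "r = onorm R"
  have r: "r > 0" and Rr: "norm (R x) \<le> r * norm x" for x
    using resolvent_onorm_pos[OF lin R] onorm[OF bl] by (simp_all add: r_def)
  define A where "A x = of_real (1 / r) *\<^sub>C R x" for x
  have nA: "norm (A x) = norm (R x) / r" for x using r by (simp add: A_def norm_cscale norm_divide)
  have "\<exists>\<mu> x. cmod \<mu> = 1 \<and> x \<noteq> 0 \<and> norm (A x - \<mu> *\<^sub>C x) \<le> \<delta> * norm x" if "\<delta> > 0" for \<delta>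
  proof (rule approximate_eigenvalue[OF _ _ _ _ _ that])
    show "A (x + y) = A x + A y" for x y by (simp add: A_def R.add cvec.scale_right_distrib)
    show "A (c *\<^sub>C x) = c *\<^sub>C A x" for c x
      by (simp add: A_def resolvent_cscale[OF lin R] mult.commute)
    show "norm (A x) \<le> norm x" for x using Rr[of x] r by (simp add: nA field_simps)
    show "\<exists>x. norm (A x) > \<eta> * norm x" if "\<eta> < 1" for \<eta>
    proof (rule ccontr)
      assume "\<nexists>x. norm (A x) > \<eta> * norm x"
      then have le: "norm (R x) \<le> (\<eta> * r) * norm x" for x
        using r by (simp add: nA not_less field_simps)
      have "0 \<le> \<eta>"
      proof -
        have "0 \<le> (\<eta> * r) * norm (basis_vec 0)" using le norm_ge_zero order_trans by blast
        moreover have "1 \<le> norm (basis_vec 0)"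
          using cmod_coeff_le[of "basis_vec 0" 0] by simp
        then have "norm (basis_vec 0) > 0" by linarith
        ultimately show ?thesis using r by (simp add: zero_le_mult_iff)
      qed
      with le have "r \<le> \<eta> * r" unfolding r_def by (intro onorm_bound) (use r in \<open>auto simp: r_def\<close>)
      then show False using that r by simp
    qed
    show "(norm (A x))\<^sup>2 \<le> norm x * norm (A (A x))" for x
    proof -
      have "(norm (R x))\<^sup>2 \<le> norm (R (R x)) * norm x"
        by (rule normal_paranormal[OF T is_resolventD(2)[OF R] is_resolventD(2)[OF R]])
      moreover have "norm (A (A x)) = norm (R (R x)) / r\<^sup>2"
        using r unfolding A_def resolvent_cscale[OF lin R]
        by (simp add: norm_cscale norm_divide norm_mult power2_eq_square)
      ultimately show ?thesis using r by (simp add: nA power_divide divide_right_mono mult.commute)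
    qed
  qed
  then have "\<forall>k. \<exists>\<mu> x. cmod \<mu> = 1 \<and> x \<noteq> 0 \<and> norm (A x - \<mu> *\<^sub>C x) \<le> inverse (real (Suc k)) * norm x"
    by simp
  then obtain m x where mx: "\<And>k. cmod (m k) = 1" "\<And>k. x k \<noteq> 0"
    "\<And>k. norm (A (x k) - m k *\<^sub>C x k) \<le> inverse (real (Suc k)) * norm (x k)" by metis
  have "seq_compact (sphere (0::complex) 1)" by (intro compact_imp_seq_compact compact_sphere)
  then obtain \<mu> \<phi> where \<mu>: "\<mu> \<in> sphere 0 1" and \<phi>: "strict_mono \<phi>" "(m \<circ> \<phi>) \<longlonglongrightarrow> \<mu>"
    using mx(1) unfolding seq_compact_def by (metis mem_sphere_0)
  have \<mu>1: "cmod \<mu> = 1" and \<mu>0: "\<mu> \<noteq> 0" using \<mu> by auto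
  have approx: "\<exists>v. v \<noteq> 0 \<and> norm (A v - \<mu> *\<^sub>C v) \<le> c * norm v" if c: "c > 0" for c
  proof -
    have "(\<lambda>k. inverse (real (Suc (\<phi> k))) + cmod (m (\<phi> k) - \<mu>)) \<longlonglongrightarrow> 0 + cmod (\<mu> - \<mu>)"
      using \<phi>(2) by (intro tendsto_intros LIMSEQ_subseq_LIMSEQ[OF LIMSEQ_inverse_real_of_nat \<phi>(1), unfolded o_def])
        (simp add: o_def)
    then have "\<forall>\<^sub>F k in sequentially. inverse (real (Suc (\<phi> k))) + cmod (m (\<phi> k) - \<mu>) < c"
      using c by (intro order_tendstoD) simp_all
    then obtain k where k: "inverse (real (Suc (\<phi> k))) + cmod (m (\<phi> k) - \<mu>) < c"
      by (auto simp: eventually_sequentially)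
    let ?v = "x (\<phi> k)"
    have "A ?v - \<mu> *\<^sub>C ?v = (A ?v - m (\<phi> k) *\<^sub>C ?v) + (m (\<phi> k) - \<mu>) *\<^sub>C ?v"
      by (simp add: cvec.scale_left_diff_distrib)
    then have "norm (A ?v - \<mu> *\<^sub>C ?v) \<le> norm (A ?v - m (\<phi> k) *\<^sub>C ?v) + cmod (m (\<phi> k) - \<mu>) * norm ?v"
      using norm_triangle_ineq by (metis norm_cscale)
    also have "\<dots> \<le> (inverse (real (Suc (\<phi> k))) + cmod (m (\<phi> k) - \<mu>)) * norm ?v"
      using mx(3)[of "\<phi> k"] by (simp add: distrib_right)
    also have "\<dots> \<le> c * norm ?v" using k by (intro mult_right_mono) auto
    finally show ?thesis using mx(2) by blast
  qed
  define w where "w = z + 1 / (of_real r * \<mu>)"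
  have "w \<in> spectrum T"
  proof (rule ccontr)
    assume "w \<notin> spectrum T"
    then obtain S where S: "is_resolvent T w S" unfolding not_in_spectrum_iff by blast
    define K where "K = onorm S"
    have K: "K > 0" "norm (S y) \<le> K * norm y" for y
      using resolvent_onorm_pos[OF lin S] onorm[OF is_resolventD(1)[OF S]] by (simp_all add: K_def)
    \<comment> \<open>Small enough for \<open>\<parallel>R v\<parallel> \<le> K c \<parallel>v\<parallel>\<close> to contradict \<open>\<parallel>R v\<parallel> \<ge> r (1 - c) \<parallel>v\<parallel>\<close>.\<close>
    define c where "c = r / (2 * (K + r))"
    have c: "c > 0" "c * (K + r) = r / 2" using r K(1) by (simp_all add: c_def field_simps)
    obtain v where v: "v \<noteq> 0" "norm (A v - \<mu> *\<^sub>C v) \<le> c * norm v" using approx[OF c(1)] by blast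
    have "(R v, v - (w - z) *\<^sub>C R v) \<in> shift T w"
      unfolding mem_shift_shift_iff[of _ _ T w z] using is_resolventD(2)[OF R] by simp
    then have "R v = S (v - (w - z) *\<^sub>C R v)" by (rule is_resolventD(3)[OF S])
    moreover have "v - (w - z) *\<^sub>C R v = (- 1 / \<mu>) *\<^sub>C (A v - \<mu> *\<^sub>C v)"
      using r \<mu>0 by (simp add: w_def A_def cvec.scale_right_diff_distrib field_simps)
    ultimately have "norm (R v) \<le> K * norm ((- 1 / \<mu>) *\<^sub>C (A v - \<mu> *\<^sub>C v))" using K(2) by metis
    also have "\<dots> = K * norm (A v - \<mu> *\<^sub>C v)" using \<mu>1 by (simp add: norm_cscale norm_divide)
    also have "\<dots> \<le> K * (c * norm v)" using K(1) v(2) by simp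
    finally have upper: "norm (R v) \<le> K * (c * norm v)" .
    have "norm (\<mu> *\<^sub>C v) \<le> norm (A v) + norm (A v - \<mu> *\<^sub>C v)"
      using norm_triangle_ineq4[of "A v" "A v - \<mu> *\<^sub>C v"] by simp
    then have "norm v \<le> norm (R v) / r + c * norm v" using v(2) \<mu>1 by (simp add: norm_cscale nA)
    then have "r * norm v \<le> norm (R v) + r * c * norm v" using r by (simp add: field_simps)
    also have "\<dots> \<le> (c * (K + r)) * norm v" using upper by (simp add: algebra_simps)
    finally have "r \<le> r / 2" unfolding c(2) by (rule mult_right_le_imp_le) (use v(1) in simp)
    then show False using r by simp
  qed
  moreover have "dist z w = 1 / r"
    using r \<mu>1 by (simp add: w_def dist_norm norm_divide norm_mult)
  ultimately show ?thesis unfolding r_def by blast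
qed

theorem infdist_spectrum:
  assumes T: "T \<in> Omega_N" and R: "is_resolvent T z R"
  shows "infdist z (spectrum T) = 1 / onorm R"
proof (rule antisym)
  obtain w where w: "w \<in> spectrum T" "dist z w = 1 / onorm R" using spectrum_on_circle[OF assms] by blast
  then show "infdist z (spectrum T) \<le> 1 / onorm R" by (metis infdist_le)
  have r: "onorm R > 0" using resolvent_onorm_pos[OF Omega_N_linear[OF T] R] .
  have "1 / onorm R \<le> dist z w" if "w \<in> spectrum T" for w
    using resolvent_below_spectrum[OF Omega_N_linear[OF T] R, of w] that r
    by (force simp: dist_norm norm_minus_commute field_simps not_less)
  then show "1 / onorm R \<le> infdist z (spectrum T)"
    using w(1) by (subst infdist_notempty) (auto intro!: cINF_greatest)
qed

section \<open>Density of the candidates\<close>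

lemma digit_div_mod: "(d::nat) < b \<Longrightarrow> (d + b * q) div b = q \<and> (d + b * q) mod b = d"
  by auto

text \<open>Round \<open>a s\<close> or \<open>- a s\<close> down, whichever is nonnegative; the other digit is 0.\<close>

lemma real_as_digit_difference:
  fixes a :: real
  assumes "\<bar>a\<bar> < real s"
  shows "\<exists>d < s * s. \<exists>d' < s * s. \<bar>(real d - real d') / real s - a\<bar> \<le> 1 / real s"
proof -
  have s: "real s > 0" using assms by linarith
  have bound: "nat \<lfloor>b * real s\<rfloor> < s * s" if "\<bar>b\<bar> < real s" for b
  proof -
    have "b * real s < real s * real s" using that s by (intro mult_strict_right_mono) auto
    then have "\<lfloor>b * real s\<rfloor> < int (s * s)" by (simp add: floor_less_iff)
    moreover have "0 < int (s * s)" using s by simp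
    ultimately show ?thesis by linarith
  qed
  have close: "\<bar>(real (nat \<lfloor>a * real s\<rfloor>) - real (nat \<lfloor>- a * real s\<rfloor>)) - a * real s\<bar> \<le> 1"
    by (cases "0 \<le> a * real s") linarith+
  have "(real (nat \<lfloor>a * real s\<rfloor>) - real (nat \<lfloor>- a * real s\<rfloor>)) / real s - a =
      ((real (nat \<lfloor>a * real s\<rfloor>) - real (nat \<lfloor>- a * real s\<rfloor>)) - a * real s) / real s"
    using s by (simp add: field_simps)
  then have "\<bar>(real (nat \<lfloor>a * real s\<rfloor>) - real (nat \<lfloor>- a * real s\<rfloor>)) / real s - a\<bar> \<le> 1 / real s"
    using close s by (simp add: abs_divide divide_right_mono)
  moreover define d d' where "d = nat \<lfloor>a * real s\<rfloor>" and "d' = nat \<lfloor>- a * real s\<rfloor>"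
  moreover have "d < s * s" "d' < s * s"
    using bound[OF assms] bound[of "- a"] assms by (simp_all add: d_def d'_def)
  ultimately show ?thesis by blast
qed

text \<open>The digits of each coordinate are prepended to the number that encodes the later coordinates.\<close>

lemma grid_exists:
  assumes "\<And>j. j < m \<Longrightarrow> cmod (w j) < real s" "s \<ge> 1"
  shows "\<exists>q. (\<forall>j<m. cmod (grid s q j - w j) \<le> 2 / real s) \<and> (\<forall>j\<ge>m. grid s q j = 0)"
  using assms(1)
proof (induction m arbitrary: w)
  case 0
  have "(drop4 s ^^ j) 0 = 0" for j by (induction j) (simp_all add: drop4_def)
  then have "grid s 0 j = 0" for j by (simp add: grid_def quad_digits_def Let_def complex_eq_iff)
  then show ?case by blast
next
  case (Suc m)
  have "cmod (w (Suc j)) < real s" if "j < m" for j using Suc.prems that by simp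
  from Suc.IH[of "\<lambda>j. w (Suc j)", OF this] obtain q where
    q: "\<And>j. j < m \<Longrightarrow> cmod (grid s q j - w (Suc j)) \<le> 2 / real s" "\<And>j. j \<ge> m \<Longrightarrow> grid s q j = 0"
    by blast
  define b where "b = s * s"
  have "\<bar>Re (w 0)\<bar> < real s" and Im: "\<bar>Im (w 0)\<bar> < real s"
    using Suc.prems[of 0] abs_Re_le_cmod[of "w 0"] abs_Im_le_cmod[of "w 0"] by auto
  from real_as_digit_difference[OF this(1)] obtain d0 d1 where d01: "d0 < b" "d1 < b"
    and re: "\<bar>(real d0 - real d1) / real s - Re (w 0)\<bar> \<le> 1 / real s"
    unfolding b_def by blast
  from real_as_digit_difference[OF Im] obtain d2 d3 where d23: "d2 < b" "d3 < b"
    and im: "\<bar>(real d2 - real d3) / real s - Im (w 0)\<bar> \<le> 1 / real s"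
    unfolding b_def by blast
  note d = d01 d23
  define r where "r = d0 + b * (d1 + b * (d2 + b * (d3 + b * q)))"
  have r: "drop4 s r = q"
    "quad_digits s r = Complex ((real d0 - real d1) / real s) ((real d2 - real d3) / real s)"
    using d by (simp_all add: r_def drop4_def quad_digits_def b_def[symmetric] digit_div_mod)
  have r0: "grid s r 0 = Complex ((real d0 - real d1) / real s) ((real d2 - real d3) / real s)"
    by (simp add: grid_def r)
  have rS: "grid s r (Suc j) = grid s q j" for j
    by (simp add: grid_def funpow_swap1 r del: funpow.simps) (simp add: funpow_Suc_right r del: funpow.simps)
  have "cmod (grid s r 0 - w 0) \<le> 2 / real s"
    using cmod_le[of "grid s r 0 - w 0"] re im by (simp add: r0)
  then have "cmod (grid s r j - w j) \<le> 2 / real s" if "j < Suc m" for j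
    using that q(1) by (cases j) (simp_all add: rS)
  moreover have "grid s r j = 0" if "j \<ge> Suc m" for j
    using that q(2) by (cases j) (simp_all add: rS)
  ultimately show ?case by blast
qed

lemma grid_dense:
  assumes "e > 0"
  shows "\<exists>s\<ge>1. \<exists>q. (\<forall>j<m. cmod (grid s q j - w j) < e) \<and> (\<forall>j\<ge>m. grid s q j = 0)"
proof -
  define s where "s = nat \<lceil>2 / e + (\<Sum>j<m. cmod (w j))\<rceil> + 1"
  have s: "2 / e + (\<Sum>j<m. cmod (w j)) < real s" unfolding s_def by linarith
  have nn: "(\<Sum>j<m. cmod (w j)) \<ge> 0" "2 / e > 0" using assms by (simp_all add: sum_nonneg)
  have "cmod (w j) < real s" if "j < m" for j
  proof -
    have "cmod (w j) \<le> (\<Sum>j<m. cmod (w j))"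
      using that by (intro member_le_sum) auto
    then show ?thesis using s nn by linarith
  qed
  moreover have "s \<ge> 1" by (simp add: s_def)
  ultimately obtain q where q: "\<And>j. j < m \<Longrightarrow> cmod (grid s q j - w j) \<le> 2 / real s"
    "\<And>j. j \<ge> m \<Longrightarrow> grid s q j = 0"
    using grid_exists[of m w s] by blast
  have "2 / e < real s" "0 < real s" using s nn by linarith+
  then have small: "2 / real s < e" using assms by (simp add: field_simps)
  show ?thesis
  proof (intro exI conjI allI impI)
    show "s \<ge> 1" by (simp add: s_def)
    show "cmod (grid s q j - w j) < e" if "j < m" for j using q(1)[OF that] small by linarith
  qed (rule q(2))
qed

definition lin :: "nat \<Rightarrow> (nat \<Rightarrow> complex) \<Rightarrow> ell2" where
  "lin m u = (\<Sum>j<m. u j *\<^sub>C basis_vec j)"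

lemma coeff_lin [simp]: "coeff (lin m u) k = (if k < m then u k else 0)"
  by (simp add: lin_def coeff_sum if_distrib sum.delta' cong: if_cong)

lemma vector_of_list_map: "vector_of_list (map u [0..<m]) = lin m u"
  by (simp add: vector_of_list_def lin_def)

lemma norm_proj_sq: "(norm (proj m y))\<^sup>2 = (\<Sum>i<m. (cmod (coeff y i))\<^sup>2)"
proof -
  have "(\<lambda>k. (cmod (coeff (proj m y) k))\<^sup>2) sums (\<Sum>i<m. (cmod (coeff (proj m y) i))\<^sup>2)"
    by (rule sums_finite) auto
  from sums_unique2[OF norm_sq_sums this] show ?thesis by simp
qed

lemma norm_proj_le: "norm (proj m y) \<le> norm y"
  by (rule power2_le_imp_le) (simp_all add: norm_proj_sq sum_coeff_le)

lemma proj_diff: "proj m (x - y) = proj m x - proj m y"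
  by (rule coeff_eqI) simp

lemma proj_lin: "m \<ge> l \<Longrightarrow> proj m (lin l u) = lin l u"
  by (rule coeff_eqI) simp

lemma mass_eq: "mass m u = (norm (lin m u))\<^sup>2"
  using norm_proj_sq[of m "lin m u"] by (simp add: proj_lin mass_def)

lemma norm_basis_vec: "norm (basis_vec j) = 1"
proof -
  have "proj (Suc j) (basis_vec j) = basis_vec j" by (rule coeff_eqI) simp
  then have "(norm (basis_vec j))\<^sup>2 = 1" using norm_proj_sq[of "Suc j" "basis_vec j"] by simp
  then show ?thesis using power2_eq_iff_nonneg[of "norm (basis_vec j)" 1] by simp
qed

lemma span_basis_vec: "x \<in> cvec.span (range basis_vec) \<Longrightarrow> \<exists>m w. x = lin m w"
proof -
  assume "x \<in> cvec.span (range basis_vec)"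
  then have "\<exists>m. \<forall>k\<ge>m. coeff x k = 0"
  proof (induction rule: cvec.span_induct_alt)
    case (step c x y)
    then obtain n m where "x = basis_vec n" "\<forall>k\<ge>m. coeff y k = 0" by blast
    then have "\<forall>k\<ge>max (Suc n) m. coeff (c *\<^sub>C x + y) k = 0" by auto
    then show ?case by blast
  qed simp
  then obtain m where "\<forall>k\<ge>m. coeff x k = 0" by blast
  then have "x = lin m (coeff x)" by (intro coeff_eqI) auto
  then show ?thesis by blast
qed

lemma lin_in_span: "lin m u \<in> cvec.span (range basis_vec)"
  unfolding lin_def by (intro cvec.span_sum cvec.span_scale cvec.span_base) blast

lemma Omega_N_core:
  assumes "T \<in> Omega_N"
  shows "cvec.span (range basis_vec) \<subseteq> Domain T"
    and "closure {(x, y) \<in> T. x \<in> cvec.span (range basis_vec)} = T"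
  using assms unfolding Omega_N_def C_ell2_def is_core_def by blast+

lemma lin_in_Domain: "T \<in> Omega_N \<Longrightarrow> lin m u \<in> Domain T"
  using Omega_N_core(1) lin_in_span by blast

lemma basis_vec_in_Domain: "T \<in> Omega_N \<Longrightarrow> basis_vec j \<in> Domain T"
  using Omega_N_core(1) cvec.span_base by blast

lemma app_lin:
  assumes B: "linear_operator B" and dom: "\<And>j. basis_vec j \<in> Domain B"
  shows "app B (lin m u) = (\<Sum>j<m. u j *\<^sub>C app B (basis_vec j))"
proof -
  have "(lin m u, \<Sum>j<m. u j *\<^sub>C app B (basis_vec j)) \<in> B"
  proof (induction m)
    case 0
    then show ?case using linear_operatorD(2)[OF B] by (simp add: lin_def)
  next
    case (Suc m)
    from linear_operatorD(3)[OF B this linear_operatorD(4)[OF B app_in[OF B dom[of m]], of "u m"]]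
    show ?case by (simp add: lin_def)
  qed
  then show ?thesis by (rule app_eqI[OF B])
qed

lemma app_shift:
  assumes "linear_operator T" "x \<in> Domain T"
  shows "app (shift T z) x = app T x - z *\<^sub>C x"
  by (rule app_eqI[OF linear_operator_shift[OF assms(1)]])
    (use app_in[OF assms] in \<open>simp add: mem_shift_iff\<close>)

text \<open>Three approximations: the core property gives a finitely supported vector near \<open>u\<close> whose
  image is near \<open>v\<close>; on the span of finitely many basis vectors \<open>T - z\<close> is continuous, so its
  coefficients may be moved to a grid; the grid vector is a candidate at all large levels. It
  does not depend on the level, which the convergence proofs exploit.\<close>

lemma candidate_approximation:
  assumes T: "T \<in> Omega_N" and uv: "(u, v) \<in> shift T z" and e: "e > 0"
  shows "\<exists>n0 l w. norm (lin l w - u) < e \<and> norm (app (shift T z) (lin l w) - v) < e \<and>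
    (\<forall>n\<ge>n0. \<exists>k<n * n. lin n (cand n k) = lin l w)"
proof -
  note lin = Omega_N_linear[OF T]
  let ?B = "shift T z"
  have B: "linear_operator ?B" and dom: "\<And>j. basis_vec j \<in> Domain ?B"
    using linear_operator_shift[OF lin] basis_vec_in_Domain[OF T] by (simp_all add: Domain_shift)
  \<comment> \<open>Passing from \<open>T\<close> to \<open>T - z\<close> increases errors by at most the factor \<open>1 + \<bar>z\<bar>\<close>.\<close>
  define \<delta> where "\<delta> = e / 2 / (1 + cmod z)"
  have \<delta>: "\<delta> > 0" "\<delta> + cmod z * \<delta> = e / 2"
  proof -
    have pos: "1 + cmod z > 0" using norm_ge_zero[of z] by linarith
    then show "\<delta> > 0" using e by (simp add: \<delta>_def)
    have "\<delta> + cmod z * \<delta> = \<delta> * (1 + cmod z)" by (simp add: algebra_simps)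
    moreover have "e / 2 = \<delta> * (1 + cmod z)"
      using pos by (intro iffD1[OF nonzero_divide_eq_eq \<delta>_def[symmetric]]) simp
    ultimately show "\<delta> + cmod z * \<delta> = e / 2" by simp
  qed
  have "(u, v + z *\<^sub>C u) \<in> closure {(x, y) \<in> T. x \<in> cvec.span (range basis_vec)}"
    using uv Omega_N_core(2)[OF T] by (simp add: mem_shift_iff)
  then obtain x y where xy: "(x, y) \<in> T" "x \<in> cvec.span (range basis_vec)"
    and near: "dist (x, y) (u, v + z *\<^sub>C u) < \<delta>"
    unfolding closure_approachable using \<delta>(1) by force
  obtain m w where x: "x = lin m w" using span_basis_vec[OF xy(2)] by blast
  have xu: "norm (x - u) < \<delta>" and yv: "norm (y - (v + z *\<^sub>C u)) < \<delta>"
    using near dist_fst_le[of "(x, y)" "(u, v + z *\<^sub>C u)"] dist_snd_le[of "(x, y)" "(u, v + z *\<^sub>C u)"]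
    by (simp_all add: dist_norm)
  have Bx: "app ?B x = y - z *\<^sub>C x"
    using app_shift[OF lin, of x z] app_eqI[OF lin xy(1)] xy(1) by (simp add: DomainI)
  have "app ?B x - v = (y - (v + z *\<^sub>C u)) - z *\<^sub>C (x - u)"
    by (simp add: Bx cvec.scale_right_diff_distrib)
  then have "norm (app ?B x - v) \<le> norm (y - (v + z *\<^sub>C u)) + cmod z * norm (x - u)"
    using norm_triangle_ineq4[of "y - (v + z *\<^sub>C u)" "z *\<^sub>C (x - u)"] by (simp only: norm_cscale)
  also have "\<dots> < \<delta> + cmod z * \<delta>"
    using xu yv by (intro add_less_le_mono mult_left_mono) auto
  finally have Bxv: "norm (app ?B x - v) < e / 2" by (simp add: \<delta>)
  have xu2: "norm (x - u) < e / 2"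
  proof -
    have "0 \<le> cmod z * \<delta>" using \<delta>(1) by simp
    then show ?thesis using xu \<delta>(2) by linarith
  qed
  define c where "c j = 1 + norm (app ?B (basis_vec j))" for j
  define C where "C = (\<Sum>j<m. c j) + 1"
  have c1: "c j \<ge> 1" for j by (simp add: c_def)
  then have "0 \<le> c j" for j using order_trans[OF zero_le_one] by blast
  then have C: "C > 0" using sum_nonneg[of "{..<m}" c] by (simp add: C_def add_nonneg_pos)
  obtain s q where s: "s \<ge> 1" and sq: "\<And>j. j < m \<Longrightarrow> cmod (grid s q j - w j) < e / 2 / C"
    "\<And>j. j \<ge> m \<Longrightarrow> grid s q j = 0"
    using grid_dense[of "e / 2 / C" m w] e C by auto
  have sum_small: "norm (\<Sum>j<m. (grid s q j - w j) *\<^sub>C t j) < e / 2"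
    if "\<And>j. norm (t j) \<le> c j" for t :: "nat \<Rightarrow> ell2"
  proof -
    have "norm (\<Sum>j<m. (grid s q j - w j) *\<^sub>C t j) \<le> (\<Sum>j<m. (e / 2 / C) * c j)"
    proof (rule sum_norm_le)
      fix j assume "j \<in> {..<m}"
      then show "norm ((grid s q j - w j) *\<^sub>C t j) \<le> (e / 2 / C) * c j"
        unfolding norm_cscale using sq(1)[of j] that[of j] e C
        by (intro mult_mono) (auto intro: less_imp_le)
    qed
    also have "\<dots> = (e / 2 / C) * (C - 1)" by (simp add: C_def sum_distrib_left)
    also have "\<dots> < (e / 2 / C) * C" using e C by (intro mult_strict_left_mono) auto
    finally show ?thesis using C by simp
  qed
  have "lin m (grid s q) - x = (\<Sum>j<m. (grid s q j - w j) *\<^sub>C basis_vec j)"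
    by (simp add: x lin_def cvec.scale_left_diff_distrib sum_subtractf)
  moreover have "norm (basis_vec j) \<le> c j" for j by (simp add: c_def norm_basis_vec)
  ultimately have near1: "norm (lin m (grid s q) - x) < e / 2" using sum_small by metis
  have "app ?B (lin m (grid s q)) - app ?B x = (\<Sum>j<m. (grid s q j - w j) *\<^sub>C app ?B (basis_vec j))"
    unfolding x app_lin[OF B dom] by (simp add: cvec.scale_left_diff_distrib sum_subtractf)
  then have near2: "norm (app ?B (lin m (grid s q)) - app ?B x) < e / 2"
    using sum_small[of "\<lambda>j. app ?B (basis_vec j)"] by (simp add: c_def)
  have "norm (lin m (grid s q) - u) < e"
    using norm_triangle_ineq[of "lin m (grid s q) - x" "x - u"] near1 xu2 by simp
  moreover have "norm (app ?B (lin m (grid s q)) - v) < e"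
    using norm_triangle_ineq[of "app ?B (lin m (grid s q)) - app ?B x" "app ?B x - v"] near2 Bxv by simp
  moreover have "\<exists>k<n * n. lin n (cand n k) = lin m (grid s q)" if n: "n \<ge> s + q + m" for n
  proof (intro exI conjI)
    have qn: "q < n" using n s by simp
    have "(s - 1) * n + q < (s - 1) * n + n" using qn by simp
    also have "\<dots> = s * n" using s by (cases s) simp_all
    also have "\<dots> \<le> n * n" using n by simp
    finally show "(s - 1) * n + q < n * n" .
    have "((s - 1) * n + q) div n = s - 1" "((s - 1) * n + q) mod n = q"
      using qn by simp_all
    then have "cand n ((s - 1) * n + q) = grid s q" using s by (simp add: cand_def)
    then show "lin n (cand n ((s - 1) * n + q)) = lin m (grid s q)"
      using n sq(2) by (intro coeff_eqI) auto
  qed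
  ultimately show ?thesis by blast
qed

section \<open>Truncated residuals\<close>

definition entry :: "operator \<Rightarrow> nat \<Rightarrow> nat \<Rightarrow> complex" where
  "entry T i j = cinner (app T (basis_vec j)) (basis_vec i)"

lemma residual_eq:
  assumes T: "T \<in> Omega_N" and "l \<le> m"
  shows "residual (entry T) (coeff x) z l m g u = (norm (proj m (app (shift T z) (lin l u) - g *\<^sub>R x)))\<^sup>2"
proof -
  note lin = Omega_N_linear[OF T]
  have dom: "\<And>j. basis_vec j \<in> Domain (shift T z)"
    using basis_vec_in_Domain[OF T] by (simp add: Domain_shift)
  have "coeff (app (shift T z) (lin l u)) i = (\<Sum>j<l. (entry T i j - (if i = j then z else 0)) * u j)" for i
    unfolding app_lin[OF linear_operator_shift[OF lin] dom] coeff_sum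
    by (intro sum.cong refl)
      (simp add: app_shift[OF lin basis_vec_in_Domain[OF T]] entry_def cinner_basis_vec mult.commute)
  then show ?thesis unfolding norm_proj_sq residual_def by simp
qed

text \<open>The dispersion refers to \<open>T\<close>, not to \<open>T - z\<close>; but \<open>z u\<close> has no component beyond the first
  \<open>n\<close> basis vectors when \<open>u\<close> has none.\<close>

lemma dispersion_bound:
  assumes T: "T \<in> Omega_N" and nm: "n \<le> m"
  shows "norm (app (shift T z) (lin n u) - proj m (app (shift T z) (lin n u)))
    \<le> dispersion T m n * norm (lin n u)"
proof -
  note lin = Omega_N_linear[OF T]
  define D where "D v = app T (proj n v) - proj m (app T (proj n v))" for v
  define d where "d j = app T (basis_vec j) - proj m (app T (basis_vec j))" for j
  have D: "D v = (\<Sum>j<n. coeff v j *\<^sub>C d j)" for v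
  proof -
    have "proj n v = lin n (coeff v)" by (rule coeff_eqI) simp
    then show ?thesis
      unfolding D_def d_def app_lin[OF lin basis_vec_in_Domain[OF T], of n, symmetric]
      by (intro coeff_eqI) (simp add: app_lin[OF lin basis_vec_in_Domain[OF T]] coeff_sum
          sum_subtractf[symmetric] algebra_simps)
  qed
  have "bounded_linear (\<lambda>v. coeff v j *\<^sub>C d j)" for j
  proof (rule bounded_linear_intro[where K = "norm (d j)"])
    show "norm (coeff v j *\<^sub>C d j) \<le> norm v * norm (d j)" for v
      unfolding norm_cscale by (intro mult_right_mono cmod_coeff_le) simp
  qed (simp_all add: cvec.scale_left_distrib scaleR_cscale)
  then have "bounded_linear D" unfolding D[abs_def] by (intro bounded_linear_sum) blast
  from onorm[OF this, of "lin n u"]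
  have "norm (D (lin n u)) \<le> dispersion T m n * norm (lin n u)"
    by (simp add: dispersion_def D_def[abs_def])
  moreover have "app (shift T z) (lin n u) - proj m (app (shift T z) (lin n u)) = D (lin n u)"
    unfolding app_shift[OF lin lin_in_Domain[OF T]] D_def proj_lin[OF order_refl]
    using nm by (intro coeff_eqI) simp
  ultimately show ?thesis by simp
qed

lemma admissible_exists:
  assumes "(T, x, z) \<in> S_class f \<alpha> \<beta>" "\<And>n. n \<ge> 1 \<Longrightarrow> 0 \<le> \<alpha> n" "\<And>n. n \<ge> 1 \<Longrightarrow> 0 \<le> \<beta> n"
  shows "\<exists>C\<^sub>1 C\<^sub>2. admissible_constants f \<alpha> \<beta> T x C\<^sub>1 C\<^sub>2"
proof -
  obtain C D where C: "\<And>n. n \<ge> 1 \<Longrightarrow> dispersion T (f n) n \<le> C * \<alpha> n"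
    and D: "\<And>n. n \<ge> 1 \<Longrightarrow> norm (proj n x - x) \<le> D * \<beta> n"
    using assms(1) unfolding S_class_def Omega_N_f_def by auto
  have le: "C * \<alpha> n \<le> max 0 C * \<alpha> n" "D * \<beta> n \<le> max 0 D * \<beta> n" if "n \<ge> 1" for n
    using assms(2,3)[OF that] by (intro mult_right_mono; simp)+
  have "admissible_constants f \<alpha> \<beta> T x (max 0 C) (max 0 D)"
    unfolding admissible_constants_def
    by (intro conjI allI impI order_trans[OF C le(1)] order_trans[OF D le(2)]) simp_all
  then show ?thesis by blast
qed

text \<open>The error bound holds for every vector that is supported on the first \<open>n\<close> basis vectors, no matter
  how it was found.\<close>

lemma error_bound_lin:
  assumes T: "T \<in> Omega_N" and R: "is_resolvent T z R"
    and C: "admissible_constants f \<alpha> \<beta> T x C\<^sub>1 C\<^sub>2" and n: "n \<ge> 1" "f n > n"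
  shows "norm (lin n u - R x) \<le> error_bound f \<alpha> \<beta> C\<^sub>1 C\<^sub>2 n T x z (lin n u)"
proof -
  note lin = Omega_N_linear[OF T]
  let ?B = "shift T z" let ?y = "lin n u"
  let ?v = "app ?B ?y"
  have "(?y, ?v) \<in> ?B"
    using app_in[OF linear_operator_shift[OF lin]] lin_in_Domain[OF T] by (simp add: Domain_shift)
  then have y: "?y = R ?v" by (rule is_resolventD(3)[OF R])
  interpret R: bounded_linear R by (rule is_resolventD(1)[OF R])
  have "?v - x = (?v - proj (f n) ?v) + (proj (f n) ?v - proj (f n) x) + (proj (f n) x - x)" by simp
  then have "norm (?v - x) \<le> norm (?v - proj (f n) ?v) + norm (proj (f n) ?v - proj (f n) x) +
      norm (proj (f n) x - x)"
    by (metis norm_triangle_ineq norm_triangle_mono order_refl)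
  moreover have "norm (?v - proj (f n) ?v) \<le> C\<^sub>1 * \<alpha> n * norm ?y"
    using dispersion_bound[OF T, of n "f n" z u] C n unfolding admissible_constants_def
    by (smt (verit) less_imp_le_nat mult_right_mono norm_ge_zero)
  moreover have "norm (proj (f n) x - x) \<le> C\<^sub>2 * \<beta> (f n)"
    using C n unfolding admissible_constants_def by simp
  ultimately have bound: "norm (?v - x) \<le> C\<^sub>2 * \<beta> (f n) + C\<^sub>1 * \<alpha> n * norm ?y +
      norm (proj (f n) ?v - proj (f n) x)" by linarith
  have "norm (?y - R x) = norm (R (?v - x))" using y by (metis R.diff)
  also have "\<dots> \<le> onorm R * norm (?v - x)" by (rule onorm[OF is_resolventD(1)[OF R]])
  also have "\<dots> \<le> onorm R * (C\<^sub>2 * \<beta> (f n) + C\<^sub>1 * \<alpha> n * norm ?y + norm (proj (f n) ?v - proj (f n) x))"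
    using bound resolvent_onorm_pos[OF lin R] by (intro mult_left_mono) auto
  finally show ?thesis
    unfolding error_bound_def infdist_spectrum[OF T R] by (simp add: mult.commute)
qed

section \<open>Convergence\<close>

definition approximant :: "(nat \<Rightarrow> nat) \<Rightarrow> nat \<Rightarrow> input \<Rightarrow> ell2" where
  "approximant f n = (\<lambda>(T, x, z). lin n (cand n (best (entry T) (coeff x) z n (f n) 1)))"

lemma residual_nonneg: "residual a x z l m g u \<ge> 0"
  by (simp add: residual_def sum_nonneg)

lemma score_le_best:
  "k < l * l \<Longrightarrow> score a x z l m g (cand l k) \<le> score a x z l m g (cand l (best a x z l m g))"
  unfolding best_def by (rule last_argmax_max[where f = "\<lambda>k. score a x z l m g (cand l k)"])

lemma best_minimises_residual:
  assumes "k < n * n"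
  shows "residual a x z n m 1 (cand n (best a x z n m 1)) \<le> residual a x z n m 1 (cand n k)"
proof -
  let ?r = "residual a x z n m 1 (cand n k)"
  let ?r' = "residual a x z n m 1 (cand n (best a x z n m 1))"
  have pos: "?r + 1 > 0" "?r' + 1 > 0" using residual_nonneg by (smt (verit))+
  have "1 / (?r + 1) \<le> 1 / (?r' + 1)"
    using score_le_best[OF assms, of a x z m 1] by (simp add: score_def)
  then show ?thesis using pos by (simp add: divide_le_eq le_divide_eq)
qed

text \<open>A fixed candidate with residual below \<open>e\<close> takes part in the search at all large levels, and
  the chosen vector is at least as good.\<close>

lemma approximant_residual_tendsto:
  assumes T: "T \<in> Omega_N" and R: "is_resolvent T z R" and f: "\<And>n. n \<ge> 1 \<Longrightarrow> f n > n"
  shows "(\<lambda>n. norm (proj (f n) (app (shift T z) (approximant f n (T, x, z))) - proj (f n) x)) \<longlonglongrightarrow> 0"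
proof (rule LIMSEQ_I)
  fix e :: real assume e: "e > 0"
  from candidate_approximation[OF T is_resolventD(2)[OF R, of x] e]
  obtain n0 l w where close: "norm (app (shift T z) (lin l w) - x) < e"
    and cand: "\<forall>n\<ge>n0. \<exists>k<n * n. lin n (cand n k) = lin l w" by blast
  have "norm (proj (f n) (app (shift T z) (approximant f n (T, x, z))) - proj (f n) x) < e"
    if n: "n \<ge> max 1 n0" for n
  proof -
    obtain k where k: "k < n * n" "lin n (cand n k) = lin l w" using cand n by auto
    have n1: "n \<ge> 1" and fn: "n \<le> f n" using n f[of n] by auto
    define b where "b = cand n (best (entry T) (coeff x) z n (f n) 1)"
    have "(norm (proj (f n) (app (shift T z) (lin n b) - x)))\<^sup>2
        \<le> (norm (proj (f n) (app (shift T z) (lin n (cand n k)) - x)))\<^sup>2"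
      using best_minimises_residual[OF k(1), of "entry T" "coeff x" z "f n"]
      by (simp add: residual_eq[OF T fn] b_def)
    then have "norm (proj (f n) (app (shift T z) (lin n b) - x))
        \<le> norm (proj (f n) (app (shift T z) (lin n (cand n k)) - x))"
      by (rule power2_le_imp_le) simp
    also have "\<dots> \<le> norm (app (shift T z) (lin l w) - x)" unfolding k(2) by (rule norm_proj_le)
    finally show ?thesis using close by (simp add: approximant_def b_def proj_diff)
  qed
  then show "\<exists>no. \<forall>n\<ge>no. norm (norm (proj (f n) (app (shift T z) (approximant f n (T, x, z))) -
      proj (f n) x) - 0) < e"
    by (intro exI[of _ "max 1 n0"]) simp
qed

text \<open>The error bound contains the norm of the approximant itself. Since \<open>C\<^sub>1 \<alpha>\<^sub>n\<close> tends to 0, that term is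
  eventually absorbed: it is at most half the error plus a null sequence.\<close>

lemma approximant_tendsto:
  assumes T: "T \<in> Omega_N" and R: "is_resolvent T z R" and f: "\<And>n. n \<ge> 1 \<Longrightarrow> f n > n"
    and C: "admissible_constants f \<alpha> \<beta> T x C\<^sub>1 C\<^sub>2" and lim: "\<alpha> \<longlonglongrightarrow> 0" "\<beta> \<longlonglongrightarrow> 0"
    and \<alpha>: "\<And>n. n \<ge> 1 \<Longrightarrow> 0 \<le> \<alpha> n"
  shows "(\<lambda>n. approximant f n (T, x, z)) \<longlonglongrightarrow> R x"
proof -
  define y where "y n = approximant f n (T, x, z)" for n
  define \<rho> where "\<rho> n = norm (proj (f n) (app (shift T z) (y n)) - proj (f n) x)" for n
  define r where "r = onorm R"
  have r: "r > 0" unfolding r_def by (rule resolvent_onorm_pos[OF Omega_N_linear[OF T] R])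
  have \<rho>: "\<rho> \<longlonglongrightarrow> 0"
    using approximant_residual_tendsto[OF T R f] unfolding \<rho>_def y_def .
  have "filterlim f at_top sequentially"
    unfolding filterlim_at_top
  proof
    fix Z
    have "Z \<le> f n" if "max 1 Z \<le> n" for n using f[of n] that by simp
    then show "\<forall>\<^sub>F n in sequentially. Z \<le> f n" unfolding eventually_sequentially by blast
  qed
  from filterlim_compose[OF lim(2) this] have \<beta>f: "(\<lambda>n. \<beta> (f n)) \<longlonglongrightarrow> 0" .
  define g where "g n = 2 * r * (C\<^sub>2 * \<beta> (f n) + C\<^sub>1 * \<alpha> n * norm (R x) + \<rho> n)" for n
  have "g \<longlonglongrightarrow> 2 * r * (C\<^sub>2 * 0 + C\<^sub>1 * 0 * norm (R x) + 0)"
    unfolding g_def by (intro tendsto_intros \<beta>f lim \<rho>)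
  then have g: "g \<longlonglongrightarrow> 0" by simp
  have "(\<lambda>n. r * (C\<^sub>1 * \<alpha> n)) \<longlonglongrightarrow> r * (C\<^sub>1 * 0)" by (intro tendsto_intros lim)
  then have "(\<lambda>n. r * (C\<^sub>1 * \<alpha> n)) \<longlonglongrightarrow> 0" by simp
  from order_tendstoD(2)[OF this, of "1 / 2"]
  have "\<forall>\<^sub>F n in sequentially. r * (C\<^sub>1 * \<alpha> n) < 1 / 2" by simp
  then have "\<forall>\<^sub>F n in sequentially. norm (y n - R x) \<le> g n"
    using eventually_ge_at_top[of 1]
  proof eventually_elim
    case (elim n)
    define e where "e = norm (y n - R x)"
    have "e \<le> error_bound f \<alpha> \<beta> C\<^sub>1 C\<^sub>2 n T x z (y n)"
      using error_bound_lin[OF T R C elim(2) f[OF elim(2)]] by (simp add: e_def y_def approximant_def)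
    then have "e \<le> r * (C\<^sub>2 * \<beta> (f n) + C\<^sub>1 * \<alpha> n * norm (y n) + \<rho> n)"
      unfolding error_bound_def infdist_spectrum[OF T R] r_def[symmetric] \<rho>_def[symmetric]
      by (simp add: mult.commute)
    also have "\<dots> \<le> r * (C\<^sub>2 * \<beta> (f n) + C\<^sub>1 * \<alpha> n * (e + norm (R x)) + \<rho> n)"
    proof -
      have "norm (y n) \<le> e + norm (R x)" unfolding e_def using norm_triangle_sub by (metis add.commute)
      then show ?thesis
        using r \<alpha>[OF elim(2)] C unfolding admissible_constants_def
        by (intro mult_left_mono add_mono) auto
    qed
    also have "\<dots> = r * (C\<^sub>1 * \<alpha> n) * e + g n / 2" by (simp add: g_def algebra_simps)
    also have "\<dots> \<le> 1 / 2 * e + g n / 2"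
      using elim(1) by (intro add_mono mult_right_mono) (auto simp: e_def)
    finally show ?case by (simp add: e_def)
  qed
  then have "(\<lambda>n. norm (y n - R x)) \<longlonglongrightarrow> 0"
    using g by (intro tendsto_sandwich[OF _ _ tendsto_const g]) simp_all
  then show ?thesis unfolding y_def using LIM_zero_iff tendsto_norm_zero_iff by blast
qed

text \<open>For \<open>g = 0\<close> the best quotient \<open>\<parallel>u\<parallel> / \<parallel>P\<^sub>m (T - z) u\<parallel>\<close> is eventually larger than any number below
  \<open>\<parallel>R\<parallel>\<close>, because a fixed candidate has a larger quotient already before truncation, which
  only decreases the denominator. It is at most \<open>\<parallel>R\<parallel> / (1 - \<parallel>R\<parallel> C\<^sub>1 \<alpha>\<^sub>m)\<close>, because truncation loses
  no more than the dispersion.\<close>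

lemma best_score_tendsto:
  assumes T: "T \<in> Omega_N" and R: "is_resolvent T z R" and f: "\<And>n. n \<ge> 1 \<Longrightarrow> f n > n"
    and C: "admissible_constants f \<alpha> \<beta> T x C\<^sub>1 C\<^sub>2" and lim: "\<alpha> \<longlonglongrightarrow> 0"
  shows "(\<lambda>l. sqrt (score (entry T) (coeff x) z l (f l) 0
      (cand l (best (entry T) (coeff x) z l (f l) 0)))) \<longlonglongrightarrow> onorm R"
proof -
  note lin = Omega_N_linear[OF T]
  let ?B = "shift T z"
  define r where "r = onorm R"
  define top where "top l = sqrt (score (entry T) (coeff x) z l (f l) 0
      (cand l (best (entry T) (coeff x) z l (f l) 0)))" for l
  have r: "r > 0" and Rr: "norm (R v) \<le> r * norm v" for v
    using resolvent_onorm_pos[OF lin R] onorm[OF is_resolventD(1)[OF R]] by (simp_all add: r_def)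
  have ratio: "sqrt (score (entry T) (coeff x) z l (f l) 0 u) =
      norm (lin l u) / norm (proj (f l) (app ?B (lin l u)))" if "l \<ge> 1" for l u
    using f[OF that] by (simp add: score_def mass_eq residual_eq[OF T] real_sqrt_divide)
  have RB: "lin l u = R (app ?B (lin l u))" for l u
    using app_in[OF linear_operator_shift[OF lin]] lin_in_Domain[OF T]
    by (intro is_resolventD(3)[OF R]) (simp add: Domain_shift)
  show ?thesis
    unfolding top_def[symmetric] r_def[symmetric]
  proof (rule order_tendstoI)
    fix \<eta> assume "\<eta> < r"
    then obtain \<theta> where \<theta>: "\<eta> < \<theta>" "0 \<le> \<theta>" "\<theta> < r"
      using r by (metis dense less_le_trans linorder_not_le order.strict_implies_order)
    have "\<exists>v. norm (R v) > \<theta> * norm v"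
    proof (rule ccontr)
      assume "\<nexists>v. norm (R v) > \<theta> * norm v"
      then have "onorm R \<le> \<theta>" using \<theta>(2) by (intro onorm_bound) (auto simp: not_less)
      with \<theta>(3) show False by (simp add: r_def)
    qed
    then obtain v where v: "norm (R v) > \<theta> * norm v" by blast
    define e where "e = (norm (R v) - \<theta> * norm v) / (1 + \<theta>)"
    have e: "e > 0" and e_eq: "e + \<theta> * e = norm (R v) - \<theta> * norm v"
    proof -
      have pos: "1 + \<theta> > 0" using \<theta>(2) by linarith
      then show "e > 0" using v by (simp add: e_def)
      have "e * (1 + \<theta>) = norm (R v) - \<theta> * norm v" using pos by (simp add: e_def)
      then show "e + \<theta> * e = norm (R v) - \<theta> * norm v" by (simp add: algebra_simps)
    qed
    from candidate_approximation[OF T is_resolventD(2)[OF R, of v] e]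
    obtain n0 m w where near: "norm (lin m w - R v) < e" "norm (app ?B (lin m w) - v) < e"
      and cand: "\<forall>n\<ge>n0. \<exists>k<n * n. lin n (cand n k) = lin m w" by blast
    define y where "y = lin m w"
    have "norm (R v) - e < norm y" using near(1) norm_triangle_ineq3[of y "R v"] by (simp add: y_def)
    moreover have "norm (app ?B y) < norm v + e"
      using near(2) norm_triangle_ineq2[of "app ?B y" v] by (simp add: y_def)
    then have "\<theta> * norm (app ?B y) \<le> \<theta> * (norm v + e)" using \<theta>(2) by (intro mult_left_mono) auto
    ultimately have big: "\<theta> * norm (app ?B y) < norm y" using e_eq by (simp add: algebra_simps)
    then have "y \<noteq> 0" using \<theta>(2) by (smt (verit) mult_nonneg_nonneg norm_ge_zero norm_zero)
    then have "app ?B y \<noteq> 0"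
      using RB[of m w] linear_0[OF bounded_linear.linear[OF is_resolventD(1)[OF R]]] unfolding y_def by metis
    then obtain i where i: "coeff (app ?B y) i \<noteq> 0" using coeff_eqI[of "app ?B y" 0] by auto
    have "top l > \<eta>" if l: "l \<ge> max 1 (max n0 i)" for l
    proof -
      obtain k where k: "k < l * l" "lin l (cand l k) = y" using cand l unfolding y_def by auto
      have l1: "l \<ge> 1" and il: "i < f l" using l f[of l] by auto
      have pos: "norm (proj (f l) (app ?B y)) > 0"
      proof -
        have "coeff (proj (f l) (app ?B y)) i \<noteq> 0" using i il by simp
        then have "proj (f l) (app ?B y) \<noteq> 0" by (metis coeff_simps(5))
        then show ?thesis by simp
      qed
      have "\<theta> * norm (proj (f l) (app ?B y)) \<le> \<theta> * norm (app ?B y)"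
        using \<theta>(2) norm_proj_le by (intro mult_left_mono)
      also have "\<dots> < norm y" by (rule big)
      finally have "\<theta> < norm y / norm (proj (f l) (app ?B y))" using pos by (simp add: pos_less_divide_eq)
      also have "\<dots> = sqrt (score (entry T) (coeff x) z l (f l) 0 (cand l k))"
        by (simp add: ratio[OF l1] k(2))
      also have "\<dots> \<le> top l"
        unfolding top_def by (intro real_sqrt_le_mono score_le_best k(1))
      finally show ?thesis using \<theta>(1) by simp
    qed
    then show "\<forall>\<^sub>F l in sequentially. \<eta> < top l"
      unfolding eventually_sequentially by blast
  next
    fix \<eta> assume \<eta>: "r < \<eta>"
    have "(\<lambda>l. r / (1 - r * (C\<^sub>1 * \<alpha> l))) \<longlonglongrightarrow> r / (1 - r * (C\<^sub>1 * 0))"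
      by (intro tendsto_intros lim) simp
    then have "(\<lambda>l. r / (1 - r * (C\<^sub>1 * \<alpha> l))) \<longlonglongrightarrow> r" by simp
    note upper = order_tendstoD(2)[OF this \<eta>]
    have "(\<lambda>l. r * (C\<^sub>1 * \<alpha> l)) \<longlonglongrightarrow> r * (C\<^sub>1 * 0)" by (intro tendsto_intros lim)
    then have "(\<lambda>l. r * (C\<^sub>1 * \<alpha> l)) \<longlonglongrightarrow> 0" by simp
    from order_tendstoD(2)[OF this, of 1]
    have "\<forall>\<^sub>F l in sequentially. r * (C\<^sub>1 * \<alpha> l) < 1" by simp
    with upper show "\<forall>\<^sub>F l in sequentially. top l < \<eta>"
      using eventually_ge_at_top[of 1]
    proof eventually_elim
      case (elim l)
      define u where "u = cand l (best (entry T) (coeff x) z l (f l) 0)"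
      define p where "p = norm (proj (f l) (app ?B (lin l u)))"
      have "norm (app ?B (lin l u)) \<le> p + C\<^sub>1 * \<alpha> l * norm (lin l u)"
      proof -
        have "norm (app ?B (lin l u)) \<le> p + norm (app ?B (lin l u) - proj (f l) (app ?B (lin l u)))"
          unfolding p_def using norm_triangle_sub by blast
        also have "\<dots> \<le> p + dispersion T (f l) l * norm (lin l u)"
          using dispersion_bound[OF T, of l "f l" z u] f[OF elim(3)] by simp
        also have "\<dots> \<le> p + C\<^sub>1 * \<alpha> l * norm (lin l u)"
          using C elim(3) unfolding admissible_constants_def by (intro add_left_mono mult_right_mono) auto
        finally show ?thesis .
      qed
      then have "r * norm (app ?B (lin l u)) \<le> r * (p + C\<^sub>1 * \<alpha> l * norm (lin l u))"
        using r by (intro mult_left_mono) auto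
      with Rr[of "app ?B (lin l u)"] have le: "norm (lin l u) * (1 - r * (C\<^sub>1 * \<alpha> l)) \<le> r * p"
        unfolding RB[symmetric] by (simp add: algebra_simps)
      have "norm (lin l u) / p \<le> r / (1 - r * (C\<^sub>1 * \<alpha> l))"
      proof (cases "p = 0")
        case True
        then show ?thesis using r elim(2) by simp
      next
        case False
        then have "p > 0" by (simp add: p_def)
        then show ?thesis using le elim(2) by (simp add: divide_le_eq le_divide_eq mult.commute)
      qed
      with elim(1) show ?case by (simp add: top_def ratio[OF elim(3)] u_def[symmetric] p_def)
    qed
  qed
qed

section \<open>The algorithms\<close>

lemma answers_Lambda1: "answers (\<lambda>q i j. Lambda1 q i j (T, x, z)) id (entry T) (coeff x) z"
  by (simp add: answers_def entry_def cinner_basis_vec)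

lemma answers_with_parameters:
  "answers (\<lambda>q i j. with_parameters Lambda1 q i j ((T, x, z), rs)) Some (entry T) (coeff x) z"
  by (simp add: answers_def entry_def cinner_basis_vec)

lemma parameters_with_parameters:
  "parameters (\<lambda>q i j. with_parameters ev q i j (A, rs)) rs"
  by (simp add: parameters_def)

lemma S_classD:
  assumes "(T, x, z) \<in> S_class f \<alpha> \<beta>"
  shows "T \<in> Omega_N" "\<exists>R. is_resolvent T z R"
  using assms by (auto simp: S_class_def Omega_N_f_def not_in_spectrum_iff)

lemma arithmetic_approximant:
  assumes f: "\<And>n. n \<ge> 1 \<Longrightarrow> f n > n"
  shows "arithmetic_algorithms \<Omega> Lambda1 [\<lambda>n. real (f n), \<alpha>] vector_of_list (approximant f)"
proof (rule arithmetic_algorithms_com[where c = "solve id"])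
  fix n :: nat and A :: input
  assume n: "n \<ge> 1"
  obtain T x z where A: "A = (T, x, z)" by (cases A)
  have "f n \<ge> n" using f[OF n] by simp
  from wp_solve[where f = f and seqs = "[\<lambda>n. real (f n), \<alpha>]" and h = id,
      OF _ _ n this answers_Lambda1[of T x z]]
  obtain t where t: "exec (\<lambda>q i j. Lambda1 q i j A) [\<lambda>n. real (f n), \<alpha>] n (solve id) (initial_store n) t"
    "nvar t 1 = n" "\<And>j. j < n \<Longrightarrow> outp t j = cand n (best (entry T) (coeff x) z n (f n) 1) j"
    unfolding wp_def A by auto
  have "map (outp t) [0..<n] = map (cand n (best (entry T) (coeff x) z n (f n) 1)) [0..<n]"
    using t(3) by simp
  then have "approximant f n A = vector_of_list (map (outp t) [0..<nvar t 1])"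
    by (simp only: t(2) vector_of_list_map approximant_def A prod.case)
  with t(1,2) show "\<exists>t. exec (\<lambda>q i j. Lambda1 q i j A) [\<lambda>n. real (f n), \<alpha>] n (solve id) (initial_store n) t \<and>
      nvar t 1 \<le> n \<and> approximant f n A = vector_of_list (map (outp t) [0..<nvar t 1])" by auto
qed

text \<open>The specifications of the real-valued programs do not determine the output; the function that
  is computed is obtained by choosing the output of some execution.\<close>

lemma arithmetic_real_output:
  fixes P :: "nat \<Rightarrow> 'a \<Rightarrow> real \<Rightarrow> bool"
  assumes run: "\<And>n A. n \<ge> 1 \<Longrightarrow> A \<in> \<Omega> \<Longrightarrow> wp (\<lambda>q i j. ev q i j A) seqs n c
    (\<lambda>t. nvar t 1 = 1 \<and> (\<exists>v. outp t 0 = of_real v \<and> P n A v)) (initial_store n)"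
  shows "\<exists>E. arithmetic_algorithms \<Omega> ev seqs real_of_list E \<and> (\<forall>n\<ge>1. \<forall>A\<in>\<Omega>. P n A (E n A))"
proof -
  let ?run = "\<lambda>n A v t. exec (\<lambda>q i j. ev q i j A) seqs n c (initial_store n) t \<and> nvar t 1 = 1 \<and>
    outp t 0 = of_real v \<and> P n A v"
  define E where "E n A = (SOME v. \<exists>t. ?run n A v t)" for n A
  have E: "\<exists>t. ?run n A (E n A) t" if "n \<ge> 1" "A \<in> \<Omega>" for n A
  proof -
    have "\<exists>v t. ?run n A v t" using run[OF that] unfolding wp_def by blast
    then show ?thesis unfolding E_def by (rule someI_ex)
  qed
  have "arithmetic_algorithms \<Omega> ev seqs real_of_list E"
  proof (rule arithmetic_algorithms_com)
    fix n :: nat and A assume n: "n \<ge> 1" and A: "A \<in> \<Omega>"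
    from E[OF this] obtain t where "?run n A (E n A) t" by blast
    then show "\<exists>t. exec (\<lambda>q i j. ev q i j A) seqs n c (initial_store n) t \<and> nvar t 1 \<le> n \<and>
        E n A = real_of_list (map (outp t) [0..<nvar t 1])"
      using n by (intro exI[of _ t]) (simp add: real_of_list_def)
  qed
  with E show ?thesis by blast
qed

lemma error_bound_approximant:
  assumes T: "T \<in> Omega_N" and f: "f n > n"
    and u: "u = cand n (best (entry T) (coeff x) z n (f n) 1)"
  shows "error_bound f \<alpha> \<beta> C\<^sub>1 C\<^sub>2 n T x z (approximant f n (T, x, z)) =
    (C\<^sub>2 * \<beta> (f n) + C\<^sub>1 * \<alpha> n * sqrt (mass n u) + sqrt (residual (entry T) (coeff x) z n (f n) 1 u)) /
      infdist z (spectrum T)"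
  using f by (simp add: error_bound_def approximant_def u mass_eq residual_eq[OF T] proj_diff)

theorem theorem2p1:
  fixes f :: "nat \<Rightarrow> nat" and \<alpha> \<beta> :: "nat \<Rightarrow> real"
  assumes "\<And>n. n \<ge> 1 \<Longrightarrow> 0 \<le> \<alpha> n" and "\<alpha> \<longlonglongrightarrow> 0"
    and "\<And>n. n \<ge> 1 \<Longrightarrow> 0 \<le> \<beta> n" and "\<beta> \<longlonglongrightarrow> 0"
    and "\<And>n. n \<ge> 1 \<Longrightarrow> f n > n"
  shows "\<exists>\<Gamma> :: nat \<Rightarrow> input \<Rightarrow> ell2.
    arithmetic_algorithms (S_class f \<alpha> \<beta>) Lambda1 [\<lambda>n. real (f n), \<alpha>] vector_of_list \<Gamma> \<and>
    (\<forall>(T, x, z) \<in> S_class f \<alpha> \<beta>.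
       (\<forall>n\<ge>1. finite {k. coeff (\<Gamma> n (T, x, z)) k \<noteq> 0}) \<and>
       (\<lambda>n. \<Gamma> n (T, x, z)) \<longlonglongrightarrow> resolvent z T x \<and>
       (\<forall>C\<^sub>1 C\<^sub>2. admissible_constants f \<alpha> \<beta> T x C\<^sub>1 C\<^sub>2 \<longrightarrow>
          (\<forall>n\<ge>1. norm (\<Gamma> n (T, x, z) - resolvent z T x)
             \<le> error_bound f \<alpha> \<beta> C\<^sub>1 C\<^sub>2 n T x z (\<Gamma> n (T, x, z))))) \<and>
    (\<exists>E :: nat \<Rightarrow> input \<times> real list \<Rightarrow> real.
       arithmetic_algorithms
         {((T, x, z), [C\<^sub>1, C\<^sub>2, infdist z (spectrum T), \<epsilon>]) | T x z C\<^sub>1 C\<^sub>2 \<epsilon>.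
            (T, x, z) \<in> S_class f \<alpha> \<beta> \<and> admissible_constants f \<alpha> \<beta> T x C\<^sub>1 C\<^sub>2 \<and> \<epsilon> > 0}
         (with_parameters Lambda1) [\<lambda>n. real (f n), \<alpha>, \<beta>] real_of_list E \<and>
       (\<forall>(T, x, z) \<in> S_class f \<alpha> \<beta>. \<forall>C\<^sub>1 C\<^sub>2. admissible_constants f \<alpha> \<beta> T x C\<^sub>1 C\<^sub>2 \<longrightarrow>
          (\<forall>\<epsilon>>0. \<forall>n\<ge>1. \<bar>E n ((T, x, z), [C\<^sub>1, C\<^sub>2, infdist z (spectrum T), \<epsilon>])
             - error_bound f \<alpha> \<beta> C\<^sub>1 C\<^sub>2 n T x z (\<Gamma> n (T, x, z))\<bar> \<le> \<epsilon>))) \<and>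
    (\<exists>E :: nat \<Rightarrow> input \<times> real list \<Rightarrow> real.
       arithmetic_algorithms
         {((T, x, z), [C\<^sub>1, C\<^sub>2, real m]) | T x z C\<^sub>1 C\<^sub>2 m.
            (T, x, z) \<in> S_class f \<alpha> \<beta> \<and> admissible_constants f \<alpha> \<beta> T x C\<^sub>1 C\<^sub>2}
         (with_parameters Lambda1) [\<lambda>n. real (f n), \<alpha>, \<beta>] real_of_list E \<and>
       (\<forall>(T, x, z) \<in> S_class f \<alpha> \<beta>. \<forall>C\<^sub>1 C\<^sub>2. admissible_constants f \<alpha> \<beta> T x C\<^sub>1 C\<^sub>2 \<longrightarrow>
          (\<forall>n\<ge>1. (\<lambda>m. E n ((T, x, z), [C\<^sub>1, C\<^sub>2, real m]))
             \<longlonglongrightarrow> error_bound f \<alpha> \<beta> C\<^sub>1 C\<^sub>2 n T x z (\<Gamma> n (T, x, z)))))"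
proof -
  let ?S = "S_class f \<alpha> \<beta>" and ?adm = "admissible_constants f \<alpha> \<beta>"
  let ?bound = "\<lambda>C\<^sub>1 C\<^sub>2 n T x z. error_bound f \<alpha> \<beta> C\<^sub>1 C\<^sub>2 n T x z (approximant f n (T, x, z))"
  let ?u = "\<lambda>n T x z. cand n (best (entry T) (coeff x) z n (f n) 1)"
  define num where "num C\<^sub>1 C\<^sub>2 n T x z = C\<^sub>2 * \<beta> (f n) + C\<^sub>1 * \<alpha> n * sqrt (mass n (?u n T x z)) +
    sqrt (residual (entry T) (coeff x) z n (f n) 1 (?u n T x z))" for C\<^sub>1 C\<^sub>2 n T x z
  define top where "top l T x z = sqrt (score (entry T) (coeff x) z l (f l) 0
    (cand l (best (entry T) (coeff x) z l (f l) 0)))" for l T x z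
  have bound_eq: "?bound C\<^sub>1 C\<^sub>2 n T x z = num C\<^sub>1 C\<^sub>2 n T x z / infdist z (spectrum T)"
    if "(T, x, z) \<in> ?S" "n \<ge> 1" for C\<^sub>1 C\<^sub>2 n T x z
  unfolding num_def by (rule error_bound_approximant[where f = f and n = n,
      OF S_classD(1)[OF that(1)] assms(5)[OF that(2)] refl])
  have fn: "f n \<ge> n" if "n \<ge> 1" for n using assms(5)[OF that] by simp
  have 1: "(\<forall>n\<ge>1. finite {k. coeff (approximant f n (T, x, z)) k \<noteq> 0}) \<and>
      (\<lambda>n. approximant f n (T, x, z)) \<longlonglongrightarrow> resolvent z T x \<and>
      (\<forall>C\<^sub>1 C\<^sub>2. ?adm T x C\<^sub>1 C\<^sub>2 \<longrightarrow>
        (\<forall>n\<ge>1. norm (approximant f n (T, x, z) - resolvent z T x) \<le> ?bound C\<^sub>1 C\<^sub>2 n T x z))"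
    if mem: "(T, x, z) \<in> ?S" for T x z
  proof -
    obtain R where T: "T \<in> Omega_N" and R: "is_resolvent T z R" using S_classD[OF mem] by blast
    obtain C\<^sub>1 C\<^sub>2 where C: "?adm T x C\<^sub>1 C\<^sub>2" using admissible_exists[OF mem assms(1,3)] by blast
    have "finite {k. coeff (approximant f n (T, x, z)) k \<noteq> 0}" for n
      by (rule finite_subset[of _ "{..<n}"]) (auto simp: approximant_def)
    moreover have "(\<lambda>n. approximant f n (T, x, z)) \<longlonglongrightarrow> R x"
      by (rule approximant_tendsto[OF T R assms(5) C assms(2,4,1)])
    moreover have "norm (approximant f n (T, x, z) - R x) \<le> ?bound D\<^sub>1 D\<^sub>2 n T x z"
      if "?adm T x D\<^sub>1 D\<^sub>2" "n \<ge> 1" for D\<^sub>1 D\<^sub>2 n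
      using error_bound_lin[OF T R that assms(5)[OF that(2)]] by (simp add: approximant_def)
    ultimately show ?thesis by (simp add: resolvent_eq[OF R])
  qed
  define P where "P n A v \<longleftrightarrow> (\<forall>T x z C\<^sub>1 C\<^sub>2 \<epsilon>. A = ((T, x, z), [C\<^sub>1, C\<^sub>2, infdist z (spectrum T), \<epsilon>]) \<longrightarrow>
    \<bar>v - num C\<^sub>1 C\<^sub>2 n T x z / infdist z (spectrum T)\<bar> \<le> \<epsilon>)" for n and A :: "input \<times> real list" and v
  \<comment> \<open>The distance is known: the tolerance \<open>\<epsilon> d / 2\<close> for each of two square roots gives accuracy \<open>\<epsilon>\<close>.\<close>
  define \<Omega>\<^sub>1 where "\<Omega>\<^sub>1 = {((T, x, z), [C\<^sub>1, C\<^sub>2, infdist z (spectrum T), \<epsilon>]) | T x z C\<^sub>1 C\<^sub>2 \<epsilon>.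
        (T, x, z) \<in> ?S \<and> ?adm T x C\<^sub>1 C\<^sub>2 \<and> \<epsilon> > 0}"
  have "\<exists>E. arithmetic_algorithms \<Omega>\<^sub>1 (with_parameters Lambda1) [\<lambda>n. real (f n), \<alpha>, \<beta>] real_of_list E \<and>
      (\<forall>n\<ge>1. \<forall>A\<in>\<Omega>\<^sub>1. P n A (E n A))"
  proof (rule arithmetic_real_output[where c = bound_known_distance])
    fix n :: nat and A :: "input \<times> real list"
    assume n: "n \<ge> 1" and "A \<in> \<Omega>\<^sub>1"
    then obtain T x z C\<^sub>1 C\<^sub>2 \<epsilon> where A: "A = ((T, x, z), [C\<^sub>1, C\<^sub>2, infdist z (spectrum T), \<epsilon>])"
      and mem: "(T, x, z) \<in> ?S" and C: "?adm T x C\<^sub>1 C\<^sub>2" and \<epsilon>: "\<epsilon> > 0"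
      unfolding \<Omega>\<^sub>1_def by blast
    obtain R where T: "T \<in> Omega_N" and R: "is_resolvent T z R" using S_classD[OF mem] by blast
    have d: "infdist z (spectrum T) > 0"
      using resolvent_onorm_pos[OF Omega_N_linear[OF T] R] by (simp add: infdist_spectrum[OF T R])
    have C1: "0 \<le> C\<^sub>1" using C by (simp add: admissible_constants_def)
    show "wp (\<lambda>q i j. with_parameters Lambda1 q i j A) [\<lambda>n. real (f n), \<alpha>, \<beta>] n bound_known_distance
        (\<lambda>t. nvar t 1 = 1 \<and> (\<exists>v. outp t 0 = of_real v \<and> P n A v)) (initial_store n)"
      unfolding A
      by (rule wp_mono[OF wp_bound_known_distance[where f = f and n = n and \<alpha> = \<alpha> and \<beta> = \<beta>,
            OF n fn[OF n] answers_with_parameters[of T x z] parameters_with_parameters C1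
            assms(1)[OF n] d \<epsilon> refl]])
        (auto simp: P_def num_def)
  qed
  then obtain E\<^sub>1 where
    E1: "arithmetic_algorithms \<Omega>\<^sub>1 (with_parameters Lambda1) [\<lambda>n. real (f n), \<alpha>, \<beta>] real_of_list E\<^sub>1"
    and PE1: "\<And>n A. n \<ge> 1 \<Longrightarrow> A \<in> \<Omega>\<^sub>1 \<Longrightarrow> P n A (E\<^sub>1 n A)" by blast
  have 2: "\<bar>E\<^sub>1 n ((T, x, z), [C\<^sub>1, C\<^sub>2, infdist z (spectrum T), \<epsilon>]) - ?bound C\<^sub>1 C\<^sub>2 n T x z\<bar> \<le> \<epsilon>"
    if "n \<ge> 1" "(T, x, z) \<in> ?S" "?adm T x C\<^sub>1 C\<^sub>2" "\<epsilon> > 0" for n T x z C\<^sub>1 C\<^sub>2 \<epsilon>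
  proof -
    have "((T, x, z), [C\<^sub>1, C\<^sub>2, infdist z (spectrum T), \<epsilon>]) \<in> \<Omega>\<^sub>1"
      unfolding \<Omega>\<^sub>1_def using that(2-4) by blast
    from PE1[OF that(1) this] show ?thesis unfolding P_def bound_eq[OF that(2,1)] by blast
  qed
  define Q where "Q n A v \<longleftrightarrow> (\<forall>T x z C\<^sub>1 C\<^sub>2 m. A = ((T, x, z), [C\<^sub>1, C\<^sub>2, real m]) \<longrightarrow>
    (\<exists>a b. v = a * b \<and> \<bar>a - num C\<^sub>1 C\<^sub>2 n T x z\<bar> \<le> 2 / real (max 1 m) \<and>
      \<bar>b - top (max 1 m) T x z\<bar> \<le> 1 / real (max 1 m)))" for n and A :: "input \<times> real list" and v
  \<comment> \<open>The distance is unknown: the numerator is multiplied by approximations of \<open>\<parallel>R\<parallel>\<close>; the level 0 is replaced by 1.\<close>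
  define \<Omega>\<^sub>2 where "\<Omega>\<^sub>2 = {((T, x, z), [C\<^sub>1, C\<^sub>2, real m]) | T x z C\<^sub>1 C\<^sub>2 m.
    (T, x, z) \<in> ?S \<and> ?adm T x C\<^sub>1 C\<^sub>2}"
  have "\<exists>E. arithmetic_algorithms \<Omega>\<^sub>2 (with_parameters Lambda1) [\<lambda>n. real (f n), \<alpha>, \<beta>] real_of_list E \<and>
      (\<forall>n\<ge>1. \<forall>A\<in>\<Omega>\<^sub>2. Q n A (E n A))"
  proof (rule arithmetic_real_output[where c = bound_in_limit])
    fix n :: nat and A :: "input \<times> real list"
    assume n: "n \<ge> 1" and "A \<in> \<Omega>\<^sub>2"
    then obtain T x z C\<^sub>1 C\<^sub>2 m where A: "A = ((T, x, z), [C\<^sub>1, C\<^sub>2, real m])"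
      and C: "?adm T x C\<^sub>1 C\<^sub>2" unfolding \<Omega>\<^sub>2_def by blast
    have C1: "0 \<le> C\<^sub>1" using C by (simp add: admissible_constants_def)
    note run = wp_bound_in_limit[where f = f and n = n and \<alpha> = \<alpha> and \<beta> = \<beta> and m = m,
        OF n fn answers_with_parameters[of T x z] parameters_with_parameters C1 assms(1)[OF n] refl refl]
    show "wp (\<lambda>q i j. with_parameters Lambda1 q i j A) [\<lambda>n. real (f n), \<alpha>, \<beta>] n bound_in_limit
        (\<lambda>t. nvar t 1 = 1 \<and> (\<exists>v. outp t 0 = of_real v \<and> Q n A v)) (initial_store n)"
      unfolding A
    proof (rule wp_mono[OF run], goal_cases)
      case (2 t)
      then obtain a b where ab: "nvar t 1 = 1" "outp t 0 = of_real (a * b)"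
        "\<bar>a - num C\<^sub>1 C\<^sub>2 n T x z\<bar> \<le> 2 / real (max 1 m)" "\<bar>b - top (max 1 m) T x z\<bar> \<le> 1 / real (max 1 m)"
        unfolding num_def top_def by blast
      then have "Q n ((T, x, z), [C\<^sub>1, C\<^sub>2, real m]) (a * b)" unfolding Q_def by auto
      with ab show ?case by blast
    qed
  qed
  then obtain E\<^sub>2 where
    E2: "arithmetic_algorithms \<Omega>\<^sub>2 (with_parameters Lambda1) [\<lambda>n. real (f n), \<alpha>, \<beta>] real_of_list E\<^sub>2"
    and QE2: "\<And>n A. n \<ge> 1 \<Longrightarrow> A \<in> \<Omega>\<^sub>2 \<Longrightarrow> Q n A (E\<^sub>2 n A)" by blast
  have 3: "(\<lambda>m. E\<^sub>2 n ((T, x, z), [C\<^sub>1, C\<^sub>2, real m])) \<longlonglongrightarrow> ?bound C\<^sub>1 C\<^sub>2 n T x z"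
    if n: "n \<ge> 1" and mem: "(T, x, z) \<in> ?S" and C: "?adm T x C\<^sub>1 C\<^sub>2" for n T x z C\<^sub>1 C\<^sub>2
  proof -
    obtain R where T: "T \<in> Omega_N" and R: "is_resolvent T z R" using S_classD[OF mem] by blast
    have "((T, x, z), [C\<^sub>1, C\<^sub>2, real m]) \<in> \<Omega>\<^sub>2" for m
      unfolding \<Omega>\<^sub>2_def using mem C by blast
    from QE2[OF n this] have "\<forall>m. \<exists>a b. E\<^sub>2 n ((T, x, z), [C\<^sub>1, C\<^sub>2, real m]) = a * b \<and>
        \<bar>a - num C\<^sub>1 C\<^sub>2 n T x z\<bar> \<le> 2 / real (max 1 m) \<and> \<bar>b - top (max 1 m) T x z\<bar> \<le> 1 / real (max 1 m)"
      unfolding Q_def by blast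
    then obtain a b where ab: "\<And>m. E\<^sub>2 n ((T, x, z), [C\<^sub>1, C\<^sub>2, real m]) = a m * b m"
      and a: "\<And>m. \<bar>a m - num C\<^sub>1 C\<^sub>2 n T x z\<bar> \<le> 2 / real (max 1 m)"
      and b: "\<And>m. \<bar>b m - top (max 1 m) T x z\<bar> \<le> 1 / real (max 1 m)" by metis
    have inv: "(\<lambda>m. c / real (max 1 m)) \<longlonglongrightarrow> 0" for c :: real
    proof (rule Lim_transform_eventually)
      show "(\<lambda>m. c / real m) \<longlonglongrightarrow> 0" by (rule lim_const_over_n)
      show "\<forall>\<^sub>F m in sequentially. c / real m = c / real (max 1 m)"
        unfolding eventually_sequentially by (intro exI[of _ 1]) (simp add: max_def)
    qed
    have "(\<lambda>m. a m - num C\<^sub>1 C\<^sub>2 n T x z) \<longlonglongrightarrow> 0"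
      by (rule Lim_null_comparison[OF _ inv[of 2]]) (simp only: real_norm_def a eventually_True)
    then have a_lim: "a \<longlonglongrightarrow> num C\<^sub>1 C\<^sub>2 n T x z" by (rule LIM_zero_cancel)
    have "(\<lambda>m. top (max 1 m) T x z) \<longlonglongrightarrow> onorm R"
    proof (rule Lim_transform_eventually)
      show "(\<lambda>m. top m T x z) \<longlonglongrightarrow> onorm R"
        unfolding top_def by (rule best_score_tendsto[OF T R assms(5) C assms(2)])
      show "\<forall>\<^sub>F m in sequentially. top m T x z = top (max 1 m) T x z"
        unfolding eventually_sequentially by (intro exI[of _ 1]) (simp add: max_def)
    qed
    moreover have "(\<lambda>m. b m - top (max 1 m) T x z) \<longlonglongrightarrow> 0"
      by (rule Lim_null_comparison[OF _ inv[of 1]]) (simp only: real_norm_def b eventually_True)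
    ultimately have "(\<lambda>m. (b m - top (max 1 m) T x z) + top (max 1 m) T x z) \<longlonglongrightarrow> 0 + onorm R"
      by (intro tendsto_add)
    then have "b \<longlonglongrightarrow> onorm R" by simp
    with a_lim have "(\<lambda>m. a m * b m) \<longlonglongrightarrow> num C\<^sub>1 C\<^sub>2 n T x z * onorm R" by (rule tendsto_mult)
    then show ?thesis unfolding ab bound_eq[OF mem n] infdist_spectrum[OF T R] by simp
  qed
  have arith: "arithmetic_algorithms ?S Lambda1 [\<lambda>n. real (f n), \<alpha>] vector_of_list (approximant f)"
    by (rule arithmetic_approximant[OF assms(5)])
  show ?thesis
    unfolding \<Omega>\<^sub>1_def[symmetric] \<Omega>\<^sub>2_def[symmetric]
  proof (intro exI[of _ "approximant f"] conjI)
    show "\<forall>(T, x, z)\<in>?S. (\<forall>n\<ge>1. finite {k. coeff (approximant f n (T, x, z)) k \<noteq> 0}) \<and>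
      (\<lambda>n. approximant f n (T, x, z)) \<longlonglongrightarrow> resolvent z T x \<and>
      (\<forall>C\<^sub>1 C\<^sub>2. ?adm T x C\<^sub>1 C\<^sub>2 \<longrightarrow>
        (\<forall>n\<ge>1. norm (approximant f n (T, x, z) - resolvent z T x) \<le> ?bound C\<^sub>1 C\<^sub>2 n T x z))"
      using 1 by blast
    show "\<exists>E. arithmetic_algorithms \<Omega>\<^sub>1 (with_parameters Lambda1) [\<lambda>n. real (f n), \<alpha>, \<beta>] real_of_list E \<and>
      (\<forall>(T, x, z) \<in> ?S. \<forall>C\<^sub>1 C\<^sub>2. ?adm T x C\<^sub>1 C\<^sub>2 \<longrightarrow> (\<forall>\<epsilon>>0. \<forall>n\<ge>1.
        \<bar>E n ((T, x, z), [C\<^sub>1, C\<^sub>2, infdist z (spectrum T), \<epsilon>]) - ?bound C\<^sub>1 C\<^sub>2 n T x z\<bar> \<le> \<epsilon>))"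
      using 2 by (intro exI[of _ E\<^sub>1] conjI E1) blast
    show "\<exists>E. arithmetic_algorithms \<Omega>\<^sub>2 (with_parameters Lambda1) [\<lambda>n. real (f n), \<alpha>, \<beta>] real_of_list E \<and>
      (\<forall>(T, x, z) \<in> ?S. \<forall>C\<^sub>1 C\<^sub>2. ?adm T x C\<^sub>1 C\<^sub>2 \<longrightarrow>
        (\<forall>n\<ge>1. (\<lambda>m. E n ((T, x, z), [C\<^sub>1, C\<^sub>2, real m])) \<longlonglongrightarrow> ?bound C\<^sub>1 C\<^sub>2 n T x z))"
      using 3 by (intro exI[of _ E\<^sub>2] conjI E2) blast
  qed (rule arith)
qed

end
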